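(* For any $v \in \mathbb{R}^{3}_1\setminus\{0\}$, there is a 2-parameter family of non-trivial soliton solutions to the curve shortening flow on the 2-dimensional hyperbolic space $\mathbb{H}^2$ (with associated vector $v$). Each soliton solution is an embedded curve $X(s)$ on $\mathbb{H}^{2}$, defined for all $s\in \mathbb{R}$. Moreover, at each end (that is, as $s\to+\infty$ and as $s\to-\infty$), the curvature function $k(s)$ tends to one of the constants $-1,0,1$.
   Context: $\mathbb{R}^3_1$ is $\mathbb{R}^3$ with the Minkowski metric $\langle u,v\rangle=-u_1v_1+u_2v_2+u_3v_3$, and $\mathbb{H}^2=\{x\in\mathbb{R}^3_1:\langle x,x\rangle=-1,\ x_1>0\}$ with the induced Riemannian metric. The Minkowski cross product $\times$ is determined by $\langle u\times v,w\rangle=\det(u,v,w)$ for all $w$. For a smooth curve $X$ in $\mathbb{H}^2$ parametrized by arc length $s$: $T=X'$ is the unit tangent field, $N=X\times T$ the unit normal field, $k=\langle T',N\rangle$ the geodesic curvature. A family $\hat X:I\times J\to\mathbb{H}^2$ ($J$ an interval, $0\in J$; everything smooth) is a curve shortening flow with initial condition $X$ if $\langle \partial_t\hat X(s,t),\hat N(s,t)\rangle=\hat k(s,t)$ and $\hat X(s,0)=X(s)$, where $\hat k(\cdot,t)$ and $\hat N(\cdot,t)$ are the geodesic curvature and unit normal field of $\hat X(\cdot,t)$. $X$ is a soliton solution to the curve shortening flow if there is such a flow of the form $\hat X(s,t)=M(t)X(s)$ with $M(t)$ a (smooth) 1-parameter family of isometries of $\mathbb{H}^2$, $M(0)=\mathrm{Id}$.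 The soliton solutions with associated vector $v$ are the arc-length parametrized curves satisfying $k(s)=\langle T(s),v\rangle$ for all $s$ in their domain; every soliton solution satisfies such an equation for some $v\in\mathbb{R}^3_1\setminus\{0\}$, and conversely. Solitons are taken to be maximally extended. A soliton is trivial if it is a geodesic ($k\equiv0$). "2-parameter family" means that, for fixed $v$, the solitons with associated vector $v$ are obtained by prescribing the initial data $(\langle X(0),v\rangle,\langle T(0),v\rangle,\langle N(0),v\rangle)=(\alpha,\tau,\eta)$ arbitrarily on the two-dimensional surface $\{-\alpha^2+\tau^2+\eta^2=\langle v,v\rangle\}$ (when $v$ is timelike or lightlike, on the part of this surface where $\alpha\neq0$ has the same sign as $\langle p,v\rangle$, $p\in\mathbb{H}^2$), these two free constants determining the soliton up to isometries of $\mathbb{H}^2$. *)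

theory Defs
  imports "HOL-Analysis.Analysis"
begin

definition mink :: "real^3 \<Rightarrow> real^3 \<Rightarrow> real" where
  "mink u v = - (u$1 * v$1) + u$2 * v$2 + u$3 * v$3"

definition H2 :: "(real^3) set" where
  "H2 = {x. mink x x = -1 \<and> x$1 > 0}"

text \<open>The explicit formula is justified by the two lemmas that follow: it is the
  unique vector representing the linear form \<open>det (u, v, _)\<close>.\<close>

definition mcross :: "real^3 \<Rightarrow> real^3 \<Rightarrow> real^3" where
  "mcross u v = vector [- (u$2 * v$3 - u$3 * v$2), u$3 * v$1 - u$1 * v$3, u$1 * v$2 - u$2 * v$1]"

lemma mink_mcross: "mink (mcross u v) w = det (vector [u, v, w] :: real^3^3)"
  by (simp add: mink_def mcross_def det_3 algebra_simps)

lemma mcross_unique: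
  assumes "\<And>w. mink c w = det (vector [u, v, w] :: real^3^3)"
  shows "c = mcross u v"
proof -
  have eq: "mink c w = mink (mcross u v) w" for w
    using assms by (simp add: mink_mcross)
  show ?thesis
    using eq[of "axis 1 1"] eq[of "axis 2 1"] eq[of "axis 3 1"]
    by (simp add: vec_eq_iff forall_3 mink_def axis_def)
qed

text \<open>Smoothness (of class \<open>C\<^sup>\<infinity>\<close>), used for open sets of Euclidean spaces only:
  all iterated directional derivatives exist and are Frechet differentiable.\<close>

primrec times_differentiable_on ::
    "nat \<Rightarrow> ('a::real_normed_vector \<Rightarrow> 'b::real_normed_vector) \<Rightarrow> 'a set \<Rightarrow> bool" where
  "times_differentiable_on 0 f S \<longleftrightarrow> continuous_on S f"
| "times_differentiable_on (Suc n) f S \<longleftrightarrow>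
     (\<forall>x\<in>S. f differentiable (at x)) \<and>
     (\<forall>h. times_differentiable_on n (\<lambda>x. frechet_derivative f (at x) h) S)"

definition smooth_on :: "'a::real_normed_vector set \<Rightarrow> ('a \<Rightarrow> 'b::real_normed_vector) \<Rightarrow> bool" where
  "smooth_on S f \<longleftrightarrow> (\<forall>n. times_differentiable_on n f S)"

definition open_interval :: "real set \<Rightarrow> bool" where
  "open_interval I \<longleftrightarrow> open I \<and> is_interval I \<and> I \<noteq> {}"

text \<open>The curves \<open>X\<^sub>t\<close> of a flow need not be parametrized by arc length, so the Frenet
  apparatus is defined for regular curves. At unit speed it reduces to \<open>T = X'\<close>,
  \<open>N = X \<times> T\<close> and \<open>k = \<langle>T', N\<rangle>\<close>.\<close>

definition speed :: "(real \<Rightarrow> real^3) \<Rightarrow> real \<Rightarrow> real" where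
  "speed X s = sqrt (mink (vector_derivative X (at s)) (vector_derivative X (at s)))"

definition unit_tangent :: "(real \<Rightarrow> real^3) \<Rightarrow> real \<Rightarrow> real^3" where
  "unit_tangent X s = (1 / speed X s) *\<^sub>R vector_derivative X (at s)"

definition unit_normal :: "(real \<Rightarrow> real^3) \<Rightarrow> real \<Rightarrow> real^3" where
  "unit_normal X s = mcross (X s) (unit_tangent X s)"

definition geodesic_curvature :: "(real \<Rightarrow> real^3) \<Rightarrow> real \<Rightarrow> real" where
  "geodesic_curvature X s =
     mink (vector_derivative (unit_tangent X) (at s)) (unit_normal X s) / speed X s"

definition regular_curve_on :: "real set \<Rightarrow> (real \<Rightarrow> real^3) \<Rightarrow> bool" where
  "regular_curve_on I X \<longleftrightarrow> open_interval I \<and> smooth_on I X \<and>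
     (\<forall>s\<in>I. X s \<in> H2 \<and> vector_derivative X (at s) \<noteq> 0)"

definition arclength_curve_on :: "real set \<Rightarrow> (real \<Rightarrow> real^3) \<Rightarrow> bool" where
  "arclength_curve_on I X \<longleftrightarrow> regular_curve_on I X \<and> (\<forall>s\<in>I. speed X s = 1)"

definition embedded_curve_on :: "real set \<Rightarrow> (real \<Rightarrow> real^3) \<Rightarrow> bool" where
  "embedded_curve_on I X \<longleftrightarrow> regular_curve_on I X \<and> (\<exists>g. homeomorphism I (X ` I) X g)"

text \<open>Isometries of the hyperboloid model, written as the Lorentz matrices that preserve \<open>H2\<close>;
  \<open>M(t) X(s)\<close> below is then matrix-vector multiplication.\<close>

definition H2_isometries :: "(real^3^3) set" where
  "H2_isometries = {A. (\<forall>x y. mink (A *v x) (A *v y) = mink x y) \<and> (\<lambda>x. A *v x) ` H2 = H2}"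

definition curve_shortening_flow ::
    "real set \<Rightarrow> (real \<Rightarrow> real^3) \<Rightarrow> real set \<Rightarrow> (real \<Rightarrow> real \<Rightarrow> real^3) \<Rightarrow> bool" where
  "curve_shortening_flow I X J Xh \<longleftrightarrow>
     open_interval J \<and> 0 \<in> J \<and>
     smooth_on (I \<times> J) (\<lambda>(s, t). Xh s t) \<and>
     (\<forall>t\<in>J. regular_curve_on I (\<lambda>s. Xh s t)) \<and>
     (\<forall>s\<in>I. \<forall>t\<in>J. mink (vector_derivative (\<lambda>t. Xh s t) (at t)) (unit_normal (\<lambda>s. Xh s t) s)
                    = geodesic_curvature (\<lambda>s. Xh s t) s) \<and>
     (\<forall>s\<in>I. Xh s 0 = X s)"

definition csf_soliton_on :: "real set \<Rightarrow> (real \<Rightarrow> real^3) \<Rightarrow> bool" where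
  "csf_soliton_on I X \<longleftrightarrow> (\<exists>J M.
     curve_shortening_flow I X J (\<lambda>s t. M t *v X s) \<and>
     smooth_on J M \<and> (\<forall>t\<in>J. M t \<in> H2_isometries) \<and> M 0 = mat 1)"

definition soliton_with_vector_on :: "real^3 \<Rightarrow> real set \<Rightarrow> (real \<Rightarrow> real^3) \<Rightarrow> bool" where
  "soliton_with_vector_on v I X \<longleftrightarrow> arclength_curve_on I X \<and>
     (\<forall>s\<in>I. geodesic_curvature X s = mink (unit_tangent X s) v)"

definition maximal_soliton :: "real^3 \<Rightarrow> real set \<Rightarrow> (real \<Rightarrow> real^3) \<Rightarrow> bool" where
  "maximal_soliton v I X \<longleftrightarrow> soliton_with_vector_on v I X \<and>
     (\<forall>J Y. soliton_with_vector_on v J Y \<and> I \<subseteq> J \<and> (\<forall>s\<in>I. Y s = X s) \<longrightarrow> J = I)"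

definition trivial_on :: "real set \<Rightarrow> (real \<Rightarrow> real^3) \<Rightarrow> bool" where
  "trivial_on I X \<longleftrightarrow> (\<forall>s\<in>I. geodesic_curvature X s = 0)"

definition initial_data :: "real^3 \<Rightarrow> (real \<Rightarrow> real^3) \<Rightarrow> real \<times> real \<times> real" where
  "initial_data v X = (mink (X 0) v, mink (unit_tangent X 0) v, mink (unit_normal X 0) v)"

text \<open>For timelike or lightlike \<open>v \<noteq> 0\<close> the sign of \<open>\<langle>p, v\<rangle>\<close> is nonzero and does not depend on
  \<open>p \<in> H2\<close>.\<close>

definition admissible_data :: "real^3 \<Rightarrow> (real \<times> real \<times> real) set" where
  "admissible_data v = {(\<alpha>, \<tau>, \<eta>). - \<alpha>\<^sup>2 + \<tau>\<^sup>2 + \<eta>\<^sup>2 = mink v v \<and>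
     (mink v v \<le> 0 \<longrightarrow> \<alpha> \<noteq> 0 \<and> (\<forall>p\<in>H2. sgn \<alpha> = sgn (mink p v)))}"

end

theory Submission
  imports Defs
begin

text \<open>The frame \<open>X, T, N\<close> of a soliton solves \<open>X' = T\<close>, \<open>T' = X + \<tau> N\<close>, \<open>N' = - \<tau> T\<close> with
  \<open>\<tau> = \<langle>T, v\<rangle>\<close>. The quadratic terms cancel in the derivative of the Euclidean norm of the frame, so
  solutions are global. The components \<open>\<alpha>, \<tau>, \<eta>\<close> of \<open>v\<close> satisfy \<open>\<alpha>' = \<tau>\<close>, \<open>\<tau>' = \<alpha> + \<tau> \<eta>\<close>,
  \<open>\<eta>' = - \<tau>\<^sup>2\<close> and \<open>- \<alpha>\<^sup>2 + \<tau>\<^sup>2 + \<eta>\<^sup>2 = \<langle>v, v\<rangle>\<close>. Unless \<open>\<alpha> = \<tau> = 0\<close>, the product \<open>\<alpha> \<tau>\<close>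
  times an integrating factor increases, so \<open>\<tau>\<close> has at most one zero. Where \<open>\<tau> > 0\<close>, either
  \<open>\<alpha>\<close> converges and \<open>\<tau> \<rightarrow> 0\<close>, or \<open>\<alpha> \<rightarrow> \<infinity>\<close>, \<open>\<eta> \<rightarrow> - \<infinity>\<close> and
  \<open>\<tau>' = (\<alpha> + \<eta>) - \<eta> (1 - \<tau>)\<close> with \<open>\<alpha> + \<eta>\<close> bounded forces \<open>\<tau> \<rightarrow> 1\<close>. In each case \<open>X\<close> leaves every
  compact set. A self-intersection would give two parameters with the same \<open>\<alpha>\<close> on either side of the
  zero of \<open>\<tau>\<close>; comparing the two branches at equal \<open>\<alpha>\<close>, the displacement between them along the
  orbits of the Killing field \<open>X \<times> v\<close> is strictly monotone, and for timelike \<open>v\<close>, when it is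
  an angle, it stays below \<open>\<pi>\<close>; if \<open>\<eta>\<close> vanishes together with \<open>\<tau>\<close>, the curve is instead
  centrally symmetric about that point. The soliton flows by the one-parameter group generated by
  \<open>x \<mapsto> x \<times> v\<close>.\<close>

subsection \<open>Global solutions of autonomous differential equations\<close>

text \<open>The Minkowski products of the frame are conserved, but the form is indefinite and bounds
  nothing; hence the use of the Euclidean norm. Embeddedness consists of injectivity and properness,
  and injectivity is the harder half. Its obstacle is that positions at different arc lengths are
  hard to compare. With the height \<alpha> as common parameter both branches become graphs, and by
  the conserved quantity the tangent of each is determined by its \<eta> and a sign. The branches
  separate as long as their two values of \<eta> have a positive sum, and this sum cannot vanish
  without a reflection symmetry of (\<alpha>, \<tau>, \<eta>). Reversal of time, and the change of
  sign of both the vector and the normal, reduce everything to \<alpha> > 0 and \<eta> \<ge> 0 at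
  the turning point. For spacelike and lightlike vectors the Killing orbits are not closed, so a
  nonzero displacement is enough; for timelike vectors they are circles, and an upper bound on the
  angle is required too.\<close>

lemma exp_growth_bound:
  fixes g :: "real \<Rightarrow> real"
  assumes "a \<le> b"
    and "\<And>t. a \<le> t \<Longrightarrow> t \<le> b \<Longrightarrow> (g has_real_derivative g' t) (at t)"
    and "\<And>t. a \<le> t \<Longrightarrow> t \<le> b \<Longrightarrow> g' t \<le> C * g t"
  shows "g b \<le> g a * exp (C * (b - a))"
proof -
  define h where "h t = g t * exp (- (C * t))" for t
  have "h a \<ge> h b"
  proof (rule DERIV_nonpos_imp_nonincreasing[OF assms(1)])
    fix t assume t: "a \<le> t" "t \<le> b"
    have "(h has_real_derivative (g' t - C * g t) * exp (- (C * t))) (at t)"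
      unfolding h_def by (auto intro!: derivative_eq_intros assms(2) t simp: algebra_simps)
    moreover have "(g' t - C * g t) * exp (- (C * t)) \<le> 0"
      using assms(3)[OF t] by (simp add: mult_le_0_iff)
    ultimately show "\<exists>y. (h has_real_derivative y) (at t) \<and> y \<le> 0" by blast
  qed
  then have "g b * exp (- (C * b)) * exp (C * b) \<le> g a * exp (- (C * a)) * exp (C * b)"
    by (simp add: h_def)
  moreover have "exp (- (C * b)) * exp (C * b) = 1" "exp (- (C * a)) * exp (C * b) = exp (C * (b - a))"
    by (simp_all add: algebra_simps flip: exp_add)
  ultimately show ?thesis by (simp only: mult.assoc mult_1_right)
qed

definition locally_lipschitz :: "('a::real_normed_vector \<Rightarrow> 'a) \<Rightarrow> bool" where
  "locally_lipschitz F \<longleftrightarrow> (\<forall>R. \<exists>L. L-lipschitz_on (cball 0 R) F)"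

text \<open>The derivative is two-sided even at the end points of a closed \<open>I\<close>, so
  restriction to any subset keeps the property verbatim.\<close>

definition solves_ode_on :: "('a::real_normed_vector \<Rightarrow> 'a) \<Rightarrow> real set \<Rightarrow> (real \<Rightarrow> 'a) \<Rightarrow> bool" where
  "solves_ode_on F I z \<longleftrightarrow> (\<forall>s\<in>I. (z has_vector_derivative F (z s)) (at s))"

lemma solves_ode_on_subset: "solves_ode_on F I z \<Longrightarrow> J \<subseteq> I \<Longrightarrow> solves_ode_on F J z"
  by (auto simp: solves_ode_on_def)

lemma solves_ode_on_continuous: "solves_ode_on F I z \<Longrightarrow> continuous_on I z"
  by (meson continuous_at_imp_continuous_on has_vector_derivative_continuous solves_ode_on_def)

lemma solves_ode_on_reflect:
  assumes "solves_ode_on F I z"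
  shows "solves_ode_on (\<lambda>x. - F x) (uminus ` I) (\<lambda>s. z (- s))"
proof -
  have "((\<lambda>s. z (- s)) has_vector_derivative - F (z (- s))) (at s)" if "- s \<in> I" for s
  proof -
    have "((z \<circ> uminus) has_vector_derivative (- 1) *\<^sub>R F (z (- s))) (at s)"
      using assms that unfolding solves_ode_on_def
      by (intro vector_diff_chain_at) (auto intro!: derivative_eq_intros)
    then show ?thesis by (simp add: o_def)
  qed
  from this[of "- s" for s] show ?thesis by (auto simp: solves_ode_on_def)
qed

lemma solves_ode_on_shift:
  assumes "solves_ode_on F I z" "\<And>s. s \<in> J \<Longrightarrow> s + c \<in> I"
  shows "solves_ode_on F J (\<lambda>s. z (s + c))"
  unfolding solves_ode_on_def
proof
  fix s assume "s \<in> J"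
  then have "(z has_vector_derivative F (z (s + c))) (at (s + c))"
    using assms by (auto simp: solves_ode_on_def)
  then have "((z \<circ> (\<lambda>s. s + c)) has_vector_derivative 1 *\<^sub>R F (z (s + c))) (at s)"
    by (intro vector_diff_chain_at) (auto intro!: derivative_eq_intros)
  then show "((\<lambda>s. z (s + c)) has_vector_derivative F (z (s + c))) (at s)"
    by (simp add: o_def)
qed

text \<open>Gronwall for the squared distance: both trajectories over \<open>{a..b}\<close> lie in
  one ball, whose Lipschitz constant \<open>L\<close> gives the growth rate
  \<open>2 * L\<close>.\<close>

lemma ode_unique_forward:
  fixes z w :: "real \<Rightarrow> 'a::real_inner"
  assumes F: "locally_lipschitz F" and ab: "a \<le> b"
    and z: "solves_ode_on F {a..b} z" and w: "solves_ode_on F {a..b} w" and "z a = w a"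
  shows "z b = w b"
proof -
  have "bounded (z ` {a..b} \<union> w ` {a..b})"
    using z w by (simp add: compact_continuous_image compact_imp_bounded solves_ode_on_continuous)
  then obtain R where R: "z ` {a..b} \<union> w ` {a..b} \<subseteq> cball 0 R"
    by (auto simp: bounded_iff subset_iff)
  obtain L where L: "L-lipschitz_on (cball 0 R) F"
    using F by (auto simp: locally_lipschitz_def)
  define g where "g t = (z t - w t) \<bullet> (z t - w t)" for t
  have "g b \<le> g a * exp (2 * L * (b - a))"
  proof (rule exp_growth_bound[OF ab])
    fix t assume t: "a \<le> t" "t \<le> b"
    have "(z has_vector_derivative F (z t)) (at t)" "(w has_vector_derivative F (w t)) (at t)"
      using z w t by (auto simp: solves_ode_on_def)
    then have "((\<lambda>t. z t - w t) has_derivative (\<lambda>h. h *\<^sub>R (F (z t) - F (w t)))) (at t)"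
      using has_vector_derivative_diff has_vector_derivative_def by blast
    from has_derivative_inner[OF this this]
    show "(g has_real_derivative 2 * ((z t - w t) \<bullet> (F (z t) - F (w t)))) (at t)"
      unfolding g_def has_field_derivative_def
      by (rule has_derivative_eq_rhs) (auto simp: inner_commute algebra_simps)
    have "(z t - w t) \<bullet> (F (z t) - F (w t)) \<le> norm (z t - w t) * norm (F (z t) - F (w t))"
      by (rule norm_cauchy_schwarz)
    also have "\<dots> \<le> norm (z t - w t) * (L * norm (z t - w t))"
      using lipschitz_onD[OF L, of "z t" "w t"] R t
      by (intro mult_left_mono) (auto simp: dist_norm image_subset_iff)
    also have "\<dots> = L * g t"
      by (simp add: g_def dot_square_norm power2_eq_square)
    finally show "2 * ((z t - w t) \<bullet> (F (z t) - F (w t))) \<le> 2 * L * g t" by simp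
  qed
  then have "g b \<le> 0" using \<open>z a = w a\<close> by (simp add: g_def)
  then have "(norm (z b - w b))\<^sup>2 \<le> 0" by (simp add: g_def dot_square_norm)
  then show ?thesis by simp
qed

lemma locally_lipschitz_minus: "locally_lipschitz F \<Longrightarrow> locally_lipschitz (\<lambda>x. - F x)"
  unfolding locally_lipschitz_def lipschitz_on_def by (simp add: dist_minus)

lemma ode_unique:
  fixes z w :: "real \<Rightarrow> 'a::real_inner"
  assumes F: "locally_lipschitz F" and I: "is_interval I" "a \<in> I" "b \<in> I"
    and z: "solves_ode_on F I z" and w: "solves_ode_on F I w" and "z a = w a"
  shows "z b = w b"
proof (cases "a \<le> b")
  case True
  have "{a..b} \<subseteq> I" using I by (meson atLeastAtMost_iff mem_is_interval_1_I subsetI)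
  then show ?thesis
    using ode_unique_forward[OF F True] z w assms(7) by (meson solves_ode_on_subset)
next
  case False
  have "{b..a} \<subseteq> I" using I by (meson atLeastAtMost_iff mem_is_interval_1_I subsetI)
  then have "{-a..-b} \<subseteq> uminus ` I" by (metis image_mono image_uminus_atLeastAtMost)
  then have "z (- (- b)) = w (- (- b))"
    using False assms(7)
    by (intro ode_unique_forward[OF locally_lipschitz_minus[OF F], of "-a" "-b" "\<lambda>s. z (- s)" "\<lambda>s. w (- s)"]
        solves_ode_on_subset[OF solves_ode_on_reflect[OF z]]
        solves_ode_on_subset[OF solves_ode_on_reflect[OF w]]) auto
  then show ?thesis by simp
qed

section \<open>Picard iteration for globally Lipschitz fields\<close>

lemma antiderivative_exists:
  fixes f :: "real \<Rightarrow> 'a::euclidean_space"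
  assumes "continuous_on UNIV f"
  obtains G where "\<And>s. (G has_vector_derivative f s) (at s)" "G c = 0"
proof -
  obtain H where H: "\<And>s. (H has_vector_derivative f s) (at s)"
    using einterval_antiderivative[of "-\<infinity>" "\<infinity>" f] assms
    by (auto simp: continuous_on_eq_continuous_at)
  have "((\<lambda>s. H s - H c) has_vector_derivative f s) (at s)" for s
    using has_vector_derivative_diff[OF H has_vector_derivative_const] by simp
  then show ?thesis using that[of "\<lambda>s. H s - H c"] by simp
qed

text \<open>This replaces integration of the bound: the comparison function has derivative
  \<open>K * t ^ n\<close>. Each application adds one power and one factor of the factorial to the
  Picard estimate.\<close>

lemma norm_le_power_of_derivative_bound:
  fixes d :: "real \<Rightarrow> 'a::euclidean_space"
  assumes d: "\<And>s. (d has_vector_derivative d' s) (at s)" "d 0 = 0"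
    and b: "\<And>s. norm (d' s) \<le> K * \<bar>s\<bar> ^ n"
  shows "norm (d s) \<le> K * \<bar>s\<bar> ^ Suc n / Suc n"
proof -
  have forward: "norm (f s) \<le> K * s ^ Suc n / Suc n"
    if f: "\<And>s. (f has_vector_derivative f' s) (at s)" "f 0 = 0"
      and b: "\<And>s. norm (f' s) \<le> K * \<bar>s\<bar> ^ n" and s: "0 < s"
    for f f' :: "real \<Rightarrow> 'a" and s
  proof -
    define \<phi> where "\<phi> t = K * t ^ Suc n / Suc n" for t
    have \<phi>: "(\<phi> has_vector_derivative K * t ^ n) (at t)" for t
      unfolding \<phi>_def has_real_derivative_iff_has_vector_derivative[symmetric]
      by (rule derivative_eq_intros refl | simp)+
    have "norm (f s - f 0) \<le> \<phi> s - \<phi> 0"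
      using f \<phi> b s
      by (intro differentiable_bound_general[where f' = f' and \<phi>' = "\<lambda>t. K * t ^ n"])
         (auto intro!: continuous_at_imp_continuous_on has_vector_derivative_continuous
           dest: order_less_imp_le, metis abs_of_pos)
    then show ?thesis using f(2) by (simp add: \<phi>_def)
  qed
  consider "s = 0" | "s > 0" | "s < 0" by linarith
  then show ?thesis
  proof cases
    case 2
    then show ?thesis using forward[OF d b, of s] by simp
  next
    case 3
    have "((\<lambda>s. d (- s)) has_vector_derivative - d' (- s)) (at s)" for s
    proof -
      have "((d \<circ> uminus) has_vector_derivative (- 1) *\<^sub>R d' (- s)) (at s)"
        using d(1) by (intro vector_diff_chain_at) (auto intro!: derivative_eq_intros)
      then show ?thesis by (simp add: o_def)
    qed
    then show ?thesis using forward[of "\<lambda>s. d (- s)" "\<lambda>s. - d' (- s)" "- s"] d(2) b[of "- t" for t] 3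
      by simp
  qed (simp add: d(2))
qed

text \<open>The integral from 0 is encoded as a chosen antiderivative vanishing at 0. It exists when
  \<open>F\<close> composed with the previous iterate is continuous, which \<open>picard_Suc\<close>
  carries along the iteration.\<close>

primrec picard :: "('a::euclidean_space \<Rightarrow> 'a) \<Rightarrow> 'a \<Rightarrow> nat \<Rightarrow> real \<Rightarrow> 'a" where
  "picard F z0 0 = (\<lambda>s. z0)"
| "picard F z0 (Suc n) =
     (\<lambda>s. z0 + (SOME G. (\<forall>t. (G has_vector_derivative F (picard F z0 n t)) (at t)) \<and> G 0 = 0) s)"

lemma picard_Suc:
  assumes "continuous_on UNIV F"
  shows "(picard F z0 (Suc n) has_vector_derivative F (picard F z0 n s)) (at s)"
    and "picard F z0 n 0 = z0"
proof -
  have *: "(\<forall>s. (picard F z0 (Suc n) has_vector_derivative F (picard F z0 n s)) (at s)) \<and>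
      picard F z0 (Suc n) 0 = z0" if "continuous_on UNIV (picard F z0 n)" for n
  proof -
    define G where "G = (SOME G. (\<forall>t. (G has_vector_derivative F (picard F z0 n t)) (at t)) \<and> G 0 = 0)"
    have "continuous_on UNIV (\<lambda>t. F (picard F z0 n t))"
      using assms that by (rule continuous_on_compose2) auto
    then have "\<exists>G. (\<forall>t. (G has_vector_derivative F (picard F z0 n t)) (at t)) \<and> G 0 = 0"
      by (metis antiderivative_exists)
    then have "(\<forall>t. (G has_vector_derivative F (picard F z0 n t)) (at t)) \<and> G 0 = 0"
      unfolding G_def by (rule someI_ex)
    then show ?thesis
      unfolding picard.simps G_def[symmetric] by (auto intro!: derivative_eq_intros)
  qed
  have cont: "continuous_on UNIV (picard F z0 n)" for n
  proof (induction n)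
    case (Suc n)
    show ?case
      using *[OF Suc] by (auto intro!: continuous_at_imp_continuous_on has_vector_derivative_continuous)
  qed auto
  show "(picard F z0 (Suc n) has_vector_derivative F (picard F z0 n s)) (at s)"
    using *[OF cont] by blast
  show "picard F z0 n 0 = z0"
    using *[OF cont] by (cases n) auto
qed

lemma picard_diff_bound:
  assumes L: "L-lipschitz_on UNIV F"
  shows "norm (picard F z0 (Suc n) s - picard F z0 n s) \<le> norm (F z0) * L ^ n * \<bar>s\<bar> ^ Suc n / fact (Suc n)"
proof (induction n arbitrary: s)
  note P = picard_Suc[OF lipschitz_on_continuous_on[OF L]]
  case 0
  have "((\<lambda>s. picard F z0 (Suc 0) s - picard F z0 0 s) has_vector_derivative F z0 - 0) (at s)" for s
    using has_vector_derivative_diff[OF P(1)[of z0 0 s] has_vector_derivative_const[of z0]] by simp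
  from norm_le_power_of_derivative_bound[OF this, of "norm (F z0)" 0]
  show ?case using P(2) by (simp del: picard.simps(2))
next
  note P = picard_Suc[OF lipschitz_on_continuous_on[OF L]]
  case (Suc n)
  have "norm (picard F z0 (Suc (Suc n)) s - picard F z0 (Suc n) s)
      \<le> (L * (norm (F z0) * L ^ n / fact (Suc n))) * \<bar>s\<bar> ^ Suc (Suc n) / Suc (Suc n)"
  proof (rule norm_le_power_of_derivative_bound)
    fix s
    show "((\<lambda>s. picard F z0 (Suc (Suc n)) s - picard F z0 (Suc n) s) has_vector_derivative
        F (picard F z0 (Suc n) s) - F (picard F z0 n s)) (at s)"
      by (intro has_vector_derivative_diff P)
    have "norm (F (picard F z0 (Suc n) s) - F (picard F z0 n s))
        \<le> L * norm (picard F z0 (Suc n) s - picard F z0 n s)"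
      using lipschitz_onD[OF L] by (metis UNIV_I dist_norm)
    also have "\<dots> \<le> L * (norm (F z0) * L ^ n * \<bar>s\<bar> ^ Suc n / fact (Suc n))"
      using Suc lipschitz_on_nonneg[OF L] by (intro mult_left_mono)
    finally show "norm (F (picard F z0 (Suc n) s) - F (picard F z0 n s))
        \<le> L * (norm (F z0) * L ^ n / fact (Suc n)) * \<bar>s\<bar> ^ Suc n" by (simp add: mult.assoc)
  qed (simp add: P(2) del: picard.simps)
  also have "\<dots> = norm (F z0) * L ^ Suc n * \<bar>s\<bar> ^ Suc (Suc n) / fact (Suc (Suc n))"
    by (simp add: field_simps)
  finally show ?case .
qed

lemma ode_exists_lipschitz:
  fixes F :: "'a::euclidean_space \<Rightarrow> 'a"
  assumes L: "L-lipschitz_on UNIV F"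
  obtains z where "solves_ode_on F UNIV z" "z 0 = z0"
proof -
  note P = picard_Suc[OF lipschitz_on_continuous_on[OF L]]
  define p where "p = picard F z0"
  define y where "y s = z0 + (\<Sum>i. p (Suc i) s - p i s)" for s
  have unif: "uniform_limit {-R<..<R} p y sequentially" for R
  proof -
    \<comment> \<open>The majorant is the exponential series of \<open>L * R\<close>; the factorial
      of \<open>Suc n\<close> is weakened to that of \<open>n\<close> to match it.\<close>
    have "uniform_limit {-R<..<R} (\<lambda>n s. \<Sum>i<n. p (Suc i) s - p i s) (\<lambda>s. \<Sum>i. p (Suc i) s - p i s) sequentially"
    proof (rule Weierstrass_m_test)
      have "summable (\<lambda>n. norm (F z0) * R * (inverse (fact n) * (L * R) ^ n))"
        using summable_exp[of "L * R"] by (rule summable_mult)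
      then show "summable (\<lambda>n. norm (F z0) * R * ((L * R) ^ n / fact n))"
        by (simp add: field_simps)
      fix n s assume s: "s \<in> {-R<..<R}"
      have L0: "0 \<le> L" using lipschitz_on_nonneg[OF L] .
      have "norm (p (Suc n) s - p n s) \<le> norm (F z0) * L ^ n * \<bar>s\<bar> ^ Suc n / fact (Suc n)"
        unfolding p_def by (rule picard_diff_bound[OF L])
      also have "\<dots> \<le> norm (F z0) * L ^ n * R ^ Suc n / fact n"
        using s L0 by (intro frac_le mult_mono power_mono mult_nonneg_nonneg) (auto simp: fact_mono)
      also have "\<dots> = norm (F z0) * R * ((L * R) ^ n / fact n)"
        by (simp add: power_mult_distrib)
      finally show "norm (p (Suc n) s - p n s) \<le> norm (F z0) * R * ((L * R) ^ n / fact n)" .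
    qed
    then have "uniform_limit {-R<..<R} (\<lambda>n s. z0 + (\<Sum>i<n. p (Suc i) s - p i s)) y sequentially"
      unfolding y_def by (intro uniform_limit_intros)
    moreover have "z0 + (\<Sum>i<n. p (Suc i) s - p i s) = p n s" for n s
      using sum_lessThan_telescope[of "\<lambda>i. p i s" n] by (simp add: p_def[THEN fun_cong, of 0])
    ultimately show ?thesis by simp
  qed
  have "(y has_vector_derivative F (y s)) (at s)" for s
  proof -
    define S where "S = {-(\<bar>s\<bar> + 1)<..<\<bar>s\<bar> + 1}"
    have lim: "(\<lambda>n. p (Suc n) x) \<longlonglongrightarrow> y x" if "x \<in> S" for x
      using tendsto_uniform_limitI[OF unif that[unfolded S_def]] LIMSEQ_Suc by blast
    \<comment> \<open>The sequence is shifted because \<open>p (Suc n)\<close> has derivative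
      \<open>F (p n)\<close>, which converges uniformly to \<open>F (y x)\<close>.\<close>
    have "\<exists>g. \<forall>x\<in>S. (\<lambda>n. p (Suc n) x) \<longlonglongrightarrow> g x \<and>
        (g has_derivative (\<lambda>h. h *\<^sub>R F (y x))) (at x within S)"
    proof (rule has_derivative_sequence)
      show "convex S" by (simp add: S_def)
      show "s \<in> S" by (auto simp: S_def)
      then show "(\<lambda>n. p (Suc n) s) \<longlonglongrightarrow> y s" by (rule lim)
      show "(p (Suc n) has_derivative (\<lambda>h. h *\<^sub>R F (p n x))) (at x within S)" if "x \<in> S" for n x
        using P(1) unfolding p_def has_vector_derivative_def
        by (rule has_derivative_at_withinI)
      fix e :: real assume "e > 0"
      \<comment> \<open>\<open>L\<close> may be 0, so \<open>L + 1\<close> serves as the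
        divisor.\<close>
      then have "e / (L + 1) > 0" using lipschitz_on_nonneg[OF L] by simp
      from uniform_limitD[OF unif this, of "\<bar>s\<bar> + 1"]
      show "\<forall>\<^sub>F n in sequentially. \<forall>x\<in>S. \<forall>h. norm (h *\<^sub>R F (p n x) - h *\<^sub>R F (y x)) \<le> e * norm h"
      proof (eventually_elim, intro ballI allI)
        fix n x and h :: real
        assume *: "\<forall>x\<in>{- (\<bar>s\<bar> + 1)<..<\<bar>s\<bar> + 1}. dist (p n x) (y x) < e / (L + 1)" and x: "x \<in> S"
        have "norm (F (p n x) - F (y x)) \<le> L * dist (p n x) (y x)"
          using lipschitz_onD[OF L] by (metis UNIV_I dist_norm)
        also have "\<dots> \<le> (L + 1) * (e / (L + 1))"
          using * x lipschitz_on_nonneg[OF L] by (intro mult_mono) (auto simp: S_def less_imp_le)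
        also have "\<dots> = e" using lipschitz_on_nonneg[OF L] by simp
        finally have "\<bar>h\<bar> * norm (F (p n x) - F (y x)) \<le> \<bar>h\<bar> * e" by (rule mult_left_mono) simp
        then show "norm (h *\<^sub>R F (p n x) - h *\<^sub>R F (y x)) \<le> e * norm h"
          by (simp add: mult.commute flip: scaleR_diff_right)
      qed
    qed
    then obtain g where g: "\<And>x. x \<in> S \<Longrightarrow> (\<lambda>n. p (Suc n) x) \<longlonglongrightarrow> g x"
        "\<And>x. x \<in> S \<Longrightarrow> (g has_derivative (\<lambda>h. h *\<^sub>R F (y x))) (at x within S)" by blast
    have "g x = y x" if "x \<in> S" for x
      using g(1)[OF that] lim[OF that] LIMSEQ_unique by blast
    moreover have "s \<in> S" "open S" by (auto simp: S_def)
    ultimately show ?thesis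
      using g(2)[of s] unfolding has_vector_derivative_def
      by (metis at_within_open has_derivative_transform)
  qed
  moreover have "y 0 = z0" using P(2) by (simp add: y_def p_def del: picard.simps)
  ultimately show ?thesis using that[of y] by (auto simp: solves_ode_on_def)
qed

section \<open>From globally to locally Lipschitz fields\<close>

text \<open>The projection is radial with a positive factor, so a bound on
  \<open>z \<bullet> F z\<close> at the projected point transfers to \<open>x\<close> by cancelling
  \<open>l\<close>.\<close>

lemma closest_point_cball_0:
  fixes x :: "'a::euclidean_space"
  assumes "B > 0"
  obtains l where "0 < l" "l \<le> 1" "closest_point (cball 0 B) x = l *\<^sub>R x"
proof (cases "x \<in> cball 0 B")
  case True
  then show ?thesis using that[of 1] by (simp add: closest_point_self)
next
  case False
  then have nx: "norm x > B" "norm x > 0" using assms by auto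
  have "(B / norm x) *\<^sub>R x = closest_point (cball 0 B) x"
  proof (rule closest_point_unique)
    show "\<forall>z\<in>cball 0 B. dist x ((B / norm x) *\<^sub>R x) \<le> dist x z"
    proof
      fix z :: 'a assume "z \<in> cball 0 B"
      then have "norm x - B \<le> dist x z"
        by (smt (verit) dist_norm mem_cball_0 norm_triangle_ineq2)
      moreover have "x - (B / norm x) *\<^sub>R x = (1 - B / norm x) *\<^sub>R x" by (simp add: algebra_simps)
      then have "dist x ((B / norm x) *\<^sub>R x) = \<bar>1 - B / norm x\<bar> * norm x"
        by (simp only: dist_norm norm_scaleR)
      then have "dist x ((B / norm x) *\<^sub>R x) = norm x - B"
        using nx by (simp add: abs_of_pos algebra_simps)
      ultimately show "dist x ((B / norm x) *\<^sub>R x) \<le> dist x z" by simp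
    qed
  qed (use assms nx in auto)
  then show ?thesis using that[of "B / norm x"] nx assms by auto
qed

text \<open>Composing \<open>F\<close> with the radial retraction onto a ball makes it globally Lipschitz and keeps
  the bound on \<open>z \<bullet> F z\<close>, so on a bounded time interval the solution never feels the truncation.\<close>

lemma ode_exists_bounded_time:
  fixes F :: "'a::euclidean_space \<Rightarrow> 'a"
  assumes F: "locally_lipschitz F" and C: "C \<ge> 0" "\<And>z. \<bar>z \<bullet> F z\<bar> \<le> C * (z \<bullet> z)"
  obtains z where "solves_ode_on F {-R..R} z" "z 0 = z0"
proof -
  \<comment> \<open>The square root bounds the norm up to time \<open>\<bar>R\<bar>\<close>; adding
    1 keeps the radius positive when \<open>z0 = 0\<close>.\<close>
  define B where "B = sqrt ((z0 \<bullet> z0) * exp (2 * C * \<bar>R\<bar>)) + 1"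
  define P where "P = closest_point (cball (0::'a) B)"
  have B: "B > 0" unfolding B_def by (smt (verit) exp_ge_zero inner_ge_zero real_sqrt_ge_zero mult_nonneg_nonneg)
  obtain L where L: "L-lipschitz_on (cball 0 B) F" using F by (auto simp: locally_lipschitz_def)
  have L0: "0 \<le> L" using lipschitz_on_nonneg[OF L] .
  have "L-lipschitz_on UNIV (\<lambda>x. F (P x))"
  proof (rule lipschitz_onI[OF _ L0])
    fix x y :: 'a
    have "P x \<in> cball 0 B" "P y \<in> cball 0 B"
      unfolding P_def using B by (intro closest_point_in_set; simp)+
    then have "dist (F (P x)) (F (P y)) \<le> L * dist (P x) (P y)" by (rule lipschitz_onD[OF L])
    also have "\<dots> \<le> L * dist x y"
      using L0 B by (intro mult_left_mono) (auto simp: P_def intro!: closest_point_lipschitz)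
    finally show "dist (F (P x)) (F (P y)) \<le> L * dist x y" .
  qed
  then obtain z where z: "solves_ode_on (\<lambda>x. F (P x)) UNIV z" "z 0 = z0"
    using ode_exists_lipschitz by blast
  have cone: "\<bar>x \<bullet> F (P x)\<bar> \<le> C * (x \<bullet> x)" for x
  proof -
    obtain l where l: "0 < l" "l \<le> 1" "P x = l *\<^sub>R x"
      using closest_point_cball_0[OF B] P_def by metis
    have "l * \<bar>x \<bullet> F (P x)\<bar> \<le> l * (l * (C * (x \<bullet> x)))"
      using C(2)[of "P x"] l by (simp add: abs_mult algebra_simps)
    then have "\<bar>x \<bullet> F (P x)\<bar> \<le> l * (C * (x \<bullet> x))" using l by simp
    also have "\<dots> \<le> 1 * (C * (x \<bullet> x))" using l C by (intro mult_right_mono) auto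
    finally show ?thesis by simp
  qed
  have growth: "w t \<bullet> w t \<le> (w 0 \<bullet> w 0) * exp (2 * C * t)"
    if w: "solves_ode_on G UNIV w" and G: "\<And>x. \<bar>x \<bullet> G x\<bar> \<le> C * (x \<bullet> x)" and "t \<ge> 0"
    for w :: "real \<Rightarrow> 'a" and G t
  proof -
    have "w t \<bullet> w t \<le> (w 0 \<bullet> w 0) * exp (2 * C * (t - 0))"
    proof (rule exp_growth_bound[OF that(3)])
      fix t
      have "(w has_derivative (\<lambda>h. h *\<^sub>R G (w t))) (at t)"
        using w unfolding solves_ode_on_def has_vector_derivative_def by blast
      from has_derivative_inner[OF this this]
      show "((\<lambda>t. w t \<bullet> w t) has_real_derivative 2 * (w t \<bullet> G (w t))) (at t)"
        unfolding has_field_derivative_def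
        by (rule has_derivative_eq_rhs) (auto simp: inner_commute algebra_simps)
      show "2 * (w t \<bullet> G (w t)) \<le> 2 * C * (w t \<bullet> w t)" using G[of "w t"] by linarith
    qed
    then show ?thesis by simp
  qed
  have bound: "norm (z s) \<le> B" if "s \<in> {-R..R}" for s
  proof -
    have "z s \<bullet> z s \<le> (z0 \<bullet> z0) * exp (2 * C * \<bar>s\<bar>)"
    proof (cases "s \<ge> 0")
      case True
      then show ?thesis using growth[OF z(1) cone True] z(2) by simp
    next
      case False
      have "solves_ode_on (\<lambda>x. - F (P x)) UNIV (\<lambda>s. z (- s))"
        using solves_ode_on_reflect[OF z(1)] by simp
      from growth[OF this, of "- s"] cone False z(2) show ?thesis by simp
    qed
    also have "\<dots> \<le> (z0 \<bullet> z0) * exp (2 * C * \<bar>R\<bar>)"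
      using that C by (intro mult_left_mono) (auto intro!: mult_left_mono)
    finally show ?thesis
      unfolding B_def norm_eq_sqrt_inner by (smt (verit) real_sqrt_le_iff)
  qed
  have "solves_ode_on F {-R..R} z"
    unfolding solves_ode_on_def
  proof
    fix s assume "s \<in> {-R..R}"
    then have "P (z s) = z s" using bound by (simp add: P_def closest_point_self)
    then show "(z has_vector_derivative F (z s)) (at s)"
      using z(1) by (metis UNIV_I solves_ode_on_def)
  qed
  then show ?thesis using z(2) that by blast
qed

theorem ode_exists_global:
  fixes F :: "'a::euclidean_space \<Rightarrow> 'a"
  assumes F: "locally_lipschitz F" and C: "C \<ge> 0" "\<And>z. \<bar>z \<bullet> F z\<bar> \<le> C * (z \<bullet> z)"
  obtains z where "solves_ode_on F UNIV z" "z 0 = z0"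
proof -
  have "\<exists>z. solves_ode_on F {-R..R} z \<and> z 0 = z0" for R
    using ode_exists_bounded_time[OF F C] by metis
  then obtain Z where Z: "\<And>R. solves_ode_on F {-R..R} (Z R)" "\<And>R. Z R 0 = z0" by metis
  \<comment> \<open>Each time is served by the solution on its own window; uniqueness makes the
    windows agree.\<close>
  define y where "y s = Z \<bar>s\<bar> s" for s
  have y: "y s = Z R s" if "\<bar>s\<bar> \<le> R" for s R
    unfolding y_def
  proof (rule ode_unique[OF F, of "{-\<bar>s\<bar>..\<bar>s\<bar>}" 0 s "Z \<bar>s\<bar>" "Z R"])
    show "solves_ode_on F {- \<bar>s\<bar>..\<bar>s\<bar>} (Z R)"
      using Z(1)[of R] by (rule solves_ode_on_subset) (use that in auto)
  qed (auto simp: Z)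
  have "(y has_vector_derivative F (y s)) (at s)" for s
  proof -
    \<comment> \<open>A window strictly larger than \<open>\<bar>s\<bar>\<close> contains a
      neighbourhood of \<open>s\<close>, on which \<open>y\<close> is a single solution.\<close>
    define R where "R = \<bar>s\<bar> + 1"
    have "(Z R has_vector_derivative F (Z R s)) (at s)"
      using Z(1)[of R] unfolding solves_ode_on_def by (rule bspec) (auto simp: R_def)
    then have "(y has_vector_derivative F (Z R s)) (at s)"
      by (rule has_vector_derivative_transform_within_open[of _ _ _ "{-R<..<R}"])
         (auto simp: R_def intro!: y[symmetric])
    then show ?thesis using y[of s R] by (simp add: R_def)
  qed
  then show ?thesis using that[of y] y[of 0 0] Z by (auto simp: solves_ode_on_def)
qed

text \<open>\<open>B x x - B y y = B x (x - y) + B (x - y) y\<close>. The frame system, the scalar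
  system and the matrix equation of the isometry group all have this linear plus quadratic
  form.\<close>

lemma locally_lipschitz_quadratic:
  assumes "bounded_linear A" "bounded_bilinear B"
  shows "locally_lipschitz (\<lambda>z. A z + B z z)"
  unfolding locally_lipschitz_def
proof
  fix R :: real
  obtain a where a: "\<And>x. norm (A x) \<le> norm x * a" "a \<ge> 0"
    using bounded_linear.nonneg_bounded[OF assms(1)] by blast
  obtain b where b: "\<And>x y. norm (B x y) \<le> norm x * norm y * b" "b \<ge> 0"
    using bounded_bilinear.nonneg_bounded[OF assms(2)] by blast
  have "(a + 2 * \<bar>R\<bar> * b)-lipschitz_on (cball 0 R) (\<lambda>z. A z + B z z)"
  proof (rule lipschitz_onI)
    fix x y :: 'a assume "x \<in> cball 0 R" "y \<in> cball 0 R"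
    then have R: "norm x \<le> \<bar>R\<bar>" "norm y \<le> \<bar>R\<bar>" by auto
    have "A x + B x x - (A y + B y y) = A (x - y) + (B x (x - y) + B (x - y) y)"
      by (simp add: bounded_linear.linear[OF assms(1)] linear_diff
          bounded_bilinear.diff_left[OF assms(2)] bounded_bilinear.diff_right[OF assms(2)])
    also have "norm \<dots> \<le> norm (A (x - y)) + (norm (B x (x - y)) + norm (B (x - y) y))"
      by (meson add_left_mono norm_triangle_ineq order_trans)
    also have "\<dots> \<le> norm (x - y) * a + (\<bar>R\<bar> * norm (x - y) * b + norm (x - y) * \<bar>R\<bar> * b)"
      using a b R by (intro add_mono order_trans[OF a(1)] order_trans[OF b(1)] mult_right_mono mult_left_mono) auto
    finally show "dist (A x + B x x) (A y + B y y) \<le> (a + 2 * \<bar>R\<bar> * b) * dist x y"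
      by (simp add: dist_norm algebra_simps)
  qed (use a b in auto)
  then show "\<exists>L. L-lipschitz_on (cball 0 R) (\<lambda>z. A z + B z z)" by blast
qed

subsection \<open>Smooth maps\<close>

lemma times_differentiable_on_cong:
  assumes "open S" "\<And>x. x \<in> S \<Longrightarrow> f x = g x" "times_differentiable_on n f S"
  shows "times_differentiable_on n g S"
  using assms(2,3)
proof (induction n arbitrary: f g)
  case 0
  then show ?case by (metis continuous_on_cong times_differentiable_on.simps(1))
next
  case (Suc n)
  have "g differentiable (at x)" if "x \<in> S" for x
    using Suc.prems that assms(1) has_derivative_transform_within_open
    unfolding times_differentiable_on.simps differentiable_def by metis
  moreover have "times_differentiable_on n (\<lambda>x. frechet_derivative g (at x) h) S" for h
  proof (rule Suc.IH)
    show "frechet_derivative f (at x) h = frechet_derivative g (at x) h" if "x \<in> S" for x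
      using frechet_derivative_transform_within_open[of f x S g] Suc.prems that assms(1) by simp
  qed (use Suc.prems in auto)
  ultimately show ?case by simp
qed

text \<open>\<open>frechet_derivative\<close> is defined by choice, so smoothness of a concrete map
  is proved by supplying an explicit derivative that agrees with it on the open set.\<close>

lemma times_differentiable_on_SucI:
  assumes "open S" "\<And>x. x \<in> S \<Longrightarrow> (f has_derivative f' x) (at x)"
    and "\<And>h. times_differentiable_on n (\<lambda>x. f' x h) S"
  shows "times_differentiable_on (Suc n) f S"
proof -
  have "f' x h = frechet_derivative f (at x) h" if "x \<in> S" for x h
    by (rule fun_cong[OF frechet_derivative_at[OF assms(2)[OF that]]])
  then have "times_differentiable_on n (\<lambda>x. frechet_derivative f (at x) h) S" for h
    by (rule times_differentiable_on_cong[OF assms(1) _ assms(3)[of h]])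
  then show ?thesis using assms(2) by (auto simp: differentiable_def)
qed

lemma times_differentiable_on_SucD: "times_differentiable_on (Suc n) f S \<Longrightarrow> times_differentiable_on n f S"
proof (induction n arbitrary: f)
  case 0
  then show ?case
    by (auto intro!: continuous_at_imp_continuous_on differentiable_imp_continuous_within)
next
  case (Suc n)
  then show ?case
    by (metis times_differentiable_on.simps(2))
qed

lemma times_differentiable_on_linear:
  assumes "bounded_linear l" "open S" "times_differentiable_on n f S"
  shows "times_differentiable_on n (\<lambda>x. l (f x)) S"
  using assms(3)
proof (induction n arbitrary: f)
  case 0
  then show ?case using assms(1) by (auto intro: bounded_linear.continuous_on)
next
  case (Suc n)
  show ?case
  proof (rule times_differentiable_on_SucI[OF assms(2)])
    fix x assume "x \<in> S"
    then have "(f has_derivative frechet_derivative f (at x)) (at x)"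
      using Suc.prems by (auto simp flip: frechet_derivative_works)
    then show "((\<lambda>x. l (f x)) has_derivative (\<lambda>h. l (frechet_derivative f (at x) h))) (at x)"
      by (rule bounded_linear.has_derivative[OF assms(1)])
  qed (use Suc in auto)
qed

lemma times_differentiable_on_add:
  assumes "open S" "times_differentiable_on n f S" "times_differentiable_on n g S"
  shows "times_differentiable_on n (\<lambda>x. f x + g x) S"
  using assms(2,3)
proof (induction n arbitrary: f g)
  case 0
  then show ?case by (auto intro: continuous_on_add)
next
  case (Suc n)
  show ?case
  proof (rule times_differentiable_on_SucI[OF assms(1)])
    fix x assume "x \<in> S"
    then have "(f has_derivative frechet_derivative f (at x)) (at x)"
      "(g has_derivative frechet_derivative g (at x)) (at x)"
      using Suc.prems by (auto simp flip: frechet_derivative_works)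
    then show "((\<lambda>x. f x + g x) has_derivative (\<lambda>h. frechet_derivative f (at x) h + frechet_derivative g (at x) h)) (at x)"
      by (rule has_derivative_add)
  qed (use Suc in auto)
qed

lemma times_differentiable_on_bilinear:
  assumes "bounded_bilinear B" "open S" "times_differentiable_on n f S" "times_differentiable_on n g S"
  shows "times_differentiable_on n (\<lambda>x. B (f x) (g x)) S"
  using assms(3,4)
proof (induction n arbitrary: f g)
  case 0
  then show ?case using assms(1) by (auto intro: bounded_bilinear.continuous_on)
next
  case (Suc n)
  show ?case
  proof (rule times_differentiable_on_SucI[OF assms(2)])
    fix x assume "x \<in> S"
    then have "(f has_derivative frechet_derivative f (at x)) (at x)"
      "(g has_derivative frechet_derivative g (at x)) (at x)"
      using Suc.prems by (auto simp flip: frechet_derivative_works)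
    then show "((\<lambda>x. B (f x) (g x)) has_derivative
        (\<lambda>h. B (f x) (frechet_derivative g (at x) h) + B (frechet_derivative f (at x) h) (g x))) (at x)"
      by (rule bounded_bilinear.FDERIV[OF assms(1)])
  next
    fix h
    show "times_differentiable_on n
        (\<lambda>x. B (f x) (frechet_derivative g (at x) h) + B (frechet_derivative f (at x) h) (g x)) S"
      using Suc.prems times_differentiable_on_SucD[OF Suc.prems(1)] times_differentiable_on_SucD[OF Suc.prems(2)]
      by (intro times_differentiable_on_add[OF assms(2)] Suc.IH) auto
  qed
qed

text \<open>Linear inner maps cover the two projections, which is what the joint smoothness of
  \<open>M t *v X s\<close> in \<open>(s, t)\<close> requires. The derivative is again of the
  composed form, so the induction closes.\<close>

lemma times_differentiable_on_compose_linear: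
  assumes "bounded_linear l" "open S" "open S'" "l ` S' \<subseteq> S" "times_differentiable_on n f S"
  shows "times_differentiable_on n (\<lambda>x. f (l x)) S'"
  using assms(5)
proof (induction n arbitrary: f)
  case 0
  then show ?case
    using assms(1,4) by (auto intro: continuous_on_compose2 linear_continuous_on)
next
  case (Suc n)
  show ?case
  proof (rule times_differentiable_on_SucI[OF assms(3)])
    fix x assume "x \<in> S'"
    then have "(f has_derivative frechet_derivative f (at (l x))) (at (l x))"
      using Suc.prems assms(4) frechet_derivative_works by auto
    then show "((\<lambda>x. f (l x)) has_derivative (\<lambda>h. frechet_derivative f (at (l x)) (l h))) (at x)"
      using bounded_linear_imp_has_derivative[OF assms(1)] by (rule has_derivative_compose[rotated])
  qed (use Suc in auto)
qed

lemma smooth_on_bilinear: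
  "bounded_bilinear B \<Longrightarrow> open S \<Longrightarrow> smooth_on S f \<Longrightarrow> smooth_on S g \<Longrightarrow> smooth_on S (\<lambda>x. B (f x) (g x))"
  by (simp add: smooth_on_def times_differentiable_on_bilinear)

lemma smooth_on_linear:
  "bounded_linear l \<Longrightarrow> open S \<Longrightarrow> smooth_on S f \<Longrightarrow> smooth_on S (\<lambda>x. l (f x))"
  by (simp add: smooth_on_def times_differentiable_on_linear)

lemma smooth_on_compose_linear:
  "bounded_linear l \<Longrightarrow> open S \<Longrightarrow> open S' \<Longrightarrow> l ` S' \<subseteq> S \<Longrightarrow> smooth_on S f \<Longrightarrow> smooth_on S' (\<lambda>x. f (l x))"
  by (simp add: smooth_on_def times_differentiable_on_compose_linear)

lemma times_differentiable_on_curve: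
  fixes X :: "real \<Rightarrow> 'a::real_normed_vector"
  assumes "open I" "\<And>s. s \<in> I \<Longrightarrow> (X has_vector_derivative Y s) (at s)" "times_differentiable_on n Y I"
  shows "times_differentiable_on (Suc n) X I"
proof (rule times_differentiable_on_SucI[OF assms(1)])
  show "(X has_derivative (\<lambda>h. h *\<^sub>R Y s)) (at s)" if "s \<in> I" for s
    using assms(2)[OF that] by (simp add: has_vector_derivative_def)
  show "times_differentiable_on n (\<lambda>s. h *\<^sub>R Y s) I" for h
    by (rule times_differentiable_on_linear[OF bounded_linear_scaleR_right assms(1,3)])
qed

lemma smooth_on_vector_derivative:
  fixes X :: "real \<Rightarrow> 'a::real_normed_vector"
  assumes "open I" "smooth_on I X"
  shows "smooth_on I (\<lambda>s. vector_derivative X (at s))"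
    and "s \<in> I \<Longrightarrow> (X has_vector_derivative vector_derivative X (at s)) (at s)"
proof -
  have X: "times_differentiable_on (Suc n) X I" for n
    using assms(2) unfolding smooth_on_def by blast
  from X[of 0] have d: "X differentiable (at s)" if "s \<in> I" for s
    using that by simp
  then show "s \<in> I \<Longrightarrow> (X has_vector_derivative vector_derivative X (at s)) (at s)"
    by (simp flip: vector_derivative_works)
  have eq: "frechet_derivative X (at s) 1 = vector_derivative X (at s)" if "s \<in> I" for s
    using frechet_derivative_eq_vector_derivative[OF d[OF that]] by simp
  have "times_differentiable_on n (\<lambda>s. frechet_derivative X (at s) 1) I" for n
    using X[of n] by simp
  from times_differentiable_on_cong[OF assms(1) eq this]
  show "smooth_on I (\<lambda>s. vector_derivative X (at s))"
    by (simp add: smooth_on_def)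
qed

text \<open>Bootstrapping: if \<open>z\<close> is \<open>n\<close> times differentiable, so is the
  right-hand side, which is the derivative of \<open>z\<close>.\<close>

lemma smooth_on_solves_quadratic_ode:
  assumes A: "bounded_linear A" and B: "bounded_bilinear B" and "open I"
    and z: "solves_ode_on (\<lambda>z. A z + B z z) I z"
  shows "smooth_on I z"
  unfolding smooth_on_def
proof
  fix n
  show "times_differentiable_on n z I"
  proof (induction n)
    case 0
    then show ?case using solves_ode_on_continuous[OF z] by simp
  next
    case (Suc n)
    show ?case
    proof (rule times_differentiable_on_curve[OF \<open>open I\<close>])
      show "(z has_vector_derivative A (z s) + B (z s) (z s)) (at s)" if "s \<in> I" for s
        using z that by (simp add: solves_ode_on_def)
      show "times_differentiable_on n (\<lambda>s. A (z s) + B (z s) (z s)) I"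
        using Suc by (intro times_differentiable_on_add times_differentiable_on_linear[OF A]
            times_differentiable_on_bilinear[OF B] \<open>open I\<close>)
    qed
  qed
qed

subsection \<open>Minkowski space\<close>

lemma vec3_eq_iff: "(x::real^3) = y \<longleftrightarrow> x$1 = y$1 \<and> x$2 = y$2 \<and> x$3 = y$3"
  by (simp add: vec_eq_iff forall_3)

lemma bounded_bilinear_mink: "bounded_bilinear mink"
proof -
  have "bilinear mink"
    by (auto simp: bilinear_def mink_def algebra_simps intro!: linearI)
  then show ?thesis by (simp add: bilinear_conv_bounded_bilinear)
qed

lemma bounded_bilinear_mcross: "bounded_bilinear mcross"
proof -
  have "bilinear mcross"
    by (auto simp: bilinear_def mcross_def vec3_eq_iff algebra_simps intro!: linearI)
  then show ?thesis by (simp add: bilinear_conv_bounded_bilinear)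
qed

lemmas mink_simps =
  bounded_bilinear.add_left[OF bounded_bilinear_mink] bounded_bilinear.add_right[OF bounded_bilinear_mink]
  bounded_bilinear.diff_left[OF bounded_bilinear_mink] bounded_bilinear.diff_right[OF bounded_bilinear_mink]
  bounded_bilinear.minus_left[OF bounded_bilinear_mink] bounded_bilinear.minus_right[OF bounded_bilinear_mink]
  bounded_bilinear.scaleR_left[OF bounded_bilinear_mink] bounded_bilinear.scaleR_right[OF bounded_bilinear_mink]
  bounded_bilinear.zero_left[OF bounded_bilinear_mink] bounded_bilinear.zero_right[OF bounded_bilinear_mink]

lemmas mcross_simps =
  bounded_bilinear.add_left[OF bounded_bilinear_mcross] bounded_bilinear.add_right[OF bounded_bilinear_mcross]
  bounded_bilinear.diff_left[OF bounded_bilinear_mcross] bounded_bilinear.diff_right[OF bounded_bilinear_mcross]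
  bounded_bilinear.minus_left[OF bounded_bilinear_mcross] bounded_bilinear.minus_right[OF bounded_bilinear_mcross]
  bounded_bilinear.scaleR_left[OF bounded_bilinear_mcross] bounded_bilinear.scaleR_right[OF bounded_bilinear_mcross]
  bounded_bilinear.zero_left[OF bounded_bilinear_mcross] bounded_bilinear.zero_right[OF bounded_bilinear_mcross]

lemma has_vector_derivative_mink:
  assumes "(f has_vector_derivative f') (at s)" "(g has_vector_derivative g') (at s)"
  shows "((\<lambda>s. mink (f s) (g s)) has_real_derivative mink (f s) g' + mink f' (g s)) (at s)"
  using bounded_bilinear.has_vector_derivative[OF bounded_bilinear_mink assms]
  by (simp add: has_real_derivative_iff_has_vector_derivative)

lemma has_vector_derivative_mcross:
  assumes "(f has_vector_derivative f') (at s)" "(g has_vector_derivative g') (at s)"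
  shows "((\<lambda>s. mcross (f s) (g s)) has_vector_derivative mcross (f s) g' + mcross f' (g s)) (at s)"
  by (rule bounded_bilinear.has_vector_derivative[OF bounded_bilinear_mcross assms])

lemma mink_commute: "mink x y = mink y x"
  by (simp add: mink_def algebra_simps)

lemma mcross_component [simp]:
  "mcross x y $ 1 = - (x$2 * y$3 - x$3 * y$2)"
  "mcross x y $ 2 = x$3 * y$1 - x$1 * y$3"
  "mcross x y $ 3 = x$1 * y$2 - x$2 * y$1"
  by (simp_all add: mcross_def)

lemma mcross_self [simp]: "mcross x x = 0"
  by (simp add: vec3_eq_iff)

lemma mcross_anticommute: "mcross x y = - mcross y x"
  by (simp add: vec3_eq_iff)

lemma mcross_mcross: "mcross (mcross x y) y = mink y y *\<^sub>R x - mink x y *\<^sub>R y"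
  by (simp add: vec3_eq_iff mink_def algebra_simps)

lemma mink_mcross_cyclic: "mink (mcross x y) z = mink (mcross y z) x"
  by (simp add: mink_def algebra_simps)

lemma mink_mcross_left [simp]: "mink (mcross x y) x = 0" "mink (mcross x y) y = 0"
  by (simp_all add: mink_def algebra_simps)

lemma mink_mcross_mcross:
  "mink (mcross x y) (mcross x y) = (mink x y)\<^sup>2 - mink x x * mink y y"
  by (simp add: mink_def power2_eq_square algebra_simps)

lemma mink_eqI: "(\<And>w. mink x w = mink y w) \<Longrightarrow> x = y"
proof -
  assume "\<And>w. mink x w = mink y w"
  from this[of "axis 1 1"] this[of "axis 2 1"] this[of "axis 3 1"] show "x = y"
    by (simp add: vec3_eq_iff mink_def axis_def)
qed

definition mframe :: "real^3 \<Rightarrow> real^3 \<Rightarrow> real^3 \<Rightarrow> bool" where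
  "mframe x t n \<longleftrightarrow> mink x x = -1 \<and> mink t t = 1 \<and> mink n n = 1 \<and>
     mink x t = 0 \<and> mink x n = 0 \<and> mink t n = 0"

definition parseval :: "real^3 \<Rightarrow> real^3 \<Rightarrow> real^3 \<Rightarrow> bool" where
  "parseval x t n \<longleftrightarrow>
     (\<forall>u w. - (mink x u * mink x w) + mink t u * mink t w + mink n u * mink n w = mink u w)"

text \<open>With the rows \<open>x, t, n\<close> in a matrix \<open>P\<close> and \<open>J = diag(-1, 1, 1)\<close>, an orthonormal frame is
  \<open>P J P\<^sup>T = J\<close> and Parseval's identity is \<open>P\<^sup>T J P = J\<close>; each says that \<open>J P\<^sup>T J\<close> is a one-sided
  inverse of \<open>P\<close>.\<close>

lemma mframe_iff_parseval: "mframe x t n \<longleftrightarrow> parseval x t n"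
proof -
  define J :: "real^3^3" where "J = vector [vector [-1, 0, 0], vector [0, 1, 0], vector [0, 0, 1]]"
  define P :: "real^3^3" where "P = vector [x, t, n]"
  have "mframe x t n \<longleftrightarrow> P ** (J ** transpose P ** J) = mat 1"
    by (auto simp: mframe_def mink_def P_def J_def vec_eq_iff forall_3 matrix_matrix_mult_def sum_3
        transpose_def mat_def algebra_simps)
  also have "\<dots> \<longleftrightarrow> (J ** transpose P ** J) ** P = mat 1"
    by (rule matrix_left_right_inverse)
  also have "\<dots> \<longleftrightarrow> parseval x t n"
  proof
    assume "(J ** transpose P ** J) ** P = mat 1"
    then show "parseval x t n"
      unfolding parseval_def
      apply (simp add: mframe_def mink_def P_def J_def vec_eq_iff forall_3 matrix_matrix_mult_def sum_3
        transpose_def mat_def)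
      apply (intro allI)
      by algebra
  next
    assume p: "parseval x t n"
    show "(J ** transpose P ** J) ** P = mat 1"
      using p[unfolded parseval_def, rule_format, of "axis 1 1" "axis 1 1"]
       p[unfolded parseval_def, rule_format, of "axis 2 1" "axis 2 1"]
       p[unfolded parseval_def, rule_format, of "axis 3 1" "axis 3 1"]
       p[unfolded parseval_def, rule_format, of "axis 1 1" "axis 2 1"]
       p[unfolded parseval_def, rule_format, of "axis 1 1" "axis 3 1"]
       p[unfolded parseval_def, rule_format, of "axis 2 1" "axis 3 1"]
      by (simp add: mink_def P_def J_def vec_eq_iff forall_3 matrix_matrix_mult_def sum_3
        transpose_def mat_def axis_def algebra_simps)
  qed
  finally show ?thesis .
qed

lemma mframe_expand:
  assumes "mframe x t n"
  shows "u = - mink x u *\<^sub>R x + mink t u *\<^sub>R t + mink n u *\<^sub>R n"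
  using assms unfolding mframe_iff_parseval parseval_def
  by (intro mink_eqI) (simp add: mink_simps)

text \<open>Reversed Cauchy-Schwarz inequality: once the squares of the first coordinates are
  substituted, the gap is a sum of three squares. Geometrically \<open>- mink x y\<close> is the
  hyperbolic cosine of the distance.\<close>

lemma H2_mink_le:
  assumes "x \<in> H2" "y \<in> H2"
  shows "mink x y \<le> -1"
proof -
  have x: "(x$1)\<^sup>2 = 1 + (x$2)\<^sup>2 + (x$3)\<^sup>2" "x$1 > 0" and y: "(y$1)\<^sup>2 = 1 + (y$2)\<^sup>2 + (y$3)\<^sup>2" "y$1 > 0"
    using assms by (auto simp: H2_def mink_def power2_eq_square)
  have "(1 + (x$2 * y$2 + x$3 * y$3))\<^sup>2 \<le> (x$1)\<^sup>2 * (y$1)\<^sup>2"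
  proof -
    have "(x$1)\<^sup>2 * (y$1)\<^sup>2 - (1 + (x$2 * y$2 + x$3 * y$3))\<^sup>2 =
      (x$2 - y$2)\<^sup>2 + (x$3 - y$3)\<^sup>2 + (x$2 * y$3 - x$3 * y$2)\<^sup>2"
      unfolding x y by (simp add: power2_eq_square algebra_simps)
    moreover have "\<dots> \<ge> 0" by simp
    ultimately show ?thesis by linarith
  qed
  then have "1 + (x$2 * y$2 + x$3 * y$3) \<le> x$1 * y$1"
    using x(2) y(2) by (metis less_imp_le mult_pos_pos power_mult_distrib power2_le_imp_le)
  then show ?thesis by (simp add: mink_def)
qed

text \<open>If \<open>y\<close> lay on the other sheet, \<open>- y\<close> would be in
  \<open>H2\<close> and have product at most -1 with \<open>x\<close>. The sign of a product thus
  tells the sheets apart.\<close>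

lemma mink_neg_imp_H2:
  assumes "x \<in> H2" "mink y y = -1" "mink x y < 0"
  shows "y \<in> H2"
proof (rule ccontr)
  assume "y \<notin> H2"
  then have "\<not> y$1 > 0" using assms(2) by (auto simp: H2_def)
  moreover have "y$1 \<noteq> 0"
  proof
    assume "y$1 = 0"
    then have "(y$2)\<^sup>2 + (y$3)\<^sup>2 = -1" using assms(2) by (simp add: mink_def power2_eq_square)
    then show False by (smt (verit) zero_le_power2)
  qed
  ultimately have "- y \<in> H2" using assms(2) by (auto simp: H2_def mink_simps)
  from H2_mink_le[OF assms(1) this] assms(3) show False by (simp add: mink_simps)
qed

lemma mink_preserving_surj:
  assumes "\<And>x y. mink (A *v x) (A *v y) = mink x y"
  shows "surj ((*v) A)"
proof -
  have "inj ((*v) A)"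
  proof (rule injI)
    fix x y assume "A *v x = A *v y"
    then have "mink x w = mink y w" for w using assms by metis
    then show "x = y" by (rule mink_eqI)
  qed
  then show ?thesis using linear_injective_imp_surjective by blast
qed

text \<open>One point staying on the upper sheet decides the sheet of all others, since their
  products with it are preserved. The image is all of \<open>H2\<close> because a form-preserving
  map is invertible.\<close>

lemma isometryI:
  assumes "\<And>x y. mink (A *v x) (A *v y) = mink x y" and p: "p \<in> H2" "A *v p \<in> H2"
  shows "A \<in> H2_isometries"
proof -
  have maps: "A *v x \<in> H2" if "x \<in> H2" for x
    using mink_neg_imp_H2[OF p(2), of "A *v x"] H2_mink_le[OF p(1) that] that
    by (auto simp: assms(1) H2_def)
  have "surj ((*v) A)" using mink_preserving_surj assms(1) by blast
  have "y \<in> (*v) A ` H2" if y: "y \<in> H2" for y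
  proof -
    obtain x where x: "y = A *v x" using \<open>surj ((*v) A)\<close> by blast
    have "mink p x \<le> -1" "mink x x = -1"
      using H2_mink_le[OF p(2) y] y by (auto simp: x assms(1) H2_def)
    then have "x \<in> H2" using mink_neg_imp_H2[OF p(1)] by simp
    then show ?thesis using x by blast
  qed
  then show ?thesis using maps assms(1) by (auto simp: H2_isometries_def)
qed

text \<open>The cross product represents the determinant, so both sides are tested against
  \<open>A *v z\<close>; \<open>det A = 1\<close> excludes a reversal of orientation.\<close>

lemma mcross_isometry:
  assumes "\<And>x y. mink (A *v x) (A *v y) = mink x y" "det A = 1"
  shows "mcross (A *v x) (A *v y) = A *v mcross x y"
proof (rule mink_eqI)
  have "surj ((*v) A)" using mink_preserving_surj assms(1) by blast
  fix w
  obtain z where z: "w = A *v z" using \<open>surj ((*v) A)\<close> by blast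
  have "(vector [A *v x, A *v y, A *v z] :: real^3^3) = vector [x, y, z] ** transpose A"
    by (simp add: vec_eq_iff forall_3 matrix_matrix_mult_def matrix_vector_mult_def sum_3 transpose_def algebra_simps)
  then have "mink (mcross (A *v x) (A *v y)) (A *v z) = mink (mcross x y) z"
    using assms(2) by (simp add: mink_mcross det_mul)
  then show "mink (mcross (A *v x) (A *v y)) w = mink (A *v mcross x y) w"
    using assms(1) z by simp
qed

subsection \<open>The Frenet system of a soliton\<close>

definition frame_field :: "real^3 \<Rightarrow> (real^3) \<times> (real^3) \<times> (real^3) \<Rightarrow> (real^3) \<times> (real^3) \<times> (real^3)" where
  "frame_field v = (\<lambda>(x, t, n). (t, x + mink t v *\<^sub>R n, - (mink t v *\<^sub>R t)))"

definition frame_lin :: "(real^3) \<times> (real^3) \<times> (real^3) \<Rightarrow> (real^3) \<times> (real^3) \<times> (real^3)" where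
  "frame_lin = (\<lambda>(x, t, n). (t, x, 0))"

text \<open>A bilinear map whose diagonal is the quadratic part of \<open>frame_field\<close>; local
  Lipschitz continuity and smoothness are proved for fields split in this way.\<close>

definition frame_bil :: "real^3 \<Rightarrow> (real^3) \<times> (real^3) \<times> (real^3) \<Rightarrow> (real^3) \<times> (real^3) \<times> (real^3) \<Rightarrow> (real^3) \<times> (real^3) \<times> (real^3)" where
  "frame_bil v = (\<lambda>(x, t, n) (x', t', n'). (0, mink t v *\<^sub>R n', - (mink t v *\<^sub>R t')))"

lemma frame_field_eq: "frame_field v = (\<lambda>z. frame_lin z + frame_bil v z z)"
  by (auto simp: frame_field_def frame_lin_def frame_bil_def)

lemma bounded_linear_frame_lin: "bounded_linear frame_lin"
  unfolding linear_conv_bounded_linear[symmetric]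
  by (rule linearI) (auto simp: frame_lin_def split: prod.splits)

lemma bounded_bilinear_frame_bil: "bounded_bilinear (frame_bil v)"
proof -
  have "bilinear (frame_bil v)"
    by (auto simp: bilinear_def frame_bil_def mink_simps algebra_simps intro!: linearI split: prod.splits)
  then show ?thesis by (simp add: bilinear_conv_bounded_bilinear)
qed

lemma locally_lipschitz_frame_field: "locally_lipschitz (frame_field v)"
  unfolding frame_field_eq
  by (rule locally_lipschitz_quadratic[OF bounded_linear_frame_lin bounded_bilinear_frame_bil])

lemma solves_frame_field_iff:
  "solves_ode_on (frame_field v) I (\<lambda>s. (X s, T s, N s)) \<longleftrightarrow>
    (\<forall>s\<in>I. (X has_vector_derivative T s) (at s) \<and>
      (T has_vector_derivative X s + mink (T s) v *\<^sub>R N s) (at s) \<and>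
      (N has_vector_derivative - (mink (T s) v *\<^sub>R T s)) (at s))"
proof -
  have "((\<lambda>s. (f s, g s, h s)) has_vector_derivative (f', g', h')) (at s) \<longleftrightarrow>
    (f has_vector_derivative f') (at s) \<and> (g has_vector_derivative g') (at s) \<and> (h has_vector_derivative h') (at s)"
    for f g h :: "real \<Rightarrow> real^3" and f' g' h' s
  proof
    assume *: "((\<lambda>s. (f s, g s, h s)) has_vector_derivative (f', g', h')) (at s)"
    show "(f has_vector_derivative f') (at s) \<and> (g has_vector_derivative g') (at s) \<and> (h has_vector_derivative h') (at s)"
      using bounded_linear.has_vector_derivative[OF bounded_linear_fst *]
        bounded_linear.has_vector_derivative[OF bounded_linear_fst[THEN bounded_linear_compose, OF bounded_linear_snd] *]
        bounded_linear.has_vector_derivative[OF bounded_linear_snd[THEN bounded_linear_compose, OF bounded_linear_snd] *]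
      by simp
  qed (auto intro!: has_vector_derivative_Pair)
  then show ?thesis by (simp add: solves_ode_on_def frame_field_def)
qed

lemma frame_field_exists:
  obtains X T N where "solves_ode_on (frame_field v) UNIV (\<lambda>s. (X s, T s, N s))"
    "X s0 = x" "T s0 = t" "N s0 = n"
proof -
  have "\<bar>z \<bullet> frame_field v z\<bar> \<le> 1 * (z \<bullet> z)" for z
  proof -
    obtain a b c where z: "z = (a, b, c)" by (cases z)
    have "z \<bullet> frame_field v z = 2 * (a \<bullet> b)"
      by (simp add: z frame_field_def inner_add_right inner_commute)
    moreover have "\<bar>2 * (a \<bullet> b)\<bar> \<le> a \<bullet> a + (b \<bullet> b + c \<bullet> c)"
      using inner_ge_zero[of "a - b"] inner_ge_zero[of "a + b"] inner_ge_zero[of c]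
      unfolding inner_diff inner_add inner_commute[of b a] by linarith
    ultimately show ?thesis by (simp add: z)
  qed
  then obtain z where z: "solves_ode_on (frame_field v) UNIV z" "z 0 = (x, t, n)"
    using ode_exists_global[OF locally_lipschitz_frame_field, of 1] by (metis zero_le_one)
  have "solves_ode_on (frame_field v) UNIV (\<lambda>s. z (s + (- s0)))"
    by (rule solves_ode_on_shift[OF z(1)]) simp
  then show ?thesis
    using that[of "\<lambda>s. fst (z (s + (- s0)))" "\<lambda>s. fst (snd (z (s + (- s0))))" "\<lambda>s. snd (snd (z (s + (- s0))))"] z(2)
    by simp
qed

text \<open>The parameter \<open>\<epsilon> = \<plusminus>1\<close> records the orientation of the frame; it makes the symmetries
  below available.\<close>

definition soliton_frame ::
    "real^3 \<Rightarrow> real \<Rightarrow> real set \<Rightarrow> (real \<Rightarrow> real^3) \<Rightarrow> (real \<Rightarrow> real^3) \<Rightarrow> (real \<Rightarrow> real^3) \<Rightarrow> bool" where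
  "soliton_frame v \<epsilon> I X T N \<longleftrightarrow> solves_ode_on (frame_field v) I (\<lambda>s. (X s, T s, N s)) \<and>
     (\<forall>s\<in>I. X s \<in> H2 \<and> mframe (X s) (T s) (N s) \<and> N s = \<epsilon> *\<^sub>R mcross (X s) (T s))"

lemma soliton_frame_derivs:
  assumes "soliton_frame v \<epsilon> I X T N" "s \<in> I"
  shows "(X has_vector_derivative T s) (at s)"
    "(T has_vector_derivative X s + mink (T s) v *\<^sub>R N s) (at s)"
    "(N has_vector_derivative - (mink (T s) v *\<^sub>R T s)) (at s)"
  using assms by (auto simp: soliton_frame_def solves_frame_field_iff)

lemma mframe_mcross:
  assumes "mink x x = -1" "mink t t = 1" "mink x t = 0"
  shows "mframe x t (mcross x t)"
  using assms by (simp add: mframe_def mink_mcross_mcross mink_commute[of x "mcross x t"] mink_commute[of t "mcross x t"])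

lemma mframe_mcross_eq:
  assumes "mframe x t n"
  shows "mcross x t = mink (mcross x t) n *\<^sub>R n"
  using mframe_expand[OF assms, of "mcross x t"]
  by (simp add: mink_commute[of x "mcross x t"] mink_commute[of t "mcross x t"] mink_commute[of n "mcross x t"])

lemma mcross_mcross_right: "mcross x (mcross x y) = mink x x *\<^sub>R y - mink x y *\<^sub>R x"
  by (simp add: vec3_eq_iff mink_def algebra_simps)

lemma mframe_mcross_normal:
  assumes "mframe x t n"
  shows "mcross x (mcross x t) = - t"
  using assms mcross_mcross_right[of x t] by (simp add: mframe_def)

lemma equal_values_of_zero_derivative:
  fixes f :: "real \<Rightarrow> real"
  assumes "is_interval I" "\<And>s. s \<in> I \<Longrightarrow> (f has_real_derivative 0) (at s)" "a \<in> I" "b \<in> I"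
  shows "f a = f b"
proof -
  have "\<exists>c. \<forall>x\<in>I. f x = c"
    using assms(1,2) by (intro has_field_derivative_zero_constant)
      (auto simp: is_interval_convex intro: has_field_derivative_at_within)
  then show ?thesis using assms(3,4) by auto
qed

text \<open>Switching sheets would force a zero of the first coordinate, where the form is a sum of
  two squares and cannot be -1.\<close>

lemma H2_continuous:
  fixes X :: "real \<Rightarrow> real^3"
  assumes "is_interval I" "continuous_on I X" "\<And>s. s \<in> I \<Longrightarrow> mink (X s) (X s) = -1"
    and "a \<in> I" "X a \<in> H2" "b \<in> I"
  shows "X b \<in> H2"
proof (rule ccontr)
  assume "X b \<notin> H2"
  then have "X b $ 1 \<le> 0" "0 \<le> X a $ 1" using assms by (auto simp: H2_def)
  moreover have "connected ((\<lambda>s. X s $ 1) ` I)"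
    using assms(1,2) by (intro connected_continuous_image continuous_intros) (auto simp: is_interval_connected)
  ultimately have "0 \<in> (\<lambda>s. X s $ 1) ` I"
    using assms(4,6) by (meson connectedD_interval imageI)
  then obtain c where c: "c \<in> I" "X c $ 1 = 0" by auto
  then have "(X c $ 2)\<^sup>2 + (X c $ 3)\<^sup>2 = -1"
    using assms(3)[of c] by (simp add: mink_def power2_eq_square)
  then show False by (smt (verit) zero_le_power2)
qed

text \<open>Differentiating the orthonormality relations would give a coupled linear system for the
  products. In Parseval's form with fixed \<open>u\<close> and \<open>w\<close> the derivative is
  identically zero, so the relation is simply conserved; the orientation is conserved as the triple
  product of the frame.\<close>

lemma soliton_frameI:
  assumes I: "is_interval I" "s0 \<in> I" and sol: "solves_ode_on (frame_field v) I (\<lambda>s. (X s, T s, N s))"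
    and 0: "X s0 \<in> H2" "mframe (X s0) (T s0) (N s0)" "N s0 = \<epsilon> *\<^sub>R mcross (X s0) (T s0)"
  shows "soliton_frame v \<epsilon> I X T N"
proof -
  note d = sol[unfolded solves_frame_field_iff, rule_format]
  have par: "parseval (X s) (T s) (N s)" if "s \<in> I" for s
    unfolding parseval_def
  proof (intro allI)
    fix u w
    define f where "f s = - (mink (X s) u * mink (X s) w) + mink (T s) u * mink (T s) w + mink (N s) u * mink (N s) w" for s
    have "f s = f s0"
    proof (rule equal_values_of_zero_derivative[OF I(1) _ \<open>s \<in> I\<close> I(2)])
      fix s assume s: "s \<in> I"
      note has_vector_derivative_mink[OF _ has_vector_derivative_const, derivative_intros]
      show "(f has_real_derivative 0) (at s)"
        unfolding f_def
        by (rule derivative_eq_intros d[OF s, THEN conjunct1] d[OF s, THEN conjunct2, THEN conjunct1]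
            d[OF s, THEN conjunct2, THEN conjunct2] refl)+ (simp add: mink_simps algebra_simps)
    qed
    then show "- (mink (X s) u * mink (X s) w) + mink (T s) u * mink (T s) w + mink (N s) u * mink (N s) w = mink u w"
      using 0(2) by (simp add: f_def mframe_iff_parseval parseval_def)
  qed
  then have fr: "mframe (X s) (T s) (N s)" if "s \<in> I" for s using that by (simp add: mframe_iff_parseval)
  have nn: "mink (N s) (N s) = 1" if "s \<in> I" for s using fr[OF that] by (simp add: mframe_def)
  have \<epsilon>: "\<epsilon>\<^sup>2 = 1"
  proof -
    have "mink (mcross (X s0) (T s0)) (mcross (X s0) (T s0)) = 1"
      using 0(2) by (simp add: mframe_def mink_mcross_mcross)
    then show ?thesis using nn[OF I(2)] 0(3) by (simp add: mink_simps power2_eq_square)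
  qed
  have "mink (mcross (X s) (T s)) (N s) = mink (mcross (X s0) (T s0)) (N s0)" if "s \<in> I" for s
  proof (rule equal_values_of_zero_derivative[OF I(1) _ \<open>s \<in> I\<close> I(2)])
    fix s assume s: "s \<in> I"
    note dd = d[OF s, THEN conjunct1] d[OF s, THEN conjunct2, THEN conjunct1]
            d[OF s, THEN conjunct2, THEN conjunct2]
    show "((\<lambda>s. mink (mcross (X s) (T s)) (N s)) has_real_derivative 0) (at s)"
      using has_vector_derivative_mink[OF has_vector_derivative_mcross[OF dd(1,2)] dd(3)]
      by (simp add: mink_simps mcross_simps)
  qed
  moreover have "mink (mcross (X s0) (T s0)) (N s0) = \<epsilon>"
    using 0(2) unfolding 0(3) by (simp add: mframe_def mink_mcross_mcross mink_simps)
  ultimately have "\<epsilon> *\<^sub>R mcross (X s) (T s) = N s" if "s \<in> I" for s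
    using mframe_mcross_eq[OF fr[OF that]] that \<epsilon>
    by (metis power2_eq_square scaleR_one scaleR_scaleR)
  moreover have "continuous_on I X"
    using d by (auto intro!: continuous_at_imp_continuous_on has_vector_derivative_continuous)
  then have "X s \<in> H2" if "s \<in> I" for s
    using that using fr H2_continuous[of I X s0 s] I 0(1) by (auto simp: mframe_def)
  ultimately show ?thesis using sol fr by (simp add: soliton_frame_def)
qed

lemma soliton_frame_exists:
  assumes "x \<in> H2" "mframe x t n" "n = \<epsilon> *\<^sub>R mcross x t"
  obtains X T N where "soliton_frame v \<epsilon> UNIV X T N" "X s0 = x" "T s0 = t" "N s0 = n"
proof -
  obtain X T N where "solves_ode_on (frame_field v) UNIV (\<lambda>s. (X s, T s, N s))"
    "X s0 = x" "T s0 = t" "N s0 = n" by (rule frame_field_exists)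
  moreover from this assms have "soliton_frame v \<epsilon> UNIV X T N"
    by (intro soliton_frameI[of UNIV s0]) auto
  ultimately show ?thesis using that by blast
qed

lemma soliton_frame_unique:
  assumes "soliton_frame v \<epsilon> I X T N" "soliton_frame v \<epsilon>' I X' T' N'" "is_interval I" "a \<in> I" "b \<in> I"
    and "X a = X' a" "T a = T' a" "N a = N' a"
  shows "X b = X' b" "T b = T' b" "N b = N' b"
  using ode_unique[OF locally_lipschitz_frame_field assms(3-5), of v "\<lambda>s. (X s, T s, N s)" "\<lambda>s. (X' s, T' s, N' s)"] assms
  by (auto simp: soliton_frame_def)

section \<open>Solitons as solutions of the frame system\<close>

lemma unit_speed_curve:
  assumes "open I" "\<And>s. s \<in> I \<Longrightarrow> (X has_vector_derivative T s) (at s)" "\<And>s. s \<in> I \<Longrightarrow> mink (T s) (T s) = 1"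
    and "s \<in> I"
  shows "speed X s = 1" "unit_tangent X s = T s" "unit_normal X s = mcross (X s) (T s)"
    "(T has_vector_derivative T') (at s) \<Longrightarrow> geodesic_curvature X s = mink T' (mcross (X s) (T s))"
proof -
  have sp: "speed X s = 1" if "s \<in> I" for s
    using vector_derivative_at[OF assms(2)[OF that]] assms(3)[OF that] by (simp add: speed_def)
  have ut: "unit_tangent X s = T s" if "s \<in> I" for s
    using vector_derivative_at[OF assms(2)[OF that]] sp[OF that] by (simp add: unit_tangent_def)
  show "speed X s = 1" "unit_tangent X s = T s" using sp ut assms(4) by auto
  then show un: "unit_normal X s = mcross (X s) (T s)" by (simp add: unit_normal_def)
  assume "(T has_vector_derivative T') (at s)"
  then have "(unit_tangent X has_vector_derivative T') (at s)"
    by (rule has_vector_derivative_transform_within_open[OF _ assms(1,4)]) (simp add: ut)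
  then show "geodesic_curvature X s = mink T' (mcross (X s) (T s))"
    using sp[OF assms(4)] un by (simp add: geodesic_curvature_def vector_derivative_at)
qed

lemma soliton_frame_smooth:
  assumes "soliton_frame v \<epsilon> I X T N" "open I"
  shows "smooth_on I X" "smooth_on I T" "smooth_on I N"
proof -
  have z: "smooth_on I (\<lambda>s. (X s, T s, N s))"
    using assms smooth_on_solves_quadratic_ode[OF bounded_linear_frame_lin bounded_bilinear_frame_bil, of I v]
    by (simp add: soliton_frame_def frame_field_eq)
  show "smooth_on I X" "smooth_on I T" "smooth_on I N"
    using smooth_on_linear[OF bounded_linear_fst assms(2) z]
      smooth_on_linear[OF bounded_linear_fst[THEN bounded_linear_compose, OF bounded_linear_snd] assms(2) z]
      smooth_on_linear[OF bounded_linear_snd[THEN bounded_linear_compose, OF bounded_linear_snd] assms(2) z]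
    by simp_all
qed

lemma soliton_frame_imp_soliton:
  assumes "soliton_frame v 1 I X T N" "open_interval I"
  shows "soliton_with_vector_on v I X"
    and "s \<in> I \<Longrightarrow> unit_tangent X s = T s"
    and "s \<in> I \<Longrightarrow> unit_normal X s = N s"
    and "s \<in> I \<Longrightarrow> geodesic_curvature X s = mink (T s) v"
proof -
  have I: "open I" using assms(2) by (simp add: open_interval_def)
  note d = soliton_frame_derivs[OF assms(1)]
  have fr: "mframe (X s) (T s) (N s)" "N s = mcross (X s) (T s)" "X s \<in> H2" if "s \<in> I" for s
    using assms(1) that by (auto simp: soliton_frame_def)
  then have tt: "mink (T s) (T s) = 1" if "s \<in> I" for s using that by (simp add: mframe_def)
  note c = unit_speed_curve[OF I d(1) tt]
  show ut: "unit_tangent X s = T s" if "s \<in> I" for s using c that by blast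
  show "unit_normal X s = N s" if "s \<in> I" for s using c that fr by metis
  show k: "geodesic_curvature X s = mink (T s) v" if "s \<in> I" for s
    using c(4)[OF _ _ that d(2)[OF that]] fr[OF that] by (simp add: that mframe_def mink_simps)
  have "vector_derivative X (at s) \<noteq> 0" if "s \<in> I" for s
    using vector_derivative_at[OF d(1)[OF that]] tt[OF that] by (auto simp: mink_simps)
  then show "soliton_with_vector_on v I X"
    using assms(2) fr soliton_frame_smooth(1)[OF assms(1) I] c(1) k ut
    by (auto simp: soliton_with_vector_on_def arclength_curve_on_def regular_curve_on_def)
qed

text \<open>Differentiating the constants \<open>mink X X\<close>, \<open>mink T T\<close> and
  \<open>mink X T\<close> yields the components of \<open>T'\<close> along \<open>X\<close> and
  \<open>T\<close>; the component along \<open>N\<close> is the curvature, given by the soliton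
  equation.\<close>

lemma soliton_imp_soliton_frame:
  assumes "soliton_with_vector_on v I X"
  shows "soliton_frame v 1 I X (unit_tangent X) (unit_normal X)"
proof -
  have I: "open I" and smooth: "smooth_on I X" and H: "\<And>s. s \<in> I \<Longrightarrow> X s \<in> H2"
    and sp: "\<And>s. s \<in> I \<Longrightarrow> speed X s = 1"
    and k: "\<And>s. s \<in> I \<Longrightarrow> geodesic_curvature X s = mink (unit_tangent X s) v"
    using assms by (auto simp: soliton_with_vector_on_def arclength_curve_on_def regular_curve_on_def open_interval_def)
  define T where "T s = vector_derivative X (at s)" for s
  have dX: "(X has_vector_derivative T s) (at s)" if "s \<in> I" for s
    unfolding T_def by (rule smooth_on_vector_derivative(2)[OF I smooth that])
  have tt: "mink (T s) (T s) = 1" if "s \<in> I" for s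
    using sp[OF that] by (simp add: speed_def T_def)
  have dT: "(T has_vector_derivative vector_derivative T (at s)) (at s)" if "s \<in> I" for s
    using smooth_on_vector_derivative(2)[OF I smooth_on_vector_derivative(1)[OF I smooth] that] unfolding T_def .
  note c = unit_speed_curve[OF I dX tt]
  define N where "N s = mcross (X s) (T s)" for s
  have const: "mink (F s) G + mink G (F s) = 0"
    if F: "\<And>s. s \<in> I \<Longrightarrow> mink (F s) (F s) = c" "(F has_vector_derivative G) (at s)" "s \<in> I"
    for F :: "real \<Rightarrow> real^3" and G s c
  proof -
    have "((\<lambda>s. c) has_real_derivative mink (F s) G + mink G (F s)) (at s)"
      by (rule has_field_derivative_transform_within_open[OF has_vector_derivative_mink[OF F(2) F(2)] I F(3) F(1)])
    then show ?thesis using DERIV_const DERIV_unique by blast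
  qed
  have xt: "mink (X s) (T s) = 0" if "s \<in> I" for s
    using const[of X "-1" "T s" s] dX[OF that] that H by (simp add: H2_def mink_commute[of "T s" "X s"])
  have tt': "mink (T s) (vector_derivative T (at s)) = 0" if "s \<in> I" for s
    using const[of T 1 "vector_derivative T (at s)" s] dT[OF that] that tt by (simp add: mink_commute[of "vector_derivative T (at s)" "T s"])
  have xt': "mink (X s) (vector_derivative T (at s)) = -1" if "s \<in> I" for s
  proof -
    have "((\<lambda>s. 0) has_real_derivative mink (X s) (vector_derivative T (at s)) + mink (T s) (T s)) (at s)"
      by (rule has_field_derivative_transform_within_open[OF has_vector_derivative_mink[OF dX dT] I that xt]) (use that in auto)
    then have "mink (X s) (vector_derivative T (at s)) + mink (T s) (T s) = 0" using DERIV_const DERIV_unique by blast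
    then show ?thesis using tt[OF that] by simp
  qed
  have fr: "mframe (X s) (T s) (N s)" if "s \<in> I" for s
    unfolding N_def using H[OF that] tt[OF that] xt[OF that] by (intro mframe_mcross) (auto simp: H2_def)
  have dT': "vector_derivative T (at s) = X s + mink (T s) v *\<^sub>R N s" if "s \<in> I" for s
  proof -
    have "mink (vector_derivative T (at s)) (N s) = mink (T s) v"
      using c(4)[OF _ _ that dT[OF that]] k[OF that] c(2)[OF _ _ that] that by (simp add: N_def)
    then show ?thesis
      using mframe_expand[OF fr[OF that], of "vector_derivative T (at s)"] tt'[OF that] xt'[OF that]
      by (simp add: mink_commute[of "N s" "vector_derivative T (at s)"])
  qed
  \<comment> \<open>\<open>N' = X \<times> T'\<close>, where only the \<open>N\<close>-part of
    \<open>T'\<close> contributes, through \<open>X \<times> (X \<times> T) = - T\<close>.\<close>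
  have dN: "(N has_vector_derivative - (mink (T s) v *\<^sub>R T s)) (at s)" if "s \<in> I" for s
    using has_vector_derivative_mcross[OF dX[OF that] dT[OF that]] mframe_mcross_normal[OF fr[OF that]]
    unfolding N_def[symmetric] by (simp add: dT'[OF that] mcross_simps N_def[abs_def])
  have "(T has_vector_derivative X s + mink (T s) v *\<^sub>R N s) (at s)" if "s \<in> I" for s
    using dT[OF that] dT'[OF that] by simp
  moreover have "N s = 1 *\<^sub>R mcross (X s) (T s)" for s by (simp add: N_def)
  ultimately have sf: "soliton_frame v 1 I X T N"
    unfolding soliton_frame_def solves_frame_field_iff using dX dN H fr by blast
  have *: "unit_tangent X s = T s" "unit_normal X s = N s" if "s \<in> I" for s
    using c(2,3) that by (auto simp: N_def)
  have "(unit_tangent X has_vector_derivative D) (at s)" if "(T has_vector_derivative D) (at s)" "s \<in> I" for s D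
    by (rule has_vector_derivative_transform_within_open[OF that(1) I that(2)]) (simp add: *)
  moreover have "(unit_normal X has_vector_derivative D) (at s)" if "(N has_vector_derivative D) (at s)" "s \<in> I" for s D
    by (rule has_vector_derivative_transform_within_open[OF that(1) I that(2)]) (simp add: *)
  ultimately show ?thesis
    using sf * unfolding soliton_frame_def solves_frame_field_iff by auto
qed

lemma open_interval_UNIV: "open_interval UNIV"
  by (simp add: open_interval_def)

text \<open>The frame solution through a point of the curve exists for all time and agrees with the
  curve on \<open>I\<close> by uniqueness, so it is an extension, and maximality forbids a proper
  one.\<close>

lemma maximal_soliton_UNIV:
  assumes "maximal_soliton v I X"
  shows "I = UNIV"
proof -
  have sol: "soliton_with_vector_on v I X" and I: "open_interval I"
    using assms by (auto simp: maximal_soliton_def soliton_with_vector_on_def arclength_curve_on_def regular_curve_on_def)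
  then obtain s0 where s0: "s0 \<in> I" by (auto simp: open_interval_def)
  note sf = soliton_imp_soliton_frame[OF sol]
  from sf s0 have 0: "X s0 \<in> H2" "mframe (X s0) (unit_tangent X s0) (unit_normal X s0)"
    "unit_normal X s0 = 1 *\<^sub>R mcross (X s0) (unit_tangent X s0)"
    unfolding soliton_frame_def by blast+
  obtain Y T N where Y: "soliton_frame v 1 UNIV Y T N" "Y s0 = X s0" "T s0 = unit_tangent X s0" "N s0 = unit_normal X s0"
    by (rule soliton_frame_exists[OF 0, of v s0])
  then have "soliton_frame v 1 I Y T N" unfolding soliton_frame_def solves_ode_on_def by blast
  then have "\<forall>s\<in>I. Y s = X s"
    using soliton_frame_unique(1)[OF _ sf, of 1 Y T N s0] I s0 Y by (auto simp: open_interval_def)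
  moreover have "soliton_with_vector_on v UNIV Y"
    by (rule soliton_frame_imp_soliton(1)[OF Y(1) open_interval_UNIV])
  ultimately show ?thesis using assms unfolding maximal_soliton_def by blast
qed

lemma maximal_soliton_iff:
  "maximal_soliton v I X \<longleftrightarrow> I = UNIV \<and> soliton_with_vector_on v UNIV X"
  using maximal_soliton_UNIV[of v I X] by (auto simp: maximal_soliton_def)

subsection \<open>Initial data\<close>

text \<open>Cauchy-Schwarz in the last two coordinates: the spatial part of \<open>p\<close> is
  shorter than \<open>p$1\<close> and that of \<open>v\<close> is at most
  \<open>\<bar>v$1\<bar>\<close>, so the first term dominates \<open>mink p v\<close>.\<close>

lemma mink_sgn_H2:
  assumes "v \<noteq> 0" "mink v v \<le> 0" "p \<in> H2"
  shows "mink p v \<noteq> 0" "sgn (mink p v) = - sgn (v$1)"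
proof -
  have p: "(p$1)\<^sup>2 = 1 + (p$2)\<^sup>2 + (p$3)\<^sup>2" "p$1 > 0"
    using assms(3) by (auto simp: H2_def mink_def power2_eq_square)
  have v: "(v$2)\<^sup>2 + (v$3)\<^sup>2 \<le> (v$1)\<^sup>2" using assms(2) by (simp add: mink_def power2_eq_square)
  have v1: "v$1 \<noteq> 0"
  proof
    assume "v$1 = 0"
    then show False using v assms(1) by (simp add: sum_power2_le_zero_iff vec3_eq_iff)
  qed
  have "(p$2 * v$2 + p$3 * v$3)\<^sup>2 \<le> ((p$2)\<^sup>2 + (p$3)\<^sup>2) * ((v$2)\<^sup>2 + (v$3)\<^sup>2)"
  proof -
    have "((p$2)\<^sup>2 + (p$3)\<^sup>2) * ((v$2)\<^sup>2 + (v$3)\<^sup>2) - (p$2 * v$2 + p$3 * v$3)\<^sup>2 = (p$2 * v$3 - p$3 * v$2)\<^sup>2"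
      by (simp add: power2_eq_square algebra_simps)
    then show ?thesis by (smt (verit) zero_le_power2)
  qed
  also have "\<dots> \<le> ((p$2)\<^sup>2 + (p$3)\<^sup>2) * (v$1)\<^sup>2" using v by (intro mult_left_mono) auto
  also have "\<dots> < (p$1)\<^sup>2 * (v$1)\<^sup>2" using v1 p by (intro mult_strict_right_mono) auto
  finally have "\<bar>p$2 * v$2 + p$3 * v$3\<bar> < \<bar>p$1 * v$1\<bar>"
    using power2_less_imp_less[of "\<bar>p$2 * v$2 + p$3 * v$3\<bar>" "\<bar>p$1 * v$1\<bar>"]
    by (simp add: power_mult_distrib)
  then have lt: "\<bar>p$2 * v$2 + p$3 * v$3\<bar> < p$1 * \<bar>v$1\<bar>" using p by (simp add: abs_mult)
  have "mink p v < 0 \<and> v$1 > 0 \<or> mink p v > 0 \<and> v$1 < 0"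
    using v1 lt by (cases "v$1 > 0") (auto simp: mink_def)
  then show "mink p v \<noteq> 0" "sgn (mink p v) = - sgn (v$1)" by auto
qed

lemma frame_data_admissible:
  assumes "v \<noteq> 0" "x \<in> H2" "mframe x t n"
  shows "(mink x v, mink t v, mink n v) \<in> admissible_data v"
  using assms mink_sgn_H2[OF assms(1)] unfolding admissible_data_def mframe_iff_parseval parseval_def
  by (auto simp: power2_eq_square)

text \<open>The tangent plane is positive definite. This settles the case where the tangential part
  of \<open>v\<close> at \<open>x\<close> is null.\<close>

lemma mframe_null_tangent:
  assumes "mframe x t n" "mink x w = 0" "mink w w = 0"
  shows "w = 0"
proof -
  have "(mink t w)\<^sup>2 + (mink n w)\<^sup>2 = 0"
    using assms unfolding mframe_iff_parseval parseval_def by (metis add.left_neutral add_0 mult_zero_left neg_0_equal_iff_equal power2_eq_square)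
  then have "mink t w = 0" "mink n w = 0" by (simp_all add: add_nonneg_eq_0_iff)
  then show ?thesis using mframe_expand[OF assms(1), of w] assms(2) by simp
qed

text \<open>The vector \<open>t\<close> is the image of the second basis vector under the Lorentz
  boost taking \<open>(1, 0, 0)\<close> to \<open>x\<close>. Its denominator is
  \<open>1 + x$1\<close>, so the two identities are proved after multiplying by it.\<close>

lemma H2_frame_exists:
  assumes "x \<in> H2"
  obtains t where "mframe x t (mcross x t)"
proof -
  have x: "(x$1)\<^sup>2 = 1 + (x$2)\<^sup>2 + (x$3)\<^sup>2" "1 + x$1 \<noteq> 0"
    using assms by (auto simp: H2_def mink_def power2_eq_square)
  define q where "q = x$2 / (1 + x$1)"
  have q: "q * (1 + x$1) = x$2" using x by (simp add: q_def)
  define t :: "real^3" where "t = vector [x$2, 1 + q * x$2, q * x$3]"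
  have *: "(- (a * b) + b * (1 + q * b) + c * (q * c)) * (1 + a) = 0"
    if "q * (1 + a) = b" "a\<^sup>2 = 1 + b\<^sup>2 + c\<^sup>2" for a b c :: real
  proof -
    have "(- (a * b) + b * (1 + q * b) + c * (q * c)) * (1 + a) =
        b * (1 - a\<^sup>2 + b\<^sup>2 + c\<^sup>2) + (b\<^sup>2 + c\<^sup>2) * (q * (1 + a) - b)"
      by (simp add: power2_eq_square algebra_simps)
    then show ?thesis using that by simp
  qed
  have "(- (b * b) + (1 + q * b) * (1 + q * b) + (q * c) * (q * c) - 1) * (1 + a) = 0"
    if "q * (1 + a) = b" "a\<^sup>2 = 1 + b\<^sup>2 + c\<^sup>2" for a b c :: real
  proof -
    have "(- (b * b) + (1 + q * b) * (1 + q * b) + (q * c) * (q * c) - 1) * (1 + a) =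
        (2 * b + q * (a\<^sup>2 - 1)) * (q * (1 + a) - b) + q * (b\<^sup>2 + c\<^sup>2 - a\<^sup>2 + 1) * (q * (1 + a)) +
        b * (a - 1) * (q * (1 + a) - b)"
      by (simp add: power2_eq_square algebra_simps)
    then show ?thesis using that by simp
  qed
  from *[OF q x(1)] this[OF q x(1)] have "mink x t * (1 + x$1) = 0" "(mink t t - 1) * (1 + x$1) = 0"
    by (simp_all add: t_def mink_def)
  then have "mink x t = 0" "mink t t = 1" using x(2) by auto
  then show ?thesis using that[of t] assms by (auto simp: H2_def intro: mframe_mcross)
qed

text \<open>On the hyperbola \<open>p = (cosh \<xi>, sinh \<xi> u\<^sub>2, sinh \<xi> u\<^sub>3)\<close> through the spatial direction
  \<open>u\<close> of \<open>v\<close>, the equation \<open>\<langle>p, v\<rangle> = \<alpha>\<close> is quadratic in \<open>y = exp \<xi>\<close>.\<close>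

lemma H2_level_nonempty:
  assumes "v \<noteq> 0" "mink v v > 0 \<or> \<alpha>\<^sup>2 + mink v v \<ge> 0 \<and> sgn \<alpha> = - sgn (v$1)"
  obtains x where "x \<in> H2" "mink x v = \<alpha>"
proof -
  define m where "m = sqrt ((v$2)\<^sup>2 + (v$3)\<^sup>2)"
  have m: "m \<ge> 0" "m\<^sup>2 = (v$2)\<^sup>2 + (v$3)\<^sup>2" by (auto simp: m_def)
  obtain u2 u3 where u: "v$2 = m * u2" "v$3 = m * u3" "u2\<^sup>2 + u3\<^sup>2 = 1"
  proof (cases "m = 0")
    case True
    then show ?thesis using that[of 1 0] m(2) by (simp add: add_nonneg_eq_0_iff)
  next
    case False
    have "(v$2 / m)\<^sup>2 + (v$3 / m)\<^sup>2 = ((v$2)\<^sup>2 + (v$3)\<^sup>2) / m\<^sup>2"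
      by (simp add: power_divide add_divide_distrib)
    also have "\<dots> = m\<^sup>2 / m\<^sup>2" by (simp only: m(2))
    finally have "(v$2 / m)\<^sup>2 + (v$3 / m)\<^sup>2 = 1" using False by simp
    then show ?thesis using that[of "v$2 / m" "v$3 / m"] False by simp
  qed
  have Q: "mink v v = m\<^sup>2 - (v$1)\<^sup>2" using m(2) by (simp add: mink_def power2_eq_square)
  obtain y where y: "y > 0" "(m - v$1) * y\<^sup>2 - 2 * \<alpha> * y - (m + v$1) = 0"
  proof -
    \<comment> \<open>The radicand is a quarter of the discriminant, since
      \<open>(m - v$1) * (m + v$1) = mink v v\<close>.\<close>
    define r where "r = sqrt (\<alpha>\<^sup>2 + mink v v)"
    have root: "(m - v$1) * y\<^sup>2 - 2 * \<alpha> * y - (m + v$1) = 0"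
      if "y = (\<alpha> + r') / (m - v$1)" "r'\<^sup>2 = \<alpha>\<^sup>2 + mink v v" "m - v$1 \<noteq> 0" for y r'
    proof -
      have "(m - v$1) * y = \<alpha> + r'" using that by simp
      then have "(m - v$1) * ((m - v$1) * y\<^sup>2 - 2 * \<alpha> * y - (m + v$1)) = 0"
        using that(2) Q by algebra
      then show ?thesis using that(3) by simp
    qed
    \<comment> \<open>The cases select a positive root: the plus sign when \<open>m > v$1\<close>,
      the minus sign when \<open>m < v$1\<close>, and a linear equation when
      \<open>m = v$1\<close>.\<close>
    consider "mink v v > 0" | "mink v v \<le> 0" "v$1 < 0" "\<alpha> > 0" "\<alpha>\<^sup>2 + mink v v \<ge> 0"
      | "mink v v \<le> 0" "v$1 > 0" "\<alpha> < 0" "\<alpha>\<^sup>2 + mink v v \<ge> 0" "m \<noteq> v$1" | "m = v$1" "v$1 > 0" "\<alpha> < 0"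
    proof -
      have "v$1 \<noteq> 0" if "mink v v \<le> 0"
        using mink_sgn_H2[OF assms(1) that] that assms
          mink_sgn_H2(1)[OF assms(1) that, of "vector [1, 0, 0]"]
        by (auto simp: H2_def mink_def)
      then consider "mink v v > 0" | "mink v v \<le> 0" "v$1 < 0" | "mink v v \<le> 0" "v$1 > 0" by linarith
      then show ?thesis
      proof cases
        case 2
        then show ?thesis using assms(2) that(2) by (auto simp: sgn_if split: if_splits)
      next
        case 3
        then have "\<alpha> < 0" using assms(2) by (auto simp: sgn_if split: if_splits)
        then show ?thesis using assms(2) that(3,4) 3 by fastforce
      qed (rule that(1))
    qed
    then show ?thesis
    proof cases
      case 1
      have "\<bar>v$1\<bar> < m" using 1 m(1) unfolding Q by (metis abs_le_square_iff abs_of_nonneg diff_gt_0_iff_gt not_le)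
      moreover have r: "r\<^sup>2 = \<alpha>\<^sup>2 + mink v v" using 1 by (simp add: r_def)
      have "\<bar>\<alpha>\<bar> < r" unfolding r_def using 1 by (simp add: real_less_rsqrt)
      ultimately show ?thesis using that[of "(\<alpha> + r) / (m - v$1)"] root[OF refl r] by auto
    next
      case 2
      then have r: "r\<^sup>2 = \<alpha>\<^sup>2 + mink v v" "r \<ge> 0" by (simp_all add: r_def)
      then show ?thesis using that[of "(\<alpha> + r) / (m - v$1)"] root[OF refl r(1)] 2 m(1)
        by (simp add: add_pos_nonneg)
    next
      case 3
      then have r: "(- r)\<^sup>2 = \<alpha>\<^sup>2 + mink v v" "r \<ge> 0" by (simp_all add: r_def)
      have "m < v$1" using 3 m(1) unfolding Q
        by (smt (verit) power2_le_imp_le)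
      then have "(\<alpha> + - r) / (m - v$1) > 0" using 3 r(2) by (simp add: divide_neg_neg)
      then show ?thesis using that[of "(\<alpha> + - r) / (m - v$1)"] root[OF refl r(1)] \<open>m < v$1\<close> by auto
    next
      case 4
      then show ?thesis using that[of "- m / \<alpha>"] by (simp add: divide_neg_neg field_simps)
    qed
  qed
  define a where "a = (y + 1 / y) / 2"
  define b where "b = (y - 1 / y) / 2"
  define x :: "real^3" where "x = vector [a, b * u2, b * u3]"
  have "mink x x = - (a\<^sup>2) + b\<^sup>2 * (u2\<^sup>2 + u3\<^sup>2)"
    by (simp add: x_def mink_def power2_eq_square algebra_simps)
  also have "\<dots> = -1" using y(1) unfolding u(3) a_def b_def by (simp add: power2_eq_square field_simps)
  finally have H: "x \<in> H2" using y(1) by (simp add: H2_def x_def a_def add_pos_pos)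
  have "mink x v = - a * v$1 + b * m * (u2\<^sup>2 + u3\<^sup>2)"
    by (simp add: x_def mink_def u(1,2) power2_eq_square algebra_simps)
  then have "mink x v = - a * v$1 + b * m" unfolding u(3) by simp
  then have "2 * y * mink x v = - (2 * y * a) * v$1 + (2 * y * b) * m"
    by (simp only: ring_distribs) simp
  also have "2 * y * a = y\<^sup>2 + 1" using y(1) by (simp add: a_def power2_eq_square field_simps)
  also have "2 * y * b = y\<^sup>2 - 1" using y(1) by (simp add: b_def power2_eq_square field_simps)
  finally have "2 * y * mink x v = (m - v$1) * y\<^sup>2 - (m + v$1)" by (simp add: algebra_simps)
  then have "2 * y * mink x v = 2 * y * \<alpha>"
    using y(2) mult.commute[of \<alpha> y] by (simp only: mult.assoc)
  then have "mink x v = \<alpha>" using y(1) by simp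
  then show ?thesis using that H by blast
qed

lemma admissible_frame_exists:
  assumes "v \<noteq> 0" and data: "(\<alpha>, \<tau>, \<eta>) \<in> admissible_data v"
  obtains x t where "x \<in> H2" "mframe x t (mcross x t)"
    "mink x v = \<alpha>" "mink t v = \<tau>" "mink (mcross x t) v = \<eta>"
proof -
  have Q: "- \<alpha>\<^sup>2 + \<tau>\<^sup>2 + \<eta>\<^sup>2 = mink v v" using data by (simp add: admissible_data_def)
  then have pos: "\<alpha>\<^sup>2 + mink v v \<ge> 0" by (smt (verit) zero_le_power2)
  have "vector [1, 0, 0] \<in> H2" by (simp add: H2_def mink_def)
  then have "mink v v > 0 \<or> \<alpha>\<^sup>2 + mink v v \<ge> 0 \<and> sgn \<alpha> = - sgn (v$1)"
    using data pos mink_sgn_H2(2)[OF assms(1), of "vector [1, 0, 0]"]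
    by (fastforce simp: admissible_data_def)
  then obtain x where x: "x \<in> H2" "mink x v = \<alpha>" using H2_level_nonempty[OF assms(1)] by metis
  have xx: "mink x x = -1" using x by (simp add: H2_def)
  \<comment> \<open>The tangential part of \<open>v\<close> at \<open>x\<close>. Its squared length
    is \<open>r\<close>; if that is 0, every frame at \<open>x\<close> has the required
    products.\<close>
  define w where "w = v + \<alpha> *\<^sub>R x"
  define r where "r = \<tau>\<^sup>2 + \<eta>\<^sup>2"
  have xw: "mink x w = 0" by (simp add: w_def mink_simps x xx)
  have ww: "mink w w = r"
    using Q by (simp add: w_def mink_simps x xx mink_commute[of v x] r_def power2_eq_square)
  have wv: "mink w v = r"
    using Q by (simp add: w_def mink_simps x xx r_def power2_eq_square)
  show ?thesis
  proof (cases "r = 0")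
    case True
    then have "\<tau> = 0" "\<eta> = 0" by (simp_all add: r_def add_nonneg_eq_0_iff)
    obtain t where t: "mframe x t (mcross x t)" using H2_frame_exists[OF x(1)] .
    have "w = 0" using mframe_null_tangent[OF t xw] ww True by simp
    then have "v = - \<alpha> *\<^sub>R x" by (simp add: w_def eq_neg_iff_add_eq_0)
    then have "mink t v = 0" "mink (mcross x t) v = 0"
      using t by (simp_all add: mframe_def mink_simps mink_commute[of t x] mink_commute[of "mcross x t" x])
    then show ?thesis using that[OF x(1) t x(2)] \<open>\<tau> = 0\<close> \<open>\<eta> = 0\<close> by simp
  next
    case False
    \<comment> \<open>This inverts \<open>w = \<tau> t + \<eta> n\<close> by a rotation in the
      tangent plane, with \<open>w\<close> and \<open>mcross x w\<close> as orthogonal basis of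
      equal lengths.\<close>
    define t where "t = (1 / r) *\<^sub>R (\<tau> *\<^sub>R w - \<eta> *\<^sub>R mcross x w)"
    have m: "mink (mcross x w) (mcross x w) = r" by (simp add: mink_mcross_mcross xw xx ww)
    have mv: "mink (mcross x w) v = 0"
    proof -
      have "v = w - \<alpha> *\<^sub>R x" by (simp add: w_def)
      then show ?thesis by (simp add: mink_simps)
    qed
    have mm: "mcross x (mcross x w) = - w"
      using mcross_mcross_right[of x w] by (simp add: xx xw)
    have n: "mcross x t = (1 / r) *\<^sub>R (\<tau> *\<^sub>R mcross x w + \<eta> *\<^sub>R w)"
      by (simp add: t_def mcross_simps mm)
    have "mink t t = (1 / r)\<^sup>2 * (\<tau>\<^sup>2 + \<eta>\<^sup>2) * r"
      by (simp add: t_def mink_simps m ww mink_commute[of w "mcross x w"] power2_eq_square algebra_simps)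
    then have "mink t t = 1" using False unfolding r_def[symmetric] by (simp add: power2_eq_square)
    moreover have "mink x t = 0"
      by (simp add: t_def mink_simps xw mink_commute[of x "mcross x w"])
    ultimately have "mframe x t (mcross x t)" using xx by (intro mframe_mcross)
    moreover have "mink t v = \<tau>" "mink (mcross x t) v = \<eta>"
      using False unfolding n by (simp_all add: t_def mink_simps wv mv)
    ultimately show ?thesis using that x by blast
  qed
qed

lemma frame_isometry_exists:
  assumes f: "mframe x t n" and g: "mframe x' t' n'" and H: "x \<in> H2" "x' \<in> H2"
  obtains A where "A \<in> H2_isometries" "A *v x = x'" "A *v t = t'" "A *v n = n'"
proof -
  define h where "h z = - mink x z *\<^sub>R x' + mink t z *\<^sub>R t' + mink n z *\<^sub>R n'" for z
  have "linear h" by (rule linearI) (auto simp: h_def mink_simps algebra_simps)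
  then have A: "matrix h *v z = h z" for z by (simp add: matrix_works linear_matrix_vector_mul_eq)
  have x: "h x = x'" "h t = t'" "h n = n'"
    using f by (auto simp: h_def mframe_def mink_commute[of t x] mink_commute[of n x] mink_commute[of n t])
  have "mink (h z) (h w) = mink z w" for z w
  proof -
    have "mink (h z) (h w) = - (mink x z * mink x w) + mink t z * mink t w + mink n z * mink n w"
      using g by (simp add: h_def mframe_def mink_simps mink_commute[of t' x'] mink_commute[of n' x'] mink_commute[of n' t'])
    then show ?thesis using f by (simp add: mframe_iff_parseval parseval_def)
  qed
  then have "matrix h \<in> H2_isometries"
    using H x by (intro isometryI[of _ x]) (auto simp: A)
  then show ?thesis using that[of "matrix h"] x by (simp add: A)
qed

text \<open>The isometry matching the two frames at 0 fixes \<open>v\<close>, because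
  \<open>v\<close> has the same components in both. It therefore maps solutions of the frame system
  to solutions, and uniqueness applies.\<close>

lemma soliton_congruent:
  assumes X: "soliton_frame v 1 UNIV X T N" and Y: "soliton_frame v 1 UNIV Y T' N'"
    and data: "mink (X 0) v = mink (Y 0) v" "mink (T 0) v = mink (T' 0) v" "mink (N 0) v = mink (N' 0) v"
  shows "\<exists>A\<in>H2_isometries. \<forall>s. Y s = A *v X s"
proof -
  have f: "mframe (X 0) (T 0) (N 0)" "X 0 \<in> H2" and g: "mframe (Y 0) (T' 0) (N' 0)" "Y 0 \<in> H2"
    using X Y unfolding soliton_frame_def by blast+
  obtain A where A: "A \<in> H2_isometries" "A *v X 0 = Y 0" "A *v T 0 = T' 0" "A *v N 0 = N' 0"
    using frame_isometry_exists[OF f(1) g(1) f(2) g(2)] by metis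
  have iso: "mink (A *v z) (A *v w) = mink z w" for z w using A(1) by (simp add: H2_isometries_def)
  have lin: "bounded_linear ((*v) A)" by (rule matrix_vector_mul_bounded_linear)
  have "A *v v = A *v (- mink (X 0) v *\<^sub>R X 0 + mink (T 0) v *\<^sub>R T 0 + mink (N 0) v *\<^sub>R N 0)"
    using mframe_expand[OF f(1), of v] by simp
  also have "\<dots> = v"
    using mframe_expand[OF g(1), of v] data A
      bounded_linear.linear[OF lin] by (simp add: linear_add linear_diff linear_scale linear_neg)
  finally have "mink (A *v z) v = mink z v" for z using iso by metis
  moreover have "A *v (a + c *\<^sub>R b) = A *v a + c *\<^sub>R (A *v b)" "A *v (- (c *\<^sub>R b)) = - (c *\<^sub>R (A *v b))" for a b c
    using bounded_linear.linear[OF lin] by (simp_all add: linear_add linear_scale linear_neg)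
  moreover note d = soliton_frame_derivs[OF X UNIV_I, THEN bounded_linear.has_vector_derivative[OF lin]]
  ultimately have sol: "solves_ode_on (frame_field v) UNIV (\<lambda>s. (A *v X s, A *v T s, A *v N s))"
    unfolding solves_frame_field_iff by simp
  have "(\<lambda>s. (A *v X s, A *v T s, A *v N s)) s = (\<lambda>s. (Y s, T' s, N' s)) s" for s
    by (rule ode_unique[OF locally_lipschitz_frame_field _ _ _ sol, of 0])
       (use Y A in \<open>auto simp: soliton_frame_def\<close>)
  then show ?thesis by (intro bexI[OF _ A(1)]) auto
qed

subsection \<open>Solitons move by isometries under the flow\<close>

lemma has_vector_derivative_matrix_vector:
  fixes M :: "real \<Rightarrow> real^'n^'m"
  assumes "(M has_vector_derivative D) (at t)"
  shows "((\<lambda>t. M t *v x) has_vector_derivative D *v x) (at t)"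
proof -
  have "linear (\<lambda>A::real^'n^'m. A *v x)"
    by (rule linearI) (simp_all add: matrix_vector_mult_add_rdistrib scaleR_matrix_vector_assoc)
  then show ?thesis
    using bounded_linear.has_vector_derivative assms linear_conv_bounded_linear by blast
qed

lemma bounded_bilinear_matrix_vector: "bounded_bilinear ((*v) :: real^'n^'m \<Rightarrow> real^'n \<Rightarrow> real^'m)"
proof -
  have "bilinear ((*v) :: real^'n^'m \<Rightarrow> real^'n \<Rightarrow> real^'m)"
    unfolding bilinear_def
    by (auto intro!: linearI simp: vec_eq_iff matrix_vector_mult_def sum.distrib sum_distrib_left
        algebra_simps)
  then show ?thesis by (simp add: bilinear_conv_bounded_bilinear)
qed

text \<open>\<open>M\<close> solves \<open>M' = K ** M\<close>, where \<open>K\<close> is the matrix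
  of \<open>x \<mapsto> mcross x v\<close>; this stands for the matrix exponential. \<open>K\<close>
  is skew for the form, so all products are constant in time.\<close>

lemma isometry_flow_exists:
  fixes v :: "real^3"
  obtains M :: "real \<Rightarrow> real^3^3" where "smooth_on UNIV M" "M 0 = mat 1"
    "\<And>t x. ((\<lambda>t. M t *v x) has_vector_derivative mcross (M t *v x) v) (at t)"
    "\<And>t. M t \<in> H2_isometries" "\<And>t. det (M t) = 1"
proof -
  define K :: "real^3^3" where "K = matrix (\<lambda>x. mcross x v)"
  have "linear (\<lambda>x. mcross x v)" by (rule linearI) (simp_all add: mcross_simps)
  then have K: "K *v x = mcross x v" for x
    by (simp add: K_def matrix_works linear_matrix_vector_mul_eq)
  have "linear (\<lambda>A::real^3^3. K ** A)"
    by (rule linearI) (simp_all add: vec_eq_iff matrix_matrix_mult_def sum_distrib_left sum.distrib distrib_left mult_ac)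
  then have lin: "bounded_linear (\<lambda>A::real^3^3. K ** A)" by (simp add: linear_conv_bounded_linear)
  \<comment> \<open>The zero bilinear map presents the linear equation as a quadratic one.\<close>
  have bil: "bounded_bilinear (\<lambda>A B::real^3^3. 0::real^3^3)"
    by unfold_locales (auto intro: exI[of _ 0])
  have lip: "locally_lipschitz (\<lambda>A::real^3^3. K ** A)"
    using locally_lipschitz_quadratic[OF lin bil] by simp
  obtain c where c: "c \<ge> 0" "\<And>A::real^3^3. norm (K ** A) \<le> norm A * c"
    using bounded_linear.nonneg_bounded[OF lin] by blast
  have "\<bar>A \<bullet> (K ** A)\<bar> \<le> c * (A \<bullet> A)" for A :: "real^3^3"
  proof -
    have "\<bar>A \<bullet> (K ** A)\<bar> \<le> norm A * norm (K ** A)" by (rule Cauchy_Schwarz_ineq2)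
    also have "\<dots> \<le> norm A * (norm A * c)" using c by (intro mult_left_mono) auto
    finally show ?thesis by (simp add: dot_square_norm power2_eq_square mult_ac)
  qed
  then obtain M where M: "solves_ode_on (\<lambda>A. K ** A) UNIV M" "M 0 = mat 1"
    using ode_exists_global[OF lip c(1)] by metis
  have smooth: "smooth_on UNIV M"
    using smooth_on_solves_quadratic_ode[OF lin bil open_UNIV] M(1) by simp
  have d: "((\<lambda>t. M t *v x) has_vector_derivative mcross (M t *v x) v) (at t)" for t x
    using has_vector_derivative_matrix_vector[of M "K ** M t" t x] M(1)
    by (simp add: solves_ode_on_def matrix_vector_mul_assoc[symmetric] K)
  have iso: "mink (M t *v x) (M t *v y) = mink x y" for t x y
  proof -
    have "((\<lambda>t. mink (M t *v x) (M t *v y)) has_real_derivative 0) (at t)" for t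
    proof -
      have "mink a (mcross b v) + mink (mcross a v) b = 0" for a b
        by (simp add: mink_def algebra_simps)
      then show ?thesis using has_vector_derivative_mink[OF d[of x t] d[of y t]] by simp
    qed
    then have "mink (M t *v x) (M t *v y) = mink (M 0 *v x) (M 0 *v y)"
      by (intro equal_values_of_zero_derivative[of UNIV _ t 0]) auto
    then show ?thesis by (simp add: M(2))
  qed
  have contM: "continuous_on UNIV M" by (rule solves_ode_on_continuous[OF M(1)])
  have isom: "M t \<in> H2_isometries" for t
  proof (rule isometryI[OF iso])
    show e1: "vector [1, 0, 0] \<in> H2" by (simp add: H2_def mink_def)
    have "continuous_on UNIV (\<lambda>t. M t *v vector [1, 0, 0])"
      using d by (auto intro!: continuous_at_imp_continuous_on has_vector_derivative_continuous)
    then show "M t *v vector [1, 0, 0] \<in> H2"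
      using H2_continuous[of UNIV "\<lambda>t. M t *v vector [1, 0, 0]" 0 t] e1
      by (simp add: iso M(2)) (simp add: H2_def)
  qed
  \<comment> \<open>Preserving the form leaves determinant 1 or -1; continuity and
    \<open>det (M 0) = 1\<close> then exclude -1.\<close>
  have det_sq: "(det (M t))\<^sup>2 = 1" for t
  proof -
    define J :: "real^3^3" where "J = vector [vector [-1, 0, 0], vector [0, 1, 0], vector [0, 0, 1]]"
    have "transpose (M t) ** J ** M t = J"
      using iso[of t "axis 1 1" "axis 1 1"] iso[of t "axis 1 1" "axis 2 1"] iso[of t "axis 1 1" "axis 3 1"]
        iso[of t "axis 2 1" "axis 2 1"] iso[of t "axis 2 1" "axis 3 1"] iso[of t "axis 3 1" "axis 3 1"]
      unfolding J_def
      by (simp add: vec_eq_iff forall_3 matrix_matrix_mult_def matrix_vector_mult_def sum_3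
          transpose_def mink_def axis_def algebra_simps)
    then have "det (transpose (M t) ** J ** M t) = det J" by simp
    moreover have "det J = -1" by (simp add: J_def det_3)
    ultimately show ?thesis by (simp add: det_mul power2_eq_square)
  qed
  have "det (M t) = 1" for t
  proof (rule ccontr)
    assume "det (M t) \<noteq> 1"
    then have "det (M t) = -1" using det_sq[of t] by (simp add: power2_eq_1_iff)
    moreover have "connected ((\<lambda>t. det (M t)) ` UNIV)"
      using contM unfolding det_3
      by (intro connected_continuous_image continuous_intros) auto
    moreover have "det (M 0) = 1" by (simp add: M(2))
    ultimately have "0 \<in> range (\<lambda>t. det (M t))"
      using connectedD_interval[of "range (\<lambda>t. det (M t))" "-1" 1 0] by (metis neg_le_0_iff_le rangeI zero_le_one)
    then obtain u where "det (M u) = 0" by auto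
    then show False using det_sq[of u] by simp
  qed
  then show ?thesis using that[of M] smooth M(2) d isom by blast
qed

lemma mcross_frame: "mframe x t n \<Longrightarrow> n = mcross x t \<Longrightarrow> mcross n x = t"
  using mcross_mcross_right[of x t] by (simp add: mframe_def mcross_anticommute[of "mcross x t" x])

text \<open>The Killing field has normal component
  \<open>mink (mcross X v) N = mink (mcross N X) v = mink T v\<close>, which is the curvature. This
  persists in time because each \<open>M t\<close> fixes \<open>v\<close> and, having determinant 1,
  carries the frame along.\<close>

theorem soliton_is_csf:
  assumes sf: "soliton_frame v 1 UNIV X T N"
  shows "csf_soliton_on UNIV X"
proof -
  obtain M where M: "smooth_on UNIV M" "M 0 = mat 1"
    "\<And>t x. ((\<lambda>t. M t *v x) has_vector_derivative mcross (M t *v x) v) (at t)"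
    "\<And>t. M t \<in> H2_isometries" "\<And>t. det (M t) = 1"
    by (rule isometry_flow_exists[of v]) blast
  have iso: "mink (M t *v x) (M t *v y) = mink x y" for t x y using M(4) by (simp add: H2_isometries_def)
  have fr: "X s \<in> H2" "mframe (X s) (T s) (N s)" "N s = mcross (X s) (T s)" for s
    using sf unfolding soliton_frame_def scaleR_one by blast+
  note d = soliton_frame_derivs[OF sf UNIV_I]
  have lin: "bounded_linear ((*v) (M t))" for t by (rule matrix_vector_mul_bounded_linear)
  note dM = bounded_linear.has_vector_derivative[OF lin]
  have tt: "mink (M t *v T s) (M t *v T s) = 1" for t s using fr(2)[of s] by (simp add: iso mframe_def)
  have curve: "unit_normal (\<lambda>s. M t *v X s) s = M t *v N s"
    "geodesic_curvature (\<lambda>s. M t *v X s) s = mink (T s) v" for t s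
  proof -
    have mc: "mcross (M t *v X s) (M t *v T s) = M t *v N s" for s
      using mcross_isometry[OF iso M(5)] fr(3)[of s] by simp
    note c = unit_speed_curve[OF open_UNIV dM[OF d(1)] tt UNIV_I]
    show "unit_normal (\<lambda>s. M t *v X s) s = M t *v N s" using c(3)[of t s] mc by simp
    have "mink (X s + mink (T s) v *\<^sub>R N s) (N s) = mink (T s) v"
      using fr(2)[of s] by (simp add: mframe_def mink_simps)
    then show "geodesic_curvature (\<lambda>s. M t *v X s) s = mink (T s) v"
      using c(4)[OF dM[OF d(2)], of t s] mc iso by simp
  qed
  have X: "smooth_on UNIV X" using soliton_frame_smooth(1)[OF sf] by simp
  have "regular_curve_on UNIV (\<lambda>s. M t *v X s)" for t
    unfolding regular_curve_on_def
  proof (intro conjI ballI)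
    show "smooth_on UNIV (\<lambda>s. M t *v X s)" by (rule smooth_on_linear[OF lin open_UNIV X])
    fix s
    show "M t *v X s \<in> H2" using M(4)[of t] fr(1)[of s] by (auto simp: H2_isometries_def)
    show "vector_derivative (\<lambda>s. M t *v X s) (at s) \<noteq> 0"
      using vector_derivative_at[OF dM[OF d(1)[of s]], of t] tt[of t s] by (auto simp: mink_simps)
  qed (rule open_interval_UNIV)
  moreover have "smooth_on (UNIV \<times> UNIV) (\<lambda>(s, t). M t *v X s)"
  proof -
    have "smooth_on (UNIV \<times> UNIV) (\<lambda>p. M (snd p) *v X (fst p))"
      using smooth_on_compose_linear[OF bounded_linear_snd open_UNIV open_UNIV _ M(1)]
        smooth_on_compose_linear[OF bounded_linear_fst open_UNIV open_UNIV _ X]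
      by (intro smooth_on_bilinear[OF bounded_bilinear_matrix_vector]) auto
    then show ?thesis by (simp add: case_prod_beta')
  qed
  moreover have "mink (vector_derivative (\<lambda>t. M t *v X s) (at t)) (unit_normal (\<lambda>s. M t *v X s) s)
      = geodesic_curvature (\<lambda>s. M t *v X s) s" for s t
  proof -
    have "mcross (M t *v N s) (M t *v X s) = M t *v T s"
      using mcross_isometry[OF iso M(5)] mcross_frame[OF fr(2,3)] by simp
    then have "mink (mcross (M t *v X s) v) (M t *v N s) = mink (M t *v T s) v"
      using mink_mcross_cyclic[of "M t *v N s" "M t *v X s" v] mink_mcross_cyclic[of "M t *v X s" v "M t *v N s"]
      by simp
    also have "\<dots> = mink (T s) v"
    proof -
      \<comment> \<open>\<open>v\<close> is a stationary point of
        \<open>x \<mapsto> mcross x v\<close>, so uniqueness gives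
        \<open>M t *v v = v\<close>.\<close>
      have "solves_ode_on (\<lambda>x. mcross x v) UNIV (\<lambda>t. M t *v v)"
        using M(3) by (simp add: solves_ode_on_def)
      moreover have "solves_ode_on (\<lambda>x. mcross x v) UNIV (\<lambda>t. v)"
        by (simp add: solves_ode_on_def)
      moreover have "locally_lipschitz (\<lambda>x. mcross x v + (\<lambda>x y. 0) x x)"
        by (rule locally_lipschitz_quadratic[OF bounded_bilinear.bounded_linear_left[OF bounded_bilinear_mcross]])
          (unfold_locales, auto intro: exI[of _ 0])
      ultimately have "M t *v v = v"
        using ode_unique[of "\<lambda>x. mcross x v" UNIV 0 t "\<lambda>t. M t *v v" "\<lambda>t. v"] M(2) by simp
      then show ?thesis using iso by metis
    qed
    finally show ?thesis
      using vector_derivative_at[OF M(3)[of "X s" t]] curve by simp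
  qed
  ultimately have "curve_shortening_flow UNIV X UNIV (\<lambda>s t. M t *v X s)"
    by (simp add: curve_shortening_flow_def open_interval_UNIV M(2))
  then show ?thesis using M unfolding csf_soliton_on_def by blast
qed

subsection \<open>Asymptotics of the curvature\<close>

text \<open>After the last time at which \<open>f\<close> is at most \<open>C\<close>, it would have
  to rise while its derivative is nonpositive.\<close>

lemma derivative_barrier:
  fixes f :: "real \<Rightarrow> real"
  assumes d: "\<And>s. s \<ge> s1 \<Longrightarrow> (f has_real_derivative f' s) (at s)"
    and b: "\<And>s. s \<ge> s1 \<Longrightarrow> f s > C \<Longrightarrow> f' s \<le> 0" and "f s1 \<le> C" "s \<ge> s1"
  shows "f s \<le> C"
proof (rule ccontr)
  assume n: "\<not> f s \<le> C"
  define S where "S = {r\<in>{s1..s}. f r \<le> C}"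
  have cont: "continuous_on {s1..s} f"
    using d by (auto intro!: continuous_at_imp_continuous_on DERIV_isCont)
  have "compact S"
  proof -
    have "S = {s1..s} \<inter> f -` {..C}" by (auto simp: S_def)
    then have "closed S" using continuous_closed_preimage[OF cont] by simp
    moreover have "bounded S" by (rule bounded_subset[of "{s1..s}"]) (auto simp: S_def)
    ultimately show ?thesis by (simp add: compact_eq_bounded_closed)
  qed
  moreover have "s1 \<in> S" using assms by (simp add: S_def)
  ultimately obtain m where m: "m \<in> S" "\<And>r. r \<in> S \<Longrightarrow> r \<le> m"
    using compact_attains_sup[of S] by blast
  then have ms: "s1 \<le> m" "m < s" "f m \<le> C" using n by (auto simp: S_def order_le_less)
  have "f m \<ge> f s"
  proof (rule DERIV_nonpos_imp_decreasing_open[where f = f and a = m and b = s])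
    show "m \<le> s" using ms by simp
  next
    fix x assume x: "m < x" "x < s"
    then have "x \<notin> S" using m(2)[of x] by auto
    then have "f x > C" using x ms by (simp add: S_def)
    then show "\<exists>y. (f has_real_derivative y) (at x) \<and> y \<le> 0" using d[of x] b[of x] x ms by auto
  qed (use ms in \<open>auto intro: continuous_on_subset[OF cont]\<close>)
  then show False using ms n by simp
qed

lemma derivative_lower_bound_growth:
  fixes f :: "real \<Rightarrow> real"
  assumes d: "\<And>s. s \<ge> s1 \<Longrightarrow> (f has_real_derivative f' s) (at s)"
    and b: "\<And>s. s \<ge> s1 \<Longrightarrow> f' s \<ge> c" and "s \<ge> s1"
  shows "f s \<ge> f s1 + c * (s - s1)"
proof -
  have "f s1 - c * s1 \<le> f s - c * s"
  proof (rule DERIV_nonneg_imp_nondecreasing[OF \<open>s \<ge> s1\<close>])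
    fix x assume "s1 \<le> x"
    then have "((\<lambda>s. f s - c * s) has_real_derivative f' x - c) (at x)"
      by (auto intro!: derivative_eq_intros d)
    then show "\<exists>y. ((\<lambda>s. f s - c * s) has_real_derivative y) (at x) \<and> y \<ge> 0"
      using b[OF \<open>s1 \<le> x\<close>] by auto
  qed
  then show ?thesis by (simp add: algebra_simps)
qed

lemma filterlim_at_top_derivative:
  fixes f :: "real \<Rightarrow> real"
  assumes d: "\<And>s. s \<ge> s1 \<Longrightarrow> (f has_real_derivative f' s) (at s)"
    and b: "\<And>s. s \<ge> s1 \<Longrightarrow> f' s \<ge> c" and "c > 0"
  shows "filterlim f at_top at_top"
  unfolding filterlim_at_top eventually_at_top_linorder
proof
  fix Z
  have "Z \<le> f s" if "s \<ge> s1 + \<bar>Z - f s1\<bar> / c" for s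
  proof -
    have "\<bar>Z - f s1\<bar> / c \<ge> 0" using \<open>c > 0\<close> by simp
    then have "s \<ge> s1" using that by linarith
    have "c * (\<bar>Z - f s1\<bar> / c) \<le> c * (s - s1)" using that \<open>c > 0\<close> by (intro mult_left_mono) auto
    then have "\<bar>Z - f s1\<bar> \<le> c * (s - s1)" using \<open>c > 0\<close> by simp
    then show ?thesis using derivative_lower_bound_growth[OF d b \<open>s \<ge> s1\<close>] by linarith
  qed
  then show "\<exists>N. \<forall>n\<ge>N. Z \<le> f n" by blast
qed

lemma filterlim_at_top_not_bounded:
  fixes f :: "real \<Rightarrow> real"
  assumes "filterlim f at_top at_top" "\<And>s. s \<ge> s0 \<Longrightarrow> f s \<le> B"
  shows False
proof -
  have "eventually (\<lambda>s. f s \<ge> B + 1) at_top" using assms(1) by (simp add: filterlim_at_top)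
  then obtain N where "\<And>n. n \<ge> N \<Longrightarrow> f n \<ge> B + 1" unfolding eventually_at_top_linorder by blast
  from this[of "max N s0"] assms(2)[of "max N s0"] show False by simp
qed

text \<open>Staying at or above \<open>C\<close> would make \<open>f\<close> fall without bound, so
  it gets below \<open>C\<close> at some time; the barrier keeps it there.\<close>

lemma eventually_le_of_derivative:
  fixes f :: "real \<Rightarrow> real"
  assumes d: "\<And>s. s \<ge> s1 \<Longrightarrow> (f has_real_derivative f' s) (at s)"
    and b: "\<And>s. s \<ge> s1 \<Longrightarrow> f s \<ge> C \<Longrightarrow> f' s \<le> -1"
  shows "eventually (\<lambda>s. f s \<le> C) at_top"
proof -
  have "\<exists>s2\<ge>s1. f s2 < C"
  proof (rule ccontr)
    assume "\<not> ?thesis"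
    then have *: "f s \<ge> C" if "s \<ge> s1" for s using that by force
    have "filterlim (\<lambda>s. - f s) at_top at_top"
    proof (rule filterlim_at_top_derivative)
      show "((\<lambda>s. - f s) has_real_derivative - f' s) (at s)" if "s \<ge> s1" for s
        by (intro DERIV_minus d that)
      show "- f' s \<ge> 1" if "s \<ge> s1" for s using b[OF that *[OF that]] by simp
    qed simp
    then show False by (rule filterlim_at_top_not_bounded[of _ s1 "- C"]) (use * in force)
  qed
  then obtain s2 where s2: "s2 \<ge> s1" "f s2 < C" by blast
  have "f s \<le> C" if "s \<ge> s2" for s
  proof (rule derivative_barrier[of s2 f f' C])
    show "f' x \<le> 0" if "s2 \<le> x" "C < f x" for x using b[of x] that s2 by simp
  qed (use s2 d that in auto)
  then show ?thesis unfolding eventually_at_top_linorder by blast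
qed

lemma mono_bounded_tendsto_at_top:
  fixes f :: "real \<Rightarrow> real"
  assumes m: "\<And>r s. s1 \<le> r \<Longrightarrow> r \<le> s \<Longrightarrow> f r \<le> f s" and B: "\<And>s. s1 \<le> s \<Longrightarrow> f s \<le> B"
  obtains l where "(f \<longlongrightarrow> l) at_top"
proof -
  define l where "l = (SUP s\<in>{s1..}. f s)"
  have bdd: "bdd_above (f ` {s1..})" using B by (auto simp: bdd_above_def)
  have "(f \<longlongrightarrow> l) at_top"
  proof (rule order_tendstoI)
    fix y assume "y < l"
    then obtain r where r: "r \<ge> s1" "y < f r"
      unfolding l_def using less_cSUP_iff[OF _ bdd] by auto
    then have "y < f s" if "s \<ge> r" for s using m[of r s] that by simp
    then show "eventually (\<lambda>s. y < f s) at_top" unfolding eventually_at_top_linorder by blast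
  next
    fix y assume "y > l"
    then have "f s < y" if "s \<ge> s1" for s
      using cSUP_upper[OF _ bdd, of s] that by (simp add: l_def)
    then show "eventually (\<lambda>s. f s < y) at_top" unfolding eventually_at_top_linorder by blast
  qed
  then show ?thesis by (rule that)
qed

text \<open>The functions \<open>a, t, e\<close> stand for the components \<open>\<langle>X, v\<rangle>, \<langle>T, v\<rangle>, \<langle>N, v\<rangle>\<close>; by the soliton
  equation \<open>t\<close> is the curvature.\<close>

locale scalar_system =
  fixes a t e :: "real \<Rightarrow> real" and Q :: real
  assumes da: "(a has_real_derivative t s) (at s)"
    and dt: "(t has_real_derivative a s + t s * e s) (at s)"
    and de: "(e has_real_derivative - (t s)\<^sup>2) (at s)"
    and cons: "(t s)\<^sup>2 + (e s)\<^sup>2 = Q + (a s)\<^sup>2"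
begin

lemma cont: "continuous_on S a" "continuous_on S t" "continuous_on S e"
  using da dt de by (meson DERIV_isCont continuous_at_imp_continuous_on)+

lemma neg: "scalar_system (\<lambda>s. - a s) (\<lambda>s. - t s) e Q"
  by standard (auto intro!: derivative_eq_intros da dt de simp: cons)

lemma reverse: "scalar_system (\<lambda>s. a (- s)) (\<lambda>s. - t (- s)) (\<lambda>s. - e (- s)) Q"
proof
  have *: "((\<lambda>s. f (- s)) has_real_derivative - D) (at s)" if "(f has_real_derivative D) (at (- s))" for f D s
    using DERIV_chain2[where f = f and g = uminus, OF that DERIV_minus[OF DERIV_ident]] by simp
  fix s
  show "((\<lambda>s. a (- s)) has_real_derivative - t (- s)) (at s)" by (rule *[OF da])
  show "((\<lambda>s. - t (- s)) has_real_derivative a (- s) + - t (- s) * - e (- s)) (at s)"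
    using DERIV_minus[OF *[OF dt]] by (simp add: add.commute)
  show "((\<lambda>s. - e (- s)) has_real_derivative - (- t (- s))\<^sup>2) (at s)"
    using DERIV_minus[OF *[OF de]] by simp
qed (simp add: cons)

lemma tendsto_of_positive:
  assumes pos: "\<And>s. s \<ge> s0 \<Longrightarrow> t s > 0"
  shows "\<exists>c\<in>{0, 1}. (t \<longlongrightarrow> c) at_top"
proof -
  have a_mono: "a r \<le> a s" if "s0 \<le> r" "r \<le> s" for r s
    by (rule DERIV_nonneg_imp_nondecreasing[OF that(2)])
      (use da pos that in \<open>force intro: less_imp_le\<close>)
  have e_mono: "e s \<le> e r" if "r \<le> s" for r s
    by (rule DERIV_nonpos_imp_nonincreasing[OF that]) (use de in \<open>force\<close>)
  show ?thesis
  proof (cases "\<exists>B. \<forall>s\<ge>s0. a s \<le> B")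
    case True
    then obtain B where B: "\<And>s. s \<ge> s0 \<Longrightarrow> a s \<le> B" by blast
    \<comment> \<open>\<open>C\<close> bounds \<open>e\<close> through the conserved quantity. The
      final 1 gives \<open>C \<le> C\<^sup>2\<close>, so the bound \<open>C\<close> for the square
      of \<open>e\<close> also bounds \<open>\<bar>e\<bar>\<close>.\<close>
    define C where "C = \<bar>Q\<bar> + (\<bar>a s0\<bar> + \<bar>B\<bar>)\<^sup>2 + 1"
    have C: "\<bar>e s\<bar> \<le> C" if "s \<ge> s0" for s
    proof -
      have "\<bar>a s\<bar> \<le> \<bar>a s0\<bar> + \<bar>B\<bar>" using a_mono[of s0 s] B[OF that] that by auto
      then have "(a s)\<^sup>2 \<le> (\<bar>a s0\<bar> + \<bar>B\<bar>)\<^sup>2" using power_mono[of "\<bar>a s\<bar>" "\<bar>a s0\<bar> + \<bar>B\<bar>" 2] by simp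
      then have "\<bar>e s\<bar>\<^sup>2 \<le> C" using cons[of s] unfolding C_def by (simp) (smt (verit) zero_le_power2)
      also have "C \<le> C\<^sup>2" unfolding C_def by (rule self_le_power) auto
      finally show ?thesis by (rule power2_le_imp_le) (simp add: C_def)
    qed
    obtain la where la: "(a \<longlongrightarrow> la) at_top"
      using mono_bounded_tendsto_at_top[of s0 a B] a_mono B by blast
    have "- e s \<le> C" if "s \<ge> s0" for s using C[OF that] by linarith
    then obtain le where "((\<lambda>s. - e s) \<longlongrightarrow> le) at_top"
      using mono_bounded_tendsto_at_top[of s0 "\<lambda>s. - e s" C] e_mono by fastforce
    then have le: "(e \<longlongrightarrow> - le) at_top" using tendsto_minus_cancel_left by fastforce
    \<comment> \<open>Being positive, \<open>t\<close> is recovered from \<open>a\<close> and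
      \<open>e\<close> by the conserved quantity, so it converges with them.\<close>
    have "((\<lambda>s. sqrt (Q + (a s)\<^sup>2 - (e s)\<^sup>2)) \<longlongrightarrow> sqrt (Q + la\<^sup>2 - (- le)\<^sup>2)) at_top"
      by (intro tendsto_intros la le)
    moreover have "eventually (\<lambda>s. sqrt (Q + (a s)\<^sup>2 - (e s)\<^sup>2) = t s) at_top"
      using eventually_ge_at_top[of s0]
    proof eventually_elim
      case (elim s)
      have "Q + (a s)\<^sup>2 - (e s)\<^sup>2 = (t s)\<^sup>2" using cons[of s] by simp
      then show ?case using pos[OF elim] by simp
    qed
    ultimately obtain l where l: "(t \<longlongrightarrow> l) at_top"
      using Lim_transform_eventually by blast
    have "l \<ge> 0"
      by (rule tendsto_lowerbound[OF l]) (use pos in \<open>auto intro: less_imp_le simp: eventually_at_top_linorder\<close>)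
    moreover have "\<not> l > 0"
    proof
      assume "l > 0"
      then have "eventually (\<lambda>s. t s > l / 2) at_top" using order_tendstoD(1)[OF l, of "l/2"] by simp
      then obtain s1 where s1: "\<And>s. s \<ge> s1 \<Longrightarrow> t s \<ge> l / 2"
        unfolding eventually_at_top_linorder by (meson less_imp_le)
      have "filterlim a at_top at_top"
        by (rule filterlim_at_top_derivative[OF da s1]) (use \<open>l > 0\<close> in auto)
      then show False by (rule filterlim_at_top_not_bounded[OF _ B])
    qed
    ultimately have "l = 0" by simp
    then show ?thesis using l by auto
  next
    case False
    have a_top: "filterlim a at_top at_top"
      unfolding filterlim_at_top eventually_at_top_linorder
    proof
      fix Z
      obtain s where "s \<ge> s0" "a s > Z" using False by (meson not_le)
      then show "\<exists>N. \<forall>n\<ge>N. Z \<le> a n" using a_mono by (meson less_imp_le order_trans)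
    qed
    \<comment> \<open>If \<open>e\<close> stayed bounded, the conserved quantity would make
      \<open>t\<^sup>2 \<ge> 1\<close> once \<open>a\<close> is large, and
      \<open>e' = - t\<^sup>2\<close> would send \<open>e\<close> to minus infinity.\<close>
    have e_bot: "\<exists>s. \<forall>r\<ge>s. e r < - Z" for Z
    proof (rule ccontr)
      assume "\<not> ?thesis"
      then have Z: "e s \<ge> - Z" for s using e_mono by (meson not_le order_le_less_trans)
      define C where "C = \<bar>Z\<bar> + \<bar>e s0\<bar>"
      have C: "(e s)\<^sup>2 \<le> C\<^sup>2" if "s \<ge> s0" for s
        unfolding abs_le_square_iff[symmetric] C_def using Z[of s] e_mono[OF that] by linarith
      have "eventually (\<lambda>s. a s \<ge> 1 + \<bar>Q\<bar> + C\<^sup>2) at_top" using a_top by (simp add: filterlim_at_top)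
      then obtain s1 where s1: "\<And>s. s \<ge> s1 \<Longrightarrow> a s \<ge> 1 + \<bar>Q\<bar> + C\<^sup>2"
        unfolding eventually_at_top_linorder by blast
      have "filterlim (\<lambda>s. - e s) at_top at_top"
      proof (rule filterlim_at_top_derivative[of "max s0 s1" "\<lambda>s. - e s" "\<lambda>s. (t s)\<^sup>2" 1])
        show "((\<lambda>s. - e s) has_real_derivative (t s)\<^sup>2) (at s)" for s
          using DERIV_minus[OF de[of s]] by simp
        fix s assume s: "s \<ge> max s0 s1"
        then have "a s \<ge> 1 + \<bar>Q\<bar> + C\<^sup>2" using s1 by simp
        moreover from this have "a s \<le> (a s)\<^sup>2"
          by (intro self_le_power) (smt (verit) zero_le_power2, simp)
        ultimately show "(t s)\<^sup>2 \<ge> 1" using cons[of s] C[of s] s by linarith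
      qed simp
      moreover have "- e s \<le> Z" for s using Z[of s] by linarith
      ultimately show False by (rule filterlim_at_top_not_bounded)
    qed
    \<comment> \<open>\<open>d\<close> is the small factor in
      \<open>t\<^sup>2 - Q = (a + e) * (a - e)\<close>, and \<open>d' = t - t\<^sup>2\<close>; these
      two identities bound it from both sides.\<close>
    define d where "d s = a s + e s" for s
    have dd: "(d has_real_derivative t s - (t s)\<^sup>2) (at s)" for s
      unfolding d_def using DERIV_add[OF da de] by simp
    have td: "(t s)\<^sup>2 = Q + d s * (a s - e s)" for s
      using cons[of s] by (simp add: d_def power2_eq_square algebra_simps)
    have dt': "(t has_real_derivative d s - e s * (1 - t s)) (at s)" for s
      using dt[of s] by (simp add: d_def algebra_simps)
    obtain s1 where s1: "s1 \<ge> s0" "\<And>s. s \<ge> s1 \<Longrightarrow> a s - e s \<ge> 1"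
    proof -
      obtain r where r: "\<And>s. s \<ge> r \<Longrightarrow> e s < - 1" using e_bot by blast
      have "eventually (\<lambda>s. a s \<ge> 0) at_top" using a_top by (simp add: filterlim_at_top)
      then obtain q where q: "\<And>s. s \<ge> q \<Longrightarrow> a s \<ge> 0" unfolding eventually_at_top_linorder by blast
      show ?thesis
        by (rule that[of "max s0 (max r q)"]) (use r q in \<open>force+\<close>)
    qed
    \<comment> \<open>Above \<open>K\<close> one has \<open>t\<^sup>2 > 1\<close>, since
      \<open>a - e \<ge> 1\<close> and \<open>K \<ge> 1 + \<bar>Q\<bar>\<close>; hence
      \<open>d\<close> decreases there.\<close>
    define K where "K = max (d s1) (1 + \<bar>Q\<bar>)"
    have K: "d s \<le> K" if "s \<ge> s1" for s
    proof (rule derivative_barrier[OF dd _ _ that])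
      fix s assume s: "s \<ge> s1" "d s > K"
      have "d s * 1 \<le> d s * (a s - e s)"
        using s s1(2)[of s] by (intro mult_left_mono) (auto simp: K_def)
      then have "(t s)\<^sup>2 > 1" using s unfolding td K_def by linarith
      then have "t s > 1" using pos[of s] s s1(1) by (smt (verit) one_power2 power2_le_imp_le)
      then have "t s * 1 \<le> t s * t s" by (intro mult_left_mono) auto
      then show "t s - (t s)\<^sup>2 \<le> 0" by (simp add: power2_eq_square)
    qed (simp add: K_def)
    have K': "d s \<ge> - \<bar>Q\<bar>" if "s \<ge> s1" for s
    proof (rule ccontr)
      assume "\<not> ?thesis"
      then have d: "d s < - \<bar>Q\<bar>" by simp
      then have "- d s * 1 \<le> - d s * (a s - e s)" using s1(2)[OF that] by (intro mult_left_mono) auto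
      then have "(t s)\<^sup>2 < 0" using d unfolding td by linarith
      then show False by (simp add: not_less[symmetric])
    qed
    have K_ge: "K \<ge> 1 + \<bar>Q\<bar>" by (simp add: K_def)
    have up: "eventually (\<lambda>s. t s \<le> 1 + \<epsilon>) at_top" and low: "eventually (\<lambda>s. - t s \<le> - (1 - \<epsilon>)) at_top"
      if "\<epsilon> > 0" for \<epsilon>
    proof -
      \<comment> \<open>Beyond this time and \<open>s1\<close>, \<open>- e * \<epsilon>\<close>
        exceeds \<open>\<bar>d\<bar>\<close> by at least 1, so outside the
        \<open>\<epsilon>\<close>-strip about 1 the function \<open>t\<close> moves towards it with
        speed at least 1.\<close>
      obtain r where r: "\<And>s. s \<ge> r \<Longrightarrow> e s < - ((K + 1) / \<epsilon>)" using e_bot by blast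
      have r: "K + 1 \<le> - e s * \<epsilon>" if "s \<ge> r" for s
        using r[OF that] \<open>\<epsilon> > 0\<close> by (simp add: field_simps)
      have en: "- e s \<ge> 0" if "s \<ge> r" for s
        using r[OF that] K_ge \<open>\<epsilon> > 0\<close> by (smt (verit) mult_nonpos_nonneg)
      show "eventually (\<lambda>s. t s \<le> 1 + \<epsilon>) at_top"
      proof (rule eventually_le_of_derivative[of "max s1 r", OF dt'])
        fix s assume s: "s \<ge> max s1 r" "t s \<ge> 1 + \<epsilon>"
        have "- e s * \<epsilon> \<le> - e s * (t s - 1)" using en s by (intro mult_left_mono) auto
        then show "d s - e s * (1 - t s) \<le> -1"
          using K[of s] r[of s] s by (simp add: algebra_simps)
      qed
      show "eventually (\<lambda>s. - t s \<le> - (1 - \<epsilon>)) at_top"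
      proof (rule eventually_le_of_derivative[of "max s1 r", OF DERIV_minus[OF dt']])
        fix s assume s: "s \<ge> max s1 r" "- t s \<ge> - (1 - \<epsilon>)"
        have "- e s * \<epsilon> \<le> - e s * (1 - t s)" using en s by (intro mult_left_mono) auto
        then show "- (d s - e s * (1 - t s)) \<le> -1"
          using K'[of s] K_ge r[of s] s by (simp add: algebra_simps)
      qed
    qed
    have "(t \<longlongrightarrow> 1) at_top"
    proof (rule tendstoI)
      fix \<epsilon> :: real assume "\<epsilon> > 0"
      then show "eventually (\<lambda>s. dist (t s) 1 < \<epsilon>) at_top"
        using up[of "\<epsilon>/2"] low[of "\<epsilon>/2"] by (auto elim: eventually_elim2 simp: dist_real_def abs_less_iff)
    qed
    then show ?thesis by auto
  qed
qed

end

locale nontrivial_scalar_system = scalar_system +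
  assumes nontrivial: "a s \<noteq> 0 \<or> t s \<noteq> 0"
begin

lemma product_sign:
  assumes "a c * t c \<ge> 0" "c < s"
  shows "a s * t s > 0"
proof -
  obtain H where H: "\<And>s. (H has_vector_derivative e s) (at s)" "H 0 = 0"
    using antiderivative_exists[OF cont(3)] by metis
  then have dH: "(H has_real_derivative e s) (at s)" for s
    by (simp add: has_real_derivative_iff_has_vector_derivative)
  \<comment> \<open>\<open>(a * t)' - e * (a * t) = a\<^sup>2 + t\<^sup>2\<close>, and the
    exponential turns the left side into a derivative.\<close>
  define y where "y s = a s * t s * exp (- H s)" for s
  have "y c < y s"
  proof (rule DERIV_pos_imp_increasing[OF assms(2)])
    fix x
    have "(y has_real_derivative ((t x)\<^sup>2 + (a x)\<^sup>2) * exp (- H x)) (at x)"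
      unfolding y_def by (auto intro!: derivative_eq_intros da dt dH simp: power2_eq_square algebra_simps)
    moreover have "(t x)\<^sup>2 + (a x)\<^sup>2 > 0" using nontrivial[of x] by (simp add: sum_power2_gt_zero_iff) blast
    ultimately show "\<exists>z. (y has_real_derivative z) (at x) \<and> z > 0" by auto
  qed
  moreover have "y c \<ge> 0" using assms(1) by (simp add: y_def)
  ultimately have "y s > 0" by simp
  then show ?thesis by (simp add: y_def zero_less_mult_iff)
qed

lemma product_neg:
  assumes "a c * t c \<le> 0" "s < c"
  shows "a s * t s < 0"
  using product_sign[of s c] assms by force

lemma nontrivial_neg: "nontrivial_scalar_system (\<lambda>s. - a s) (\<lambda>s. - t s) e Q"
  using neg nontrivial by (simp add: nontrivial_scalar_system_def nontrivial_scalar_system_axioms_def)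

lemma eventually_sign: "\<exists>s0. (\<forall>s\<ge>s0. t s > 0) \<or> (\<forall>s\<ge>s0. t s < 0)"
proof -
  obtain s0 where s0: "\<And>s. s \<ge> s0 \<Longrightarrow> t s \<noteq> 0"
  proof (cases "\<exists>c. t c = 0")
    case True
    then obtain c where "t c = 0" by blast
    then have "t s \<noteq> 0" if "s \<ge> c + 1" for s using product_sign[of c s] that by auto
    then show ?thesis by (rule that)
  qed (use that in blast)
  have "t r * t s > 0" if rs: "s0 \<le> r" "r \<le> s" for r s
  proof (rule ccontr)
    assume "\<not> ?thesis"
    then have "t r \<le> 0 \<and> 0 \<le> t s \<or> t s \<le> 0 \<and> 0 \<le> t r"
      by (smt (verit) mult_pos_pos mult_neg_neg)
    then consider "t r \<le> 0" "0 \<le> t s" | "t s \<le> 0" "0 \<le> t r" by blast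
    then obtain x where "r \<le> x" "t x = 0"
    proof cases
      case 1
      from IVT'[OF 1 rs(2) cont(2)] show ?thesis using that by blast
    next
      case 2
      from IVT2'[OF 2 rs(2) cont(2)] show ?thesis using that by blast
    qed
    then show False using s0[of x] rs by simp
  qed
  then have *: "t s0 * t s > 0" if "s \<ge> s0" for s using that by simp
  show ?thesis
  proof (cases "t s0 > 0")
    case True
    then have "\<forall>s\<ge>s0. t s > 0" using * by (simp add: zero_less_mult_iff)
    then show ?thesis by blast
  next
    case False
    then have "\<forall>s\<ge>s0. t s < 0" using * by (simp add: zero_less_mult_iff)
    then show ?thesis by blast
  qed
qed

lemma tendsto_at_top: "\<exists>c\<in>{-1, 0, 1}. (t \<longlongrightarrow> c) at_top"
proof -
  interpret neg: nontrivial_scalar_system "\<lambda>s. - a s" "\<lambda>s. - t s" e Q by (rule nontrivial_neg)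
  obtain s0 where "(\<forall>s\<ge>s0. t s > 0) \<or> (\<forall>s\<ge>s0. t s < 0)" using eventually_sign by blast
  then show ?thesis
  proof
    assume "\<forall>s\<ge>s0. t s < 0"
    then obtain c where "c \<in> {0, 1}" "((\<lambda>s. - t s) \<longlongrightarrow> c) at_top"
      using neg.tendsto_of_positive[of s0] by auto
    then show ?thesis using tendsto_minus[of "\<lambda>s. - t s" c at_top] by auto
  qed (use tendsto_of_positive in auto)
qed

end

lemma (in scalar_system) shift: "scalar_system (\<lambda>s. a (s + c)) (\<lambda>s. t (s + c)) (\<lambda>s. e (s + c)) Q"
proof -
  have *: "((\<lambda>s. f (s + c)) has_real_derivative D) (at s)" if "(f has_real_derivative D) (at (s + c))" for f D s
    using that by (simp add: DERIV_shift)
  show ?thesis by standard (auto intro: * da dt de simp: cons)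
qed

text \<open>Uniqueness for the products alone. It yields reflection symmetries of
  \<open>(a, t, e)\<close> that the curve itself shares only up to an isometry.\<close>

lemma scalar_system_unique:
  assumes "scalar_system a t e Q" "scalar_system a' t' e' Q'" "a r = a' r" "t r = t' r" "e r = e' r"
  shows "a s = a' s" "t s = t' s" "e s = e' s"
proof -
  define A :: "real \<times> real \<times> real \<Rightarrow> real \<times> real \<times> real" where "A = (\<lambda>(a, t, e). (t, a, 0))"
  define B :: "real \<times> real \<times> real \<Rightarrow> real \<times> real \<times> real \<Rightarrow> real \<times> real \<times> real" where
    "B = (\<lambda>(a, t, e) (a', t', e'). (0, t * e', - (t * t')))"
  have "linear A" by (rule linearI) (auto simp: A_def split: prod.splits)
  moreover have "bilinear B"
    by (auto simp: bilinear_def B_def algebra_simps intro!: linearI split: prod.splits)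
  ultimately have lip: "locally_lipschitz (\<lambda>z. A z + B z z)"
    by (intro locally_lipschitz_quadratic)
      (simp_all add: linear_conv_bounded_linear bilinear_conv_bounded_bilinear)
  have sol: "solves_ode_on (\<lambda>z. A z + B z z) UNIV (\<lambda>s. (a s, t s, e s))" if "scalar_system a t e Q" for a t e Q
  proof -
    interpret scalar_system a t e Q by (rule that)
    show ?thesis unfolding solves_ode_on_def
      by (auto simp: A_def B_def power2_eq_square simp flip: has_real_derivative_iff_has_vector_derivative
          intro!: has_vector_derivative_Pair da[unfolded has_real_derivative_iff_has_vector_derivative]
            dt[unfolded has_real_derivative_iff_has_vector_derivative]
            de[unfolded has_real_derivative_iff_has_vector_derivative power2_eq_square])
  qed
  have "(\<lambda>s. (a s, t s, e s)) s = (\<lambda>s. (a' s, t' s, e' s)) s"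
    by (rule ode_unique[OF lip _ _ _ sol[OF assms(1)] sol[OF assms(2)], of r]) (auto simp: assms)
  then show "a s = a' s" "t s = t' s" "e s = e' s" by auto
qed

section \<open>Symmetries of soliton frames and their scalar components\<close>

lemma mframe_minus:
  assumes "mframe x t n"
  shows "mframe x t (- n)" "mframe x (- t) (- n)"
  using assms by (simp_all add: mframe_def mink_simps)

text \<open>Traversing the curve backwards keeps \<open>v\<close> and changes the sign of
  \<open>mink N v\<close>, which later allows that product to be taken nonnegative at the turning
  point.\<close>

lemma soliton_frame_reverse:
  assumes "soliton_frame v \<epsilon> UNIV X T N"
  shows "soliton_frame v \<epsilon> UNIV (\<lambda>s. X (- s)) (\<lambda>s. - T (- s)) (\<lambda>s. - N (- s))"
proof -
  have *: "((\<lambda>s. f (- s)) has_vector_derivative - D) (at s)"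
    if "(f has_vector_derivative D) (at (- s))" for f :: "real \<Rightarrow> real^3" and D s
  proof -
    have "((f \<circ> uminus) has_vector_derivative (- 1) *\<^sub>R D) (at s)"
      using that by (intro vector_diff_chain_at) (auto intro!: derivative_eq_intros)
    then show ?thesis by (simp add: o_def)
  qed
  note d = soliton_frame_derivs[OF assms UNIV_I]
  have "((\<lambda>s. - T (- s)) has_vector_derivative X (- s) + mink (- T (- s)) v *\<^sub>R - N (- s)) (at s)" for s
    using has_vector_derivative_minus[OF *[OF d(2)]] by (simp add: mink_simps add.commute)
  moreover have "((\<lambda>s. - N (- s)) has_vector_derivative - (mink (- T (- s)) v *\<^sub>R - T (- s))) (at s)" for s
    using has_vector_derivative_minus[OF *[OF d(3)]] by (simp add: mink_simps)
  moreover have "- N (- s) = \<epsilon> *\<^sub>R mcross (X (- s)) (- T (- s))" for s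
    using assms by (simp add: soliton_frame_def mcross_simps)
  ultimately show ?thesis
    using assms *[OF d(1)] mframe_minus(2) unfolding soliton_frame_def solves_frame_field_iff by blast
qed

lemma soliton_frame_shift:
  assumes "soliton_frame v \<epsilon> UNIV X T N"
  shows "soliton_frame v \<epsilon> UNIV (\<lambda>s. X (s + c)) (\<lambda>s. T (s + c)) (\<lambda>s. N (s + c))"
  using assms solves_ode_on_shift[of "frame_field v" UNIV "\<lambda>s. (X s, T s, N s)" UNIV c]
  unfolding soliton_frame_def by blast

text \<open>Changing the sign of \<open>v\<close> and of the normal together changes the sign of
  \<open>mink X v\<close> and keeps \<open>mink N v\<close>; \<open>\<epsilon>\<close> absorbs the
  change of orientation.\<close>

lemma soliton_frame_flip:
  assumes "soliton_frame v \<epsilon> UNIV X T N"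
  shows "soliton_frame (- v) (- \<epsilon>) UNIV X T (\<lambda>s. - N s)"
proof -
  note d = soliton_frame_derivs[OF assms UNIV_I]
  have "((\<lambda>s. - N s) has_vector_derivative - (mink (T s) (- v) *\<^sub>R T s)) (at s)" for s
    using has_vector_derivative_minus[OF d(3)] by (simp add: mink_simps)
  moreover have "(T has_vector_derivative X s + mink (T s) (- v) *\<^sub>R - N s) (at s)" for s
    using d(2) by (simp add: mink_simps)
  moreover have "- N s = - \<epsilon> *\<^sub>R mcross (X s) (T s)" for s
    using assms by (simp add: soliton_frame_def)
  ultimately show ?thesis
    using assms d(1) mframe_minus(1) unfolding soliton_frame_def solves_frame_field_iff by blast
qed

locale global_soliton =
  fixes v :: "real^3" and \<epsilon> :: real and X T N :: "real \<Rightarrow> real^3"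
  assumes sf: "soliton_frame v \<epsilon> UNIV X T N"
begin

definition "a s = mink (X s) v"
definition "t s = mink (T s) v"
definition "e s = mink (N s) v"

lemma frame: "X s \<in> H2" "mframe (X s) (T s) (N s)" "N s = \<epsilon> *\<^sub>R mcross (X s) (T s)"
  using sf unfolding soliton_frame_def by blast+

lemmas dX = soliton_frame_derivs(1)[OF sf UNIV_I]
  and dT = soliton_frame_derivs(2)[OF sf UNIV_I, folded t_def]
  and dN = soliton_frame_derivs(3)[OF sf UNIV_I, folded t_def]

sublocale scalar_system a t e "mink v v"
proof
  fix s
  show "(a has_real_derivative t s) (at s)"
    unfolding a_def t_def using has_vector_derivative_mink[OF dX has_vector_derivative_const] by (simp add: mink_simps)
  show "(t has_real_derivative a s + t s * e s) (at s)"
  proof -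
    have "((\<lambda>s. mink (T s) v) has_real_derivative mink (X s + t s *\<^sub>R N s) v) (at s)"
      using has_vector_derivative_mink[OF dT has_vector_derivative_const] by (simp add: mink_simps)
    then show ?thesis by (simp add: t_def[abs_def] a_def e_def mink_simps)
  qed
  show "(e has_real_derivative - (t s)\<^sup>2) (at s)"
  proof -
    have "((\<lambda>s. mink (N s) v) has_real_derivative mink (- (t s *\<^sub>R T s)) v) (at s)"
      using has_vector_derivative_mink[OF dN has_vector_derivative_const] by (simp add: mink_simps)
    then show ?thesis by (simp add: e_def[abs_def] t_def mink_simps power2_eq_square)
  qed
  show "(t s)\<^sup>2 + (e s)\<^sup>2 = mink v v + (a s)\<^sup>2"
    using frame(2)[of s] unfolding mframe_iff_parseval parseval_def
    by (simp add: a_def e_def t_def power2_eq_square) (smt (verit))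
qed

lemma continuous_X: "continuous_on S X"
  using dX by (auto intro!: continuous_at_imp_continuous_on has_vector_derivative_continuous)

lemma norm_at_top_of_mink:
  assumes "filterlim (\<lambda>s. mink (X s) w) at_top at_top"
  shows "filterlim (\<lambda>s. norm (X s)) at_top at_top"
proof -
  obtain K where K: "\<And>x y. norm (mink x y) \<le> norm x * norm y * K" "K \<ge> 0"
    using bounded_bilinear.nonneg_bounded[OF bounded_bilinear_mink] by blast
  define C where "C = norm w * K + 1"
  have C: "C > 0" "mink x w \<le> norm x * C" for x
  proof -
    show "C > 0" unfolding C_def using K(2) by (simp add: add_nonneg_pos)
    have "mink x w \<le> norm x * norm w * K" using K(1)[of x w] by simp
    then show "mink x w \<le> norm x * C" by (simp add: C_def distrib_left mult.assoc add_increasing2)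
  qed
  show ?thesis unfolding filterlim_at_top
  proof
    fix Z
    have "eventually (\<lambda>s. mink (X s) w \<ge> Z * C) at_top" using assms by (simp add: filterlim_at_top)
    then show "eventually (\<lambda>s. Z \<le> norm (X s)) at_top"
    proof eventually_elim
      case (elim s)
      then have "Z * C \<le> norm (X s) * C" using C(2)[of "X s"] by linarith
      then show ?case using C(1) by simp
    qed
  qed
qed

text \<open>For the limits 1 and -1 the height \<open>a\<close> or \<open>- a\<close> grows at least
  linearly. For the limit 0 it may stay bounded, and the first coordinate takes its place.\<close>

lemma norm_X_at_top:
  assumes "(t \<longlongrightarrow> c) at_top" "c \<in> {-1, 0, 1}"
  shows "filterlim (\<lambda>s. norm (X s)) at_top at_top"
proof -
  have "\<exists>w. filterlim (\<lambda>s. mink (X s) w) at_top at_top"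
  proof -
    consider "c = 1" | "c = -1" | "c = 0" using assms(2) by auto
    then show ?thesis
    proof cases
      case 1
      then have "eventually (\<lambda>s. t s > 1 / 2) at_top" using order_tendstoD(1)[OF assms(1), of "1/2"] by simp
      then obtain r where r: "\<And>s. s \<ge> r \<Longrightarrow> t s \<ge> 1 / 2"
        unfolding eventually_at_top_linorder by (meson less_imp_le)
      have "filterlim a at_top at_top" by (rule filterlim_at_top_derivative[OF da r]) auto
      then show ?thesis unfolding a_def[abs_def] by blast
    next
      case 2
      then have "eventually (\<lambda>s. t s < - 1 / 2) at_top" using order_tendstoD(2)[OF assms(1), of "-1/2"] by simp
      then obtain r where r: "\<And>s. s \<ge> r \<Longrightarrow> - t s \<ge> 1 / 2"
        unfolding eventually_at_top_linorder by force
      have "filterlim (\<lambda>s. - a s) at_top at_top"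
        by (rule filterlim_at_top_derivative[OF DERIV_minus[OF da] r]) auto
      then have "filterlim (\<lambda>s. mink (X s) (- v)) at_top at_top" by (simp add: a_def mink_simps)
      then show ?thesis by blast
    next
      case 3
      then have "eventually (\<lambda>s. t s < 1 / 2) at_top" "eventually (\<lambda>s. - 1 / 2 < t s) at_top"
        using order_tendstoD(2)[OF assms(1), of "1/2"] order_tendstoD(1)[OF assms(1), of "- 1/2"] by simp_all
      then have "eventually (\<lambda>s. \<bar>t s\<bar> \<le> 1 / 2) at_top" by eventually_elim auto
      then obtain r where r: "\<And>s. s \<ge> r \<Longrightarrow> \<bar>t s\<bar> \<le> 1 / 2"
        unfolding eventually_at_top_linorder by blast
      \<comment> \<open>The product with \<open>w\<close> is the first coordinate. Writing
        \<open>x\<close> and \<open>n\<close> for that of \<open>X\<close> and \<open>N\<close>, one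
        has \<open>x'' = x + t * n\<close> and, by Parseval, \<open>\<bar>n\<bar> \<le> x\<close>;
        so \<open>x'' \<ge> x / 2\<close> once \<open>\<bar>t\<bar> \<le> 1 / 2\<close>.\<close>
      define w :: "real^3" where "w = vector [-1, 0, 0]"
      have w: "mink w w = -1" "mink x w = x $ 1" for x by (simp_all add: w_def mink_def)
      have dx: "((\<lambda>s. mink (X s) w) has_real_derivative mink (T s) w) (at s)" for s
        using has_vector_derivative_mink[OF dX has_vector_derivative_const] by (simp add: mink_simps)
      have dt1: "((\<lambda>s. mink (T s) w) has_real_derivative mink (X s) w + t s * mink (N s) w) (at s)" for s
        using has_vector_derivative_mink[OF dT has_vector_derivative_const] by (simp add: mink_simps)
      have x1: "mink (X s) w \<ge> 1" and n1: "\<bar>mink (N s) w\<bar> \<le> mink (X s) w" for s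
      proof -
        have x0: "mink (X s) w > 0" using frame(1)[of s] by (simp add: w(2) H2_def)
        have p: "- (mink (X s) w * mink (X s) w) + mink (T s) w * mink (T s) w + mink (N s) w * mink (N s) w = -1"
          using frame(2)[of s] w(1) unfolding mframe_iff_parseval parseval_def by metis
        then have "1\<^sup>2 \<le> (mink (X s) w)\<^sup>2" "\<bar>mink (N s) w\<bar>\<^sup>2 \<le> (mink (X s) w)\<^sup>2"
          unfolding power2_abs by (simp_all add: power2_eq_square) (smt (verit) zero_le_square)+
        then show "mink (X s) w \<ge> 1" "\<bar>mink (N s) w\<bar> \<le> mink (X s) w"
          using x0 by (auto intro: power2_le_imp_le)
      qed
      have "filterlim (\<lambda>s. mink (T s) w) at_top at_top"
      proof (rule filterlim_at_top_derivative[OF dt1])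
        fix s assume s: "s \<ge> r"
        have "\<bar>t s * mink (N s) w\<bar> \<le> 1 / 2 * mink (X s) w"
          unfolding abs_mult using r[OF s] n1 by (intro mult_mono) auto
        then show "mink (X s) w + t s * mink (N s) w \<ge> 1 / 2" using x1[of s] by linarith
      qed simp
      then have "eventually (\<lambda>s. mink (T s) w \<ge> 1) at_top" by (simp add: filterlim_at_top)
      then obtain q where q: "\<And>s. s \<ge> q \<Longrightarrow> mink (T s) w \<ge> 1"
        unfolding eventually_at_top_linorder by blast
      have "filterlim (\<lambda>s. mink (X s) w) at_top at_top"
        by (rule filterlim_at_top_derivative[OF dx q]) auto
      then show ?thesis by blast
    qed
  qed
  then show ?thesis using norm_at_top_of_mink by blast
qed

text \<open>The constant solution \<open>(0, 0, e r)\<close> has the same data at \<open>r\<close>;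
  this is the geodesic case.\<close>

lemma trivial_everywhere:
  assumes "a r = 0" "t r = 0"
  shows "a s = 0" "t s = 0" "e s = e r"
proof -
  have "scalar_system (\<lambda>s. 0) (\<lambda>s. 0) (\<lambda>s. e r) ((e r)\<^sup>2)"
    by standard (auto intro!: derivative_eq_intros)
  from scalar_system_unique[OF scalar_system_axioms this, of r s] assms
  show "a s = 0" "t s = 0" "e s = e r" by auto
qed

lemma t_tendsto: "\<exists>c\<in>{-1, 0, 1}. (t \<longlongrightarrow> c) at_top"
proof (cases "\<exists>r. a r = 0 \<and> t r = 0")
  case True
  then have "t s = 0" for s using trivial_everywhere by blast
  then have "t = (\<lambda>s. 0)" by auto
  then show ?thesis by auto
next
  case False
  then interpret nontrivial_scalar_system a t e "mink v v" by unfold_locales auto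
  show ?thesis by (rule tendsto_at_top)
qed

subsection \<open>Injectivity\<close>

text \<open>\<open>f\<close>, the hyperbolic cosine of the distance to \<open>X p\<close>, satisfies
  \<open>f'' = f \<ge> 1\<close> and \<open>f' = 0\<close> at \<open>p\<close>, so it increases
  strictly afterwards.\<close>

lemma geodesic_inj:
  assumes "\<And>s. t s = 0" "p < q"
  shows "X p \<noteq> X q"
proof
  assume eq: "X p = X q"
  define f where "f s = - mink (X s) (X p)" for s
  define h where "h s = - mink (T s) (X p)" for s
  have f: "(f has_real_derivative h s) (at s)" for s
    unfolding f_def h_def using DERIV_minus[OF has_vector_derivative_mink[OF dX has_vector_derivative_const]]
    by (simp add: mink_simps)
  have h: "(h has_real_derivative f s) (at s)" for s
    unfolding f_def h_def using DERIV_minus[OF has_vector_derivative_mink[OF dT has_vector_derivative_const]]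
    by (simp add: mink_simps assms(1))
  have f1: "f s \<ge> 1" for s using H2_mink_le[OF frame(1)[of s] frame(1)[of p]] by (simp add: f_def)
  have h0: "h p = 0" using frame(2)[of p] by (simp add: h_def mframe_def mink_commute[of "T p" "X p"])
  have "h s > 0" if "s > p" for s
    using DERIV_pos_imp_increasing[OF that, of h] h f1 h0 by (metis less_le_trans zero_less_one)
  moreover have "continuous_on {p..q} f"
    using f by (auto intro!: continuous_at_imp_continuous_on DERIV_isCont)
  ultimately have "f p < f q"
    using f by (intro DERIV_pos_imp_increasing_open[OF assms(2)]) auto
  then show False using eq by (simp add: f_def)
qed

lemma \<epsilon>_square: "\<epsilon> * \<epsilon> = 1"
proof -
  have "mink (N 0) (N 0) = \<epsilon> * \<epsilon> * mink (mcross (X 0) (T 0)) (mcross (X 0) (T 0))"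
    unfolding frame(3)[of 0] by (simp add: mink_simps)
  moreover have "mink (N 0) (N 0) = 1" "mink (mcross (X 0) (T 0)) (mcross (X 0) (T 0)) = 1"
    using frame(2)[of 0] unfolding mframe_def mink_mcross_mcross by simp_all
  ultimately show ?thesis by simp
qed

text \<open>The tangential part of \<open>v\<close>, which is the gradient of the height function
  \<open>x \<mapsto> mink x v\<close> on \<open>H2\<close>.\<close>

lemma gradient_frame: "v + a s *\<^sub>R X s = t s *\<^sub>R T s + e s *\<^sub>R N s"
proof -
  have "v = - a s *\<^sub>R X s + t s *\<^sub>R T s + e s *\<^sub>R N s"
    using mframe_expand[OF frame(2), of v s] by (simp only: a_def t_def e_def)
  from arg_cong[OF this, of "\<lambda>z. z + a s *\<^sub>R X s"] show ?thesis by simp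
qed

text \<open>The Killing field is the gradient turned by a right angle, in the sense given by
  \<open>\<epsilon>\<close>.\<close>

lemma killing_frame: "\<epsilon> *\<^sub>R mcross (X s) v = t s *\<^sub>R N s - e s *\<^sub>R T s"
proof -
  have "v = - a s *\<^sub>R X s + t s *\<^sub>R T s + e s *\<^sub>R N s"
    using mframe_expand[OF frame(2), of v s] by (simp only: a_def t_def e_def)
  then have "mcross (X s) v = mcross (X s) (- a s *\<^sub>R X s + t s *\<^sub>R T s + e s *\<^sub>R N s)" by (rule arg_cong)
  also have "\<dots> = t s *\<^sub>R mcross (X s) (T s) + e s *\<^sub>R mcross (X s) (N s)" by (simp add: mcross_simps)
  also have "mcross (X s) (N s) = - \<epsilon> *\<^sub>R T s"
    unfolding frame(3)[of s] using mframe_mcross_normal[OF frame(2)[of s]] by (simp add: mcross_simps)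
  finally have "\<epsilon> *\<^sub>R mcross (X s) v = \<epsilon> *\<^sub>R (t s *\<^sub>R mcross (X s) (T s) + e s *\<^sub>R - \<epsilon> *\<^sub>R T s)"
    by (rule arg_cong)
  also have "\<dots> = t s *\<^sub>R (\<epsilon> *\<^sub>R mcross (X s) (T s)) - (e s * (\<epsilon> * \<epsilon>)) *\<^sub>R T s"
    by (simp add: algebra_simps)
  finally show ?thesis by (simp add: \<epsilon>_square flip: frame(3))
qed

text \<open>The two previous identities solved for \<open>T\<close>. The right side involves only
  the position, \<open>t\<close> and \<open>e\<close>, so tangents at equal height can be compared
  without the normals.\<close>

lemma tangent_eq:
  "(mink v v + (a s)\<^sup>2) *\<^sub>R T s = t s *\<^sub>R (v + a s *\<^sub>R X s) - (e s * \<epsilon>) *\<^sub>R mcross (X s) v"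
proof -
  have K: "(e s * \<epsilon>) *\<^sub>R mcross (X s) v = e s *\<^sub>R (t s *\<^sub>R N s - e s *\<^sub>R T s)"
    by (simp flip: killing_frame)
  have "t s *\<^sub>R (v + a s *\<^sub>R X s) - (e s * \<epsilon>) *\<^sub>R mcross (X s) v = ((t s)\<^sup>2 + (e s)\<^sup>2) *\<^sub>R T s"
    unfolding gradient_frame K by (simp add: algebra_simps power2_eq_square)
  then show ?thesis by (simp only: cons)
qed

text \<open>Opposite tangents at a double point make the reversed curve
  \<open>s \<mapsto> X (l + r - s)\<close> coincide with \<open>X\<close>. At the midpoint of
  \<open>l\<close> and \<open>r\<close> this forces \<open>T = - T\<close>.\<close>

lemma opposite_tangents_impossible:
  assumes "X l = X r" "t l = - t r" "e l = - e r" "t r \<noteq> 0"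
  shows False
proof -
  have al: "a l = a r" by (simp add: a_def assms)
  have ne: "mink v v + (a r)\<^sup>2 \<noteq> 0"
    using assms(4) cons[of r] by (smt (verit) zero_le_power2 zero_eq_power2)
  have "(mink v v + (a r)\<^sup>2) *\<^sub>R T l = - ((mink v v + (a r)\<^sup>2) *\<^sub>R T r)"
    unfolding tangent_eq[of r] tangent_eq[of l, unfolded al assms(1-3)] by simp
  then have "(mink v v + (a r)\<^sup>2) *\<^sub>R T l = (mink v v + (a r)\<^sup>2) *\<^sub>R (- T r)" by simp
  then have T: "T l = - T r" using ne by (metis scaleR_cancel_left)
  then have N: "N l = - N r" by (simp add: frame(3) assms mcross_simps)
  have rev: "soliton_frame v \<epsilon> UNIV (\<lambda>s. X (- (s + - (l + r)))) (\<lambda>s. - T (- (s + - (l + r)))) (\<lambda>s. - N (- (s + - (l + r))))"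
    by (rule soliton_frame_shift[OF soliton_frame_reverse[OF sf]])
  have "T ((l + r) / 2) = - T (- ((l + r) / 2 + - (l + r)))"
    by (rule soliton_frame_unique(2)[OF sf rev, of r]) (use T N assms(1) in auto)
  moreover have "- ((l + r) / 2 + - (l + r)) = (l + r) / 2" by (simp add: field_simps)
  ultimately have "T ((l + r) / 2) + T ((l + r) / 2) = 0" by (metis add.left_inverse)
  then have "T ((l + r) / 2) = 0" by (simp flip: scaleR_2)
  then show False using frame(2)[of "(l + r) / 2"] by (simp add: mframe_def mink_simps)
qed

end

section \<open>Comparison of the two branches over a common height\<close>

text \<open>Meant for the height on one branch. Its inverse has infinite slope at the turning point
  and is merely continuous there, so the derivative is asserted in the interior.\<close>

lemma inverse_function_on_interval:
  fixes f :: "real \<Rightarrow> real"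
  assumes inj: "inj_on f {p..q}" and im: "f ` {p..q} = {m..M}"
    and d: "\<And>x. (f has_real_derivative f' x) (at x)"
  obtains g where "continuous_on {m..M} g" "\<And>u. u \<in> {m..M} \<Longrightarrow> g u \<in> {p..q} \<and> f (g u) = u"
    "\<And>u. m < u \<Longrightarrow> u < M \<Longrightarrow> f' (g u) \<noteq> 0 \<Longrightarrow> (g has_real_derivative inverse (f' (g u))) (at u)"
    "\<And>x. x \<in> {p..q} \<Longrightarrow> g (f x) = x"
proof -
  define g where "g = inv_into {p..q} f"
  have gf: "g (f x) = x" if "x \<in> {p..q}" for x using inj that by (simp add: g_def)
  have fg: "g u \<in> {p..q} \<and> f (g u) = u" if "u \<in> {m..M}" for u
    using that unfolding g_def im[symmetric] by (meson f_inv_into_f inv_into_into)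
  have "continuous_on {p..q} f" using d by (auto intro!: continuous_at_imp_continuous_on DERIV_isCont)
  then have cont: "continuous_on {m..M} g"
    using continuous_on_inv[of "{p..q}" f g] gf im by simp
  have "(g has_real_derivative inverse (f' (g u))) (at u)" if "m < u" "u < M" "f' (g u) \<noteq> 0" for u
  proof (rule DERIV_inverse_function[where f = f and g = g, OF d that(3) that(1,2)])
    show "f (g y) = y" if "m < y" "y < M" for y using fg[of y] that by simp
    show "isCont g u" using cont that(1,2) by (simp add: continuous_on_interior)
  qed
  then show ?thesis using that cont fg gf by blast
qed

text \<open>On a circle of fixed radius \<open>x / p\<close> is the tangent of the angle whose sine
  is proportional to \<open>x\<close>, an odd increasing function of \<open>x\<close>.\<close>

lemma slope_sum_pos:
  fixes x y p q :: real
  assumes "p > 0" "q > 0" "p\<^sup>2 + x\<^sup>2 = q\<^sup>2 + y\<^sup>2" "x + y > 0"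
  shows "x / p + y / q > 0"
proof -
  have main: "x / p + y / q > 0" if "p > 0" "q > 0" "p\<^sup>2 + x\<^sup>2 = q\<^sup>2 + y\<^sup>2" "x + y > 0" "y \<le> 0"
    for x y p q :: real
  proof -
    have "(- y)\<^sup>2 < x\<^sup>2" using that by (intro power_strict_mono) auto
    then have "p\<^sup>2 < q\<^sup>2" using that(3) by simp
    then have "p < q" using that by (simp add: power2_less_imp_less)
    then have "- y / q \<le> - y / p" using that by (intro divide_left_mono) auto
    also have "\<dots> < x / p" using that by (intro divide_strict_right_mono) auto
    finally show ?thesis by simp
  qed
  consider "y \<le> 0" | "x \<le> 0" | "x > 0" "y > 0" by linarith
  then show ?thesis
  proof cases
    case 2
    then show ?thesis using main[of q p y x] assms by (simp add: add.commute)
  next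
    case 3
    then show ?thesis using assms by (intro add_pos_pos divide_pos_pos)
  qed (use main[of p q x y] assms in auto)
qed

text \<open>\<open>(\<kappa>, w \<gamma>)\<close> rotates by the angle \<open>w D\<close>, where \<open>w = sqrt (- Q)\<close>.\<close>

lemma rotation_no_return:
  fixes \<kappa> \<gamma> D :: "real \<Rightarrow> real"
  assumes "m < M" "w > 0" and cont: "continuous_on {m..M} \<kappa>" "continuous_on {m..M} \<gamma>" "continuous_on {m..M} D"
    and d: "\<And>u. m < u \<Longrightarrow> u < M \<Longrightarrow> (\<kappa> has_real_derivative - w\<^sup>2 * \<gamma> u * D' u) (at u)"
      "\<And>u. m < u \<Longrightarrow> u < M \<Longrightarrow> (\<gamma> has_real_derivative \<kappa> u * D' u) (at u)"
      "\<And>u. m < u \<Longrightarrow> u < M \<Longrightarrow> (D has_real_derivative D' u) (at u)"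
    and 0: "\<kappa> m = 1" "\<gamma> m = 0" "D m = 0" and M: "0 < D M" "w * D M < pi"
  shows "\<gamma> M \<noteq> 0"
proof
  assume \<gamma>: "\<gamma> M = 0"
  \<comment> \<open>\<open>f\<close> and \<open>g\<close> are the coordinates of
    \<open>(\<kappa>, w * \<gamma>)\<close> rotated back by \<open>w * D\<close>, so they keep their
    initial values 1 and 0.\<close>
  define f where "f u = \<kappa> u * cos (w * D u) + w * \<gamma> u * sin (w * D u)" for u
  define g where "g u = w * \<gamma> u * cos (w * D u) - \<kappa> u * sin (w * D u)" for u
  have "f M = f m"
  proof (rule DERIV_isconst_end[OF \<open>m < M\<close>])
    show "continuous_on {m..M} f" unfolding f_def by (intro continuous_intros cont)
    show "(f has_real_derivative 0) (at u)" if "m < u" "u < M" for u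
      unfolding f_def by (auto intro!: derivative_eq_intros d that simp: power2_eq_square algebra_simps)
  qed
  moreover have "g M = g m"
  proof (rule DERIV_isconst_end[OF \<open>m < M\<close>])
    show "continuous_on {m..M} g" unfolding g_def by (intro continuous_intros cont)
    show "(g has_real_derivative 0) (at u)" if "m < u" "u < M" for u
      unfolding g_def by (auto intro!: derivative_eq_intros d that simp: power2_eq_square algebra_simps)
  qed
  ultimately have "\<kappa> M * cos (w * D M) = 1" "\<kappa> M * sin (w * D M) = 0"
    by (auto simp: f_def g_def 0 \<gamma>)
  then have "sin (w * D M) = 0" by auto
  moreover have "sin (w * D M) > 0" using M \<open>w > 0\<close> by (intro sin_gt_zero) auto
  ultimately show False by simp
qed

text \<open>\<open>p\<close> is the other leg of the right triangle with leg \<open>f u\<close> and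
  hypotenuse \<open>sqrt (Q + u\<^sup>2)\<close>, so the cosine of the angle is their quotient and
  the square root in the derivative of \<open>arcsin\<close> disappears.\<close>

lemma DERIV_arcsin_quotient:
  fixes f :: "real \<Rightarrow> real"
  assumes f: "(f has_real_derivative f') (at u)" and p: "p > 0" "p\<^sup>2 + (f u)\<^sup>2 = Q + u\<^sup>2"
  shows "((\<lambda>u. arcsin (f u / sqrt (Q + u\<^sup>2))) has_real_derivative (f' - f u * u / (Q + u\<^sup>2)) / p) (at u)"
proof -
  define \<rho> where "\<rho> = sqrt (Q + u\<^sup>2)"
  have Qu: "Q + u\<^sup>2 > 0" using p by (metis add_pos_nonneg zero_le_power2 zero_less_power)
  then have \<rho>: "\<rho> > 0" "\<rho>\<^sup>2 = Q + u\<^sup>2" by (auto simp: \<rho>_def)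
  have r: "((\<lambda>u. sqrt (Q + u\<^sup>2)) has_real_derivative u / \<rho>) (at u)"
    using Qu unfolding \<rho>_def by (auto intro!: derivative_eq_intros simp: field_simps)
  have "((\<lambda>u. f u / sqrt (Q + u\<^sup>2)) has_real_derivative (f' * \<rho> - f u * (u / \<rho>)) / (\<rho> * \<rho>)) (at u)"
    using DERIV_divide[OF f r] \<rho> unfolding \<rho>_def[symmetric] by simp
  moreover have sq: "1 - (f u / \<rho>)\<^sup>2 = (p / \<rho>)\<^sup>2"
  proof -
    have "1 - (f u / \<rho>)\<^sup>2 = (\<rho>\<^sup>2 - (f u)\<^sup>2) / \<rho>\<^sup>2" using \<rho>(1) by (simp add: power_divide diff_divide_distrib)
    also have "\<rho>\<^sup>2 - (f u)\<^sup>2 = p\<^sup>2" using p(2) \<rho>(2) by simp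
    finally show ?thesis by (simp add: power_divide)
  qed
  have "(f u / \<rho>)\<^sup>2 < 1\<^sup>2"
    using sq p \<rho>(1) by (smt (verit) divide_pos_pos one_power2 zero_less_power)
  then have "\<bar>f u / \<rho>\<bar> < 1" by (metis abs_1 abs_square_less_1 one_power2)
  then have "- 1 < f u / \<rho>" "f u / \<rho> < 1" by (simp_all only: abs_less_iff) linarith
  then have "(arcsin has_real_derivative inverse (sqrt (1 - (f u / \<rho>)\<^sup>2))) (at (f u / sqrt (Q + u\<^sup>2)))"
    unfolding \<rho>_def by (rule DERIV_arcsin)
  ultimately have "((\<lambda>u. arcsin (f u / sqrt (Q + u\<^sup>2))) has_real_derivative
      inverse (sqrt (1 - (f u / \<rho>)\<^sup>2)) * ((f' * \<rho> - f u * (u / \<rho>)) / (\<rho> * \<rho>))) (at u)"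
    by (rule DERIV_chain2[rotated]) 
  moreover have "inverse (sqrt (1 - (f u / \<rho>)\<^sup>2)) * ((f' * \<rho> - f u * (u / \<rho>)) / (\<rho> * \<rho>)) =
      (f' - f u * u / (Q + u\<^sup>2)) / p"
  proof -
    have "sqrt (1 - (f u / \<rho>)\<^sup>2) = p / \<rho>" unfolding sq using p(1) \<rho>(1) by simp
    then show ?thesis
      unfolding \<rho>(2)[symmetric] using p(1) \<rho>(1) by (simp add: power2_eq_square field_simps)
  qed
  ultimately show ?thesis by simp
qed

text \<open>The height has its minimum, a positive one, at \<open>c\<close>, and the branches on
  either side are graphs over it. Other turning points are brought to this form by the
  symmetries.\<close>

locale u_shaped_soliton = global_soliton +
  fixes c :: real
  assumes tc: "t c = 0" and ac: "a c > 0"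
begin

lemma nontrivial: "a s \<noteq> 0 \<or> t s \<noteq> 0"
  using trivial_everywhere(1)[of s c] ac by fastforce

sublocale nontrivial_scalar_system a t e "mink v v"
  by unfold_locales (rule nontrivial)

lemma a_pos: "a s > 0"
proof (rule ccontr)
  assume s: "\<not> a s > 0"
  have z: "a r \<noteq> 0" for r
    using product_sign[of c r] product_neg[of c r] tc ac by (cases r c rule: linorder_cases) force+
  have "\<exists>r. a r = 0"
  proof (cases "s \<le> c")
    case True
    then show ?thesis using IVT'[of a s 0 c] s ac cont(1) by force
  next
    case False
    then show ?thesis using IVT2'[of a s 0 c] s ac cont(1) by force
  qed
  then show False using z by blast
qed

lemma t_pos: "s > c \<Longrightarrow> t s > 0" and t_neg: "s < c \<Longrightarrow> t s < 0"
  using product_sign[of c s] product_neg[of c s] a_pos[of s] tc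
  by (auto simp: zero_less_mult_iff mult_less_0_iff)

lemma a_increasing: "c \<le> p \<Longrightarrow> p < q \<Longrightarrow> a p < a q"
  by (rule DERIV_pos_imp_increasing_open[OF _ _ cont(1)]) (auto intro!: exI[of _ "t _"] da t_pos)

lemma a_decreasing: "p < q \<Longrightarrow> q \<le> c \<Longrightarrow> a q < a p"
  by (rule DERIV_neg_imp_decreasing_open[OF _ _ cont(1)]) (auto intro!: exI[of _ "t _"] da t_neg)

text \<open>Time reversal about the midpoint of \<open>l\<close> and \<open>r\<close> gives a second
  solution with the same data at \<open>r\<close>.\<close>

lemma reflected_values:
  assumes "a l = a r" "t l = - t r" "e l = - e r"
  shows "a s = a (l + r - s)" "t s = - t (l + r - s)" "e s = - e (l + r - s)"
proof -
  interpret rev: scalar_system "\<lambda>s. a (- s)" "\<lambda>s. - t (- s)" "\<lambda>s. - e (- s)" "mink v v" by (rule reverse)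
  have eq: "- (s + - (l + r)) = l + r - s" for s by simp
  from scalar_system_unique[OF scalar_system_axioms rev.shift[of "- (l + r)"], of r s, unfolded eq] assms
  show "a s = a (l + r - s)" "t s = - t (l + r - s)" "e s = - e (l + r - s)" by simp_all
qed

lemma opposite_t:
  assumes "l < c" "c < r" "a l = a r" "e l = - e r"
  shows "t l = - t r"
proof -
  have "(t l)\<^sup>2 = (t r)\<^sup>2" using cons[of l] cons[of r] assms(3,4) by simp
  then show ?thesis using t_pos[OF assms(2)] t_neg[OF assms(1)] by (auto simp: power2_eq_iff)
qed

text \<open>The reflection exchanging \<open>l\<close> and \<open>r\<close> must fix the only zero
  \<open>c\<close> of \<open>t\<close>, and \<open>e\<close> is odd under it.\<close>

lemma opposite_e_imp:
  assumes "l < c" "c < r" "a l = a r" "e l = - e r"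
  shows "e c = 0"
proof -
  note refl = reflected_values[OF assms(3) opposite_t[OF assms] assms(4), of c]
  have "l + r - c = c"
    using refl(2) tc t_pos[of "l + r - c"] t_neg[of "l + r - c"] by (cases "l + r - c" c rule: linorder_cases) auto
  then show ?thesis using refl(3) by simp
qed

text \<open>Here the partner of \<open>l\<close> at the same height is its mirror image about
  \<open>c\<close>, with opposite \<open>t\<close> and \<open>e\<close>. A double point would then
  have opposite tangents.\<close>

lemma symmetric_case:
  assumes "e c = 0" "l < c" "c < r"
  shows "X l \<noteq> X r"
proof
  assume X: "X l = X r"
  then have al: "a l = a r" by (simp add: a_def)
  have refl: "a s = a (c + c - s)" "e s = - e (c + c - s)" for s
    using reflected_values[of c c s] tc assms(1) by auto
  have "c + c - l = r"
  proof (rule ccontr)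
    assume "c + c - l \<noteq> r"
    then have "a (c + c - l) \<noteq> a r"
      using a_increasing[of r "c + c - l"] a_increasing[of "c + c - l" r] assms by force
    then show False using refl(1)[of l] al by simp
  qed
  then have e: "e l = - e r" using refl(2)[of l] by simp
  from opposite_tangents_impossible[OF X opposite_t[OF assms(2,3) al e] e] t_pos[OF assms(3)]
  show False by simp
qed

text \<open>The points \<open>P u\<close> and \<open>O' u\<close> of the two branches have the same height \<open>u\<close>. For timelike \<open>v\<close>,
  \<open>w \<gamma>\<close> and \<open>\<kappa>\<close> are the sine and cosine of the rotation about \<open>v\<close> taking one to the other, so
  \<open>\<gamma>\<close> vanishes at a self-intersection. The rotation angle \<open>w D\<close> increases, and it stays below
  \<open>pi\<close> because the sum \<open>\<Psi>\<close> of the two angles made with the height direction decreases faster,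
  from \<open>pi\<close>, without reaching \<open>0\<close>.\<close>

lemma asymmetric_case:
  assumes ec: "e c > 0" and lr: "l < c" "c < r"
  shows "X l \<noteq> X r"
proof
  assume X: "X l = X r"
  define Q where "Q = mink v v"
  define m where "m = a c"
  define M where "M = a r"
  have al: "a l = M" using X by (simp add: a_def M_def)
  have mM: "m < M" unfolding m_def M_def using a_increasing[of c r] lr by simp
  have m0: "m > 0" using ac by (simp add: m_def)
  have consQ: "(t s)\<^sup>2 + (e s)\<^sup>2 = Q + (a s)\<^sup>2" for s using cons by (simp add: Q_def)
  have rho_pos: "Q + (a s)\<^sup>2 > 0" for s
  proof (cases "s = c")
    case True
    then show ?thesis using consQ[of c] ec tc by (metis add_0 zero_power2 zero_less_power)
  next
    case False
    then have "t s \<noteq> 0" using t_pos[of s] t_neg[of s] by force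
    then show ?thesis using consQ[of s] by (metis add_pos_nonneg zero_le_power2 zero_less_power2)
  qed
  have "inj_on a {c..r}"
    by (rule linorder_inj_onI) (use a_increasing in force)+
  moreover have "a ` {c..r} = {m..M}"
  proof
    show "{m..M} \<subseteq> a ` {c..r}"
      using IVT'[of a c _ r] lr cont(1) by (force simp: m_def M_def)
    show "a ` {c..r} \<subseteq> {m..M}"
      unfolding m_def M_def using a_increasing by (force simp: order_le_less)
  qed
  ultimately obtain R where R: "continuous_on {m..M} R" "\<And>u. u \<in> {m..M} \<Longrightarrow> R u \<in> {c..r} \<and> a (R u) = u"
    "\<And>u. m < u \<Longrightarrow> u < M \<Longrightarrow> t (R u) \<noteq> 0 \<Longrightarrow> (R has_real_derivative inverse (t (R u))) (at u)"
    "\<And>x. x \<in> {c..r} \<Longrightarrow> R (a x) = x"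
    using inverse_function_on_interval[of a c r m M t] da by metis
  have "inj_on a {l..c}"
    by (rule linorder_inj_onI) (use a_decreasing in force)+
  moreover have "a ` {l..c} = {m..M}"
  proof
    show "{m..M} \<subseteq> a ` {l..c}"
      using IVT2'[of a c _ l] lr cont(1) al by (force simp: m_def)
    show "a ` {l..c} \<subseteq> {m..M}"
      unfolding m_def al[symmetric] using a_decreasing by (force simp: order_le_less)
  qed
  ultimately obtain L where L: "continuous_on {m..M} L" "\<And>u. u \<in> {m..M} \<Longrightarrow> L u \<in> {l..c} \<and> a (L u) = u"
    "\<And>u. m < u \<Longrightarrow> u < M \<Longrightarrow> t (L u) \<noteq> 0 \<Longrightarrow> (L has_real_derivative inverse (t (L u))) (at u)"
    "\<And>x. x \<in> {l..c} \<Longrightarrow> L (a x) = x"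
    using inverse_function_on_interval[of a l c m M t] da by metis
  have ends: "R m = c" "L m = c" "R M = r" "L M = l"
    using R(4)[of c] R(4)[of r] L(4)[of c] L(4)[of l] lr al by (auto simp: m_def M_def)
  have aR: "a (R u) = u" and aL: "a (L u) = u" if "u \<in> {m..M}" for u using R(2) L(2) that by auto
  have Rc: "R u > c" and Lc: "L u < c" if "u \<in> {m<..M}" for u
    using R(2)[of u] L(2)[of u] that by (auto simp: m_def order_le_less)
  define p where "p u = t (R u)" for u
  define q where "q u = - t (L u)" for u
  have p: "p u > 0" and q: "q u > 0" if "u \<in> {m<..M}" for u
    using t_pos[OF Rc[OF that]] t_neg[OF Lc[OF that]] by (auto simp: p_def q_def)
  have pe: "(p u)\<^sup>2 + (e (R u))\<^sup>2 = Q + u\<^sup>2" and qe: "(q u)\<^sup>2 + (e (L u))\<^sup>2 = Q + u\<^sup>2" if "u \<in> {m..M}" for u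
    using consQ[of "R u"] consQ[of "L u"] aR aL that by (auto simp: p_def q_def)
  have Qu: "Q + u\<^sup>2 > 0" if "u \<in> {m..M}" for u using rho_pos[of "R u"] aR[OF that] by simp
  have dR: "(R has_real_derivative 1 / p u) (at u)" and dL: "(L has_real_derivative - 1 / q u) (at u)"
    if "m < u" "u < M" for u
    using R(3)[OF that] L(3)[OF that] p[of u] q[of u] that by (auto simp: p_def q_def inverse_eq_divide)
  \<comment> \<open>The sum starts at \<open>2 * e c\<close>, and a zero would make the scalar data
    of the two branches mirror images, which forces \<open>e c = 0\<close>.\<close>
  have S: "e (R u) + e (L u) > 0" if u: "u \<in> {m..M}" for u
  proof (rule ccontr)
    assume n: "\<not> ?thesis"
    have "continuous_on {m..u} (\<lambda>u. e (R u) + e (L u))"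
      using u R(1) L(1)
      by (intro continuous_intros continuous_on_compose2[OF cont(3)[of UNIV]]) (auto elim: continuous_on_subset)
    then obtain x where x: "m \<le> x" "x \<le> u" "e (R x) + e (L x) = 0"
      using IVT2'[of "\<lambda>u. e (R u) + e (L u)" u 0 m] n u ec by (auto simp: ends)
    then have "x \<noteq> m" using ec by (auto simp: ends)
    then have "x \<in> {m<..M}" using x u by auto
    then have "e c = 0"
      using opposite_e_imp[OF Lc Rc, of x x] aR[of x] aL[of x] x(3) by auto
    then show False using ec by simp
  qed
  \<comment> \<open>By \<open>tangent_eq\<close>, with the height as parameter the branches move
    along the Killing orbits at rates \<open>e (R u) / p u\<close> and
    \<open>- e (L u) / q u\<close>, divided by \<open>Q + u\<^sup>2\<close> and up to orientation;
    \<open>D'\<close> is the rate of separation.\<close>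
  define D' where "D' u = (e (R u) / p u + e (L u) / q u) / (Q + u\<^sup>2)" for u
  have D'_pos: "D' u > 0" if "m < u" "u < M" for u
  proof -
    have "e (R u) / p u + e (L u) / q u > 0"
      using p[of u] q[of u] pe[of u] qe[of u] S[of u] that by (intro slope_sum_pos) auto
    then show ?thesis using Qu[of u] that by (simp add: D'_def)
  qed
  define P where "P u = X (R u)" for u
  define O' where "O' u = X (L u)" for u
  define E where "E u = - 1 - mink (P u) (O' u)" for u
  define g where "g u = mink (mcross (P u) v) (O' u)" for u
  \<comment> \<open>Generalized cosine and sine of the displacement, with
    \<open>\<kappa>' = Q * \<gamma> * D'\<close> and \<open>\<gamma>' = \<kappa> * D'\<close>:
    hyperbolic for \<open>Q > 0\<close>, the constant 1 and the displacement itself for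
    \<open>Q = 0\<close>, circular for \<open>Q < 0\<close>.\<close>
  define \<kappa> where "\<kappa> u = 1 + Q * (E u / (Q + u\<^sup>2))" for u
  define \<gamma> where "\<gamma> u = \<epsilon> * g u / (Q + u\<^sup>2)" for u
  have contP: "continuous_on {m..M} P" and contO: "continuous_on {m..M} O'"
    unfolding P_def O'_def
    by (auto intro!: continuous_on_compose2[OF continuous_X[of UNIV]] R(1) L(1))
  have contE: "continuous_on {m..M} E" and contg: "continuous_on {m..M} g"
    unfolding E_def g_def
    by (intro continuous_intros bounded_bilinear.continuous_on[OF bounded_bilinear_mink]
        bounded_bilinear.continuous_on[OF bounded_bilinear_mcross] contP contO)+
  have cont\<kappa>: "continuous_on {m..M} \<kappa>" and cont\<gamma>: "continuous_on {m..M} \<gamma>"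
    unfolding \<kappa>_def \<gamma>_def using Qu by (intro continuous_intros contE contg; force)+
  have start: "\<kappa> m = 1" "\<gamma> m = 0"
    using frame(1)[of c] by (simp_all add: \<kappa>_def \<gamma>_def E_def g_def P_def O'_def ends H2_def)
  have finish: "\<gamma> M = 0"
    using X by (simp add: \<gamma>_def g_def P_def O'_def ends)
  have derivs: "(E has_real_derivative (2 * u * E u + \<epsilon> * g u * (x + y)) / (Q + u\<^sup>2)) (at u)"
      "(g has_real_derivative (2 * u * g u + \<epsilon> * (x + y) * (Q + u\<^sup>2 + Q * E u)) / (Q + u\<^sup>2)) (at u)"
    if u: "m < u" "u < M" and xy: "x = e (R u) / p u" "y = e (L u) / q u" for u x y
  proof -
    have u': "u \<in> {m..M}" using u by simp
    have pq: "p u > 0" "q u > 0" using p q u by auto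
    note rho = Qu[OF u']
    define W where "W z = v + u *\<^sub>R z" for z
    \<comment> \<open>The derivatives of the branches in \<open>u\<close>, from
      \<open>tangent_eq\<close> divided by \<open>p u\<close> and by \<open>- q u\<close>. The
      gradient parts have the same sign, the Killing parts opposite ones.\<close>
    define P1 where "P1 = (1 / (Q + u\<^sup>2)) *\<^sub>R (W (P u) - (x * \<epsilon>) *\<^sub>R mcross (P u) v)"
    define O1 where "O1 = (1 / (Q + u\<^sup>2)) *\<^sub>R (W (O' u) + (y * \<epsilon>) *\<^sub>R mcross (O' u) v)"
    have tR: "(Q + u\<^sup>2) *\<^sub>R T (R u) = p u *\<^sub>R W (P u) - (e (R u) * \<epsilon>) *\<^sub>R mcross (P u) v"
      using tangent_eq[of "R u"] by (simp add: aR[OF u'] p_def P_def W_def Q_def)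
    have tL: "(Q + u\<^sup>2) *\<^sub>R T (L u) = - q u *\<^sub>R W (O' u) - (e (L u) * \<epsilon>) *\<^sub>R mcross (O' u) v"
      using tangent_eq[of "L u"] by (simp add: aL[OF u'] q_def O'_def W_def Q_def)
    have "P1 = (1 / p u) *\<^sub>R ((1 / (Q + u\<^sup>2)) *\<^sub>R ((Q + u\<^sup>2) *\<^sub>R T (R u)))"
      unfolding tR P1_def xy using pq by (simp add: scaleR_diff_right mult.commute)
    also have "\<dots> = (1 / p u) *\<^sub>R T (R u)" using rho by simp
    finally have P1: "P1 = (1 / p u) *\<^sub>R T (R u)" .
    have "O1 = (- 1 / q u) *\<^sub>R ((1 / (Q + u\<^sup>2)) *\<^sub>R ((Q + u\<^sup>2) *\<^sub>R T (L u)))"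
      unfolding tL O1_def xy using pq by (simp add: scaleR_diff_right scaleR_add_right mult.commute)
    also have "\<dots> = (- 1 / q u) *\<^sub>R T (L u)" using rho by simp
    finally have O1: "O1 = (- 1 / q u) *\<^sub>R T (L u)" .
    have dP: "(P has_vector_derivative P1) (at u)"
      unfolding P_def P1 using vector_diff_chain_at[OF _ dX, of R "1 / p u" u] dR[OF u]
      by (simp add: o_def has_real_derivative_iff_has_vector_derivative)
    have dO: "(O' has_vector_derivative O1) (at u)"
      unfolding O'_def O1 using vector_diff_chain_at[OF _ dX, of L "- 1 / q u" u] dL[OF u]
      by (simp add: o_def has_real_derivative_iff_has_vector_derivative)
    have hP: "mink (P u) v = u" "mink v (P u) = u" and hO: "mink (O' u) v = u" "mink v (O' u) = u"
      using aR[OF u'] aL[OF u'] mink_commute[of v] by (auto simp: P_def O'_def a_def)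
    have PO: "mink (P u) (O' u) = - 1 - E u" "mink (O' u) (P u) = - 1 - E u"
      using mink_commute[of "O' u"] by (auto simp: E_def)
    have gO: "mink (mcross (O' u) v) (P u) = - g u"
      by (simp add: g_def mink_def algebra_simps)
    have PP: "mink (P u) (mcross (O' u) v) = - g u" "mink (O' u) (mcross (P u) v) = g u"
      using gO by (simp_all add: g_def mink_commute[of "O' u" "mcross (P u) v"] mink_commute[of "P u" "mcross (O' u) v"])
    have "(E has_real_derivative - (mink (P u) O1 + mink P1 (O' u))) (at u)"
      unfolding E_def using DERIV_diff[OF DERIV_const has_vector_derivative_mink[OF dP dO]] by simp
    moreover have "- (mink (P u) O1 + mink P1 (O' u)) = (2 * u * E u + \<epsilon> * g u * (x + y)) / (Q + u\<^sup>2)"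
    proof -
      have "mink (P u) O1 = (1 / (Q + u\<^sup>2)) * (u + u * (- 1 - E u) - y * \<epsilon> * g u)"
        by (simp add: O1_def W_def mink_simps hP PO PP)
      moreover have "mink P1 (O' u) = (1 / (Q + u\<^sup>2)) * (u + u * (- 1 - E u) - x * \<epsilon> * g u)"
        by (simp add: P1_def W_def mink_simps hO PO g_def)
      ultimately show ?thesis by (simp add: algebra_simps add_divide_distrib diff_divide_distrib)
    qed
    ultimately show "(E has_real_derivative (2 * u * E u + \<epsilon> * g u * (x + y)) / (Q + u\<^sup>2)) (at u)" by simp
    have "(g has_real_derivative mink (mcross (P u) v) O1 + mink (mcross P1 v) (O' u)) (at u)"
      unfolding g_def
      using has_vector_derivative_mink[OF has_vector_derivative_mcross[OF dP has_vector_derivative_const] dO]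
      by (simp add: mcross_simps)
    moreover have "mink (mcross (P u) v) O1 + mink (mcross P1 v) (O' u) =
        (2 * u * g u + \<epsilon> * (x + y) * (Q + u\<^sup>2 + Q * E u)) / (Q + u\<^sup>2)"
    proof -
      define G where "G = Q + u\<^sup>2 + Q * E u"
      have "mink (mcross (P u) v) (mcross (O' u) v) = mink (P u) v * mink (O' u) v - mink (P u) (O' u) * mink v v"
        by (simp add: mink_def algebra_simps)
      then have "mink (mcross (P u) v) (mcross (O' u) v) = G"
        by (simp add: G_def hP hO PO Q_def power2_eq_square algebra_simps)
      then have "mink (mcross (P u) v) O1 = (1 / (Q + u\<^sup>2)) * (u * g u + y * \<epsilon> * G)"
        by (simp add: O1_def W_def mink_simps g_def)
      moreover have "mink (mcross (mcross (P u) v) v) (O' u) = - G"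
        by (simp add: G_def mcross_mcross mink_simps hP hO PO Q_def power2_eq_square algebra_simps)
      then have "mink (mcross P1 v) (O' u) = (1 / (Q + u\<^sup>2)) * (u * g u + x * \<epsilon> * G)"
        by (simp add: P1_def W_def mink_simps mcross_simps g_def)
      ultimately show ?thesis
        unfolding G_def[symmetric]
        by (simp add: distrib_right distrib_left add_divide_distrib mult.commute mult.left_commute)
    qed
    ultimately show "(g has_real_derivative (2 * u * g u + \<epsilon> * (x + y) * (Q + u\<^sup>2 + Q * E u)) / (Q + u\<^sup>2)) (at u)"
      by simp
  qed
  have d\<rho>: "((\<lambda>u. Q + u\<^sup>2) has_real_derivative 2 * u) (at u)" for u
    by (auto intro!: derivative_eq_intros)
  have d\<kappa>: "(\<kappa> has_real_derivative Q * (\<gamma> u * D' u)) (at u)"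
    and d\<gamma>: "(\<gamma> has_real_derivative \<kappa> u * D' u) (at u)" if u: "m < u" "u < M" for u
  proof -
    note d = derivs[OF u refl refl]
    have rho: "Q + u\<^sup>2 > 0" using Qu u by auto
    \<comment> \<open>Division by \<open>Q + u\<^sup>2\<close>, the squared length of the Killing
      field at height \<open>u\<close>, cancels the terms with \<open>2 * u\<close>.\<close>
    have "((\<lambda>u. E u / (Q + u\<^sup>2)) has_real_derivative
        ((2 * u * E u + \<epsilon> * g u * (e (R u) / p u + e (L u) / q u)) / (Q + u\<^sup>2) * (Q + u\<^sup>2) - E u * (2 * u)) / ((Q + u\<^sup>2) * (Q + u\<^sup>2))) (at u)"
      using rho by (intro DERIV_divide d d\<rho>) auto
    moreover have "((2 * u * E u + \<epsilon> * g u * (e (R u) / p u + e (L u) / q u)) / (Q + u\<^sup>2) * (Q + u\<^sup>2) - E u * (2 * u)) / ((Q + u\<^sup>2) * (Q + u\<^sup>2)) = \<gamma> u * D' u"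
      using rho by (simp add: \<gamma>_def D'_def)
    ultimately have "((\<lambda>u. E u / (Q + u\<^sup>2)) has_real_derivative \<gamma> u * D' u) (at u)" by simp
    from DERIV_add[OF DERIV_const DERIV_cmult[OF this]]
    show "(\<kappa> has_real_derivative Q * (\<gamma> u * D' u)) (at u)" unfolding \<kappa>_def by simp
    define z where "z = e (R u) / p u + e (L u) / q u"
    have "(\<gamma> has_real_derivative
        (\<epsilon> * ((2 * u * g u + \<epsilon> * z * (Q + u\<^sup>2 + Q * E u)) / (Q + u\<^sup>2)) * (Q + u\<^sup>2) - \<epsilon> * g u * (2 * u)) / ((Q + u\<^sup>2) * (Q + u\<^sup>2))) (at u)"
      unfolding \<gamma>_def z_def using rho by (intro DERIV_divide DERIV_cmult d d\<rho>) auto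
    moreover have "(\<epsilon> * ((2 * u * g u + \<epsilon> * z * (Q + u\<^sup>2 + Q * E u)) / (Q + u\<^sup>2)) * (Q + u\<^sup>2) - \<epsilon> * g u * (2 * u)) / ((Q + u\<^sup>2) * (Q + u\<^sup>2))
      = (\<epsilon> * \<epsilon>) * z * (Q + u\<^sup>2 + Q * E u) / ((Q + u\<^sup>2) * (Q + u\<^sup>2))"
    proof -
      have "\<epsilon> * (y / (Q + u\<^sup>2)) * (Q + u\<^sup>2) = \<epsilon> * y" for y using rho by simp
      moreover have "\<epsilon> * (2 * u * g u + \<epsilon> * z * G) - \<epsilon> * g u * (2 * u) = (\<epsilon> * \<epsilon>) * z * G" for G
        by (simp add: algebra_simps)
      ultimately show ?thesis by (simp only:)
    qed
    moreover have "\<dots> = \<kappa> u * D' u"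
      using rho unfolding \<epsilon>_square \<kappa>_def D'_def z_def[symmetric] by (simp add: field_simps)
    ultimately show "(\<gamma> has_real_derivative \<kappa> u * D' u) (at u)" by simp
  qed
  show False
  proof (cases "Q \<ge> 0")
    case True
    \<comment> \<open>\<open>E \<ge> 0\<close> keeps \<open>\<kappa>\<close> at least 1, so
      \<open>\<gamma>\<close> increases strictly from 0 and cannot return.\<close>
    have "\<kappa> u \<ge> 1" if "u \<in> {m..M}" for u
    proof -
      have "E u \<ge> 0" using H2_mink_le[OF frame(1)[of "R u"] frame(1)[of "L u"]] by (simp add: E_def P_def O'_def)
      then show ?thesis using True Qu[OF that] by (simp add: \<kappa>_def)
    qed
    then have "\<kappa> u * D' u > 0" if "m < u" "u < M" for u
      using D'_pos[OF that] that by (intro mult_pos_pos) (force intro: less_le_trans[OF zero_less_one])+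
    then have "\<gamma> m < \<gamma> M"
      using d\<gamma> by (intro DERIV_pos_imp_increasing_open[OF mM _ cont\<gamma>]) blast
    then show False using start finish by simp
  next
    case False
    define w where "w = sqrt (- Q)"
    have w: "w > 0" "w\<^sup>2 = - Q" using False by (auto simp: w_def)
    \<comment> \<open>The denominators \<open>p\<close> and \<open>q\<close> of \<open>D'\<close>
      vanish at the turning point. Taking \<open>D\<close> as a difference of values of a function
      of arc length makes it continuous up to \<open>u = m\<close>.\<close>
    obtain \<theta> where \<theta>: "\<And>s. (\<theta> has_vector_derivative e s / (Q + (a s)\<^sup>2)) (at s)"
    proof (rule antiderivative_exists[of "\<lambda>s. e s / (Q + (a s)\<^sup>2)"])
      show "continuous_on UNIV (\<lambda>s. e s / (Q + (a s)\<^sup>2))"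
        using rho_pos by (intro continuous_intros cont) (metis less_irrefl)
    qed blast
    then have d\<theta>: "(\<theta> has_real_derivative e s / (Q + (a s)\<^sup>2)) (at s)" for s
      by (simp add: has_real_derivative_iff_has_vector_derivative)
    define D where "D u = \<theta> (R u) - \<theta> (L u)" for u
    have cont\<theta>: "continuous_on UNIV \<theta>"
      using d\<theta> by (auto intro!: continuous_at_imp_continuous_on DERIV_isCont)
    have contD: "continuous_on {m..M} D"
      unfolding D_def by (intro continuous_intros continuous_on_compose2[OF cont\<theta>] R(1) L(1)) auto
    have dD: "(D has_real_derivative D' u) (at u)" if "m < u" "u < M" for u
    proof -
      have u': "u \<in> {m..M}" using that by simp
      have "(D has_real_derivative e (R u) / (Q + (a (R u))\<^sup>2) * (1 / p u) - e (L u) / (Q + (a (L u))\<^sup>2) * (- 1 / q u)) (at u)"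
        unfolding D_def using that by (intro DERIV_diff DERIV_chain2[OF d\<theta>] dR dL)
      moreover have "e (R u) / (Q + (a (R u))\<^sup>2) * (1 / p u) - e (L u) / (Q + (a (L u))\<^sup>2) * (- 1 / q u) = D' u"
        unfolding aR[OF u'] aL[OF u'] D'_def by (simp add: add_divide_distrib mult.commute)
      ultimately show ?thesis by simp
    qed
    have D0: "D m = 0" by (simp add: D_def ends)
    have DM: "D M > 0"
      using DERIV_pos_imp_increasing_open[OF mM _ contD] dD D'_pos D0 by metis
    define \<Psi> where "\<Psi> u = arcsin (e (R u) / sqrt (Q + u\<^sup>2)) + arcsin (e (L u) / sqrt (Q + u\<^sup>2))" for u
    have bnd: "\<bar>e (R u) / sqrt (Q + u\<^sup>2)\<bar> \<le> 1" "\<bar>e (L u) / sqrt (Q + u\<^sup>2)\<bar> \<le> 1" if "u \<in> {m..M}" for u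
    proof -
      have "(e (R u))\<^sup>2 \<le> Q + u\<^sup>2" "(e (L u))\<^sup>2 \<le> Q + u\<^sup>2"
        using pe[OF that] qe[OF that] by (smt (verit) zero_le_power2)+
      then have "\<bar>e (R u)\<bar> \<le> sqrt (Q + u\<^sup>2)" "\<bar>e (L u)\<bar> \<le> sqrt (Q + u\<^sup>2)"
        by (auto intro: real_le_rsqrt)
      then show "\<bar>e (R u) / sqrt (Q + u\<^sup>2)\<bar> \<le> 1" "\<bar>e (L u) / sqrt (Q + u\<^sup>2)\<bar> \<le> 1"
        using Qu[OF that] by (auto simp: abs_divide divide_le_eq_1)
    qed
    have cont\<Psi>: "continuous_on {m..M} \<Psi>"
    proof -
      have "sqrt (Q + u\<^sup>2) \<noteq> 0" if "u \<in> {m..M}" for u using Qu[OF that] by simp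
      then have c: "continuous_on {m..M} (\<lambda>u. e (f u) / sqrt (Q + u\<^sup>2))" if "continuous_on {m..M} f" for f
        using that by (intro continuous_on_divide continuous_on_compose2[OF cont(3)[of UNIV]])
          (auto intro!: continuous_intros)
      show ?thesis
        unfolding \<Psi>_def using bnd
        by (intro continuous_on_add continuous_on_arcsin c R(1) L(1) ballI conjI) (metis abs_le_D1 abs_le_D2 minus_le_iff)+
    qed
    have d\<Psi>: "(\<Psi> has_real_derivative - u * D' u) (at u)" if "m < u" "u < M" for u
    proof -
      have u': "u \<in> {m..M}" using that by simp
      have pq: "p u > 0" "q u > 0" using p q that by auto
      have "((\<lambda>u. e (R u)) has_real_derivative - (t (R u))\<^sup>2 * (1 / p u)) (at u)"
        using that by (intro DERIV_chain2[OF de] dR)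
      then have eR: "((\<lambda>u. e (R u)) has_real_derivative - p u) (at u)"
        using pq by (simp add: p_def[symmetric] power2_eq_square)
      have "((\<lambda>u. e (L u)) has_real_derivative - (t (L u))\<^sup>2 * (- 1 / q u)) (at u)"
        using that by (intro DERIV_chain2[OF de] dL)
      then have eL: "((\<lambda>u. e (L u)) has_real_derivative q u) (at u)"
      proof -
        have "t (L u) = - q u" by (simp add: q_def)
        then have "- (t (L u))\<^sup>2 * (- 1 / q u) = q u" using pq by (simp add: power2_eq_square)
        then show ?thesis using \<open>((\<lambda>u. e (L u)) has_real_derivative - (t (L u))\<^sup>2 * (- 1 / q u)) (at u)\<close> by simp
      qed
      have "(\<Psi> has_real_derivative (- p u - e (R u) * u / (Q + u\<^sup>2)) / p u + (q u - e (L u) * u / (Q + u\<^sup>2)) / q u) (at u)"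
        unfolding \<Psi>_def
        by (intro DERIV_add DERIV_arcsin_quotient[OF eR pq(1) pe[OF u']] DERIV_arcsin_quotient[OF eL pq(2) qe[OF u']])
      moreover have "(- p u - e (R u) * u / (Q + u\<^sup>2)) / p u + (q u - e (L u) * u / (Q + u\<^sup>2)) / q u = - u * D' u"
      proof -
        have "(- p' - x * u / z) / p' + (q' - y * u / z) / q' = - u * ((x / p' + y / q') / z)"
          if "p' > 0" "q' > 0" "z > 0" for p' q' x y z :: real
          using that by (simp add: field_simps)
        then show ?thesis unfolding D'_def using pq Qu[OF u'] by blast
      qed
      ultimately show ?thesis by simp
    qed
    have "w * D M + \<Psi> M < w * D m + \<Psi> m"
    proof (rule DERIV_neg_imp_decreasing_open[OF mM])
      show "continuous_on {m..M} (\<lambda>u. w * D u + \<Psi> u)" by (intro continuous_intros contD cont\<Psi>)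
      fix u assume u: "m < u" "u < M"
      \<comment> \<open>\<open>Q + u\<^sup>2 > 0\<close> means \<open>w < u\<close>, so the loss
        \<open>u * D'\<close> of \<open>\<Psi>\<close> exceeds the gain \<open>w * D'\<close> of the
        rotation angle.\<close>
      have "w\<^sup>2 < u\<^sup>2" using Qu[of u] u w(2) by simp
      then have "w < u" using m0 u by (simp add: power2_less_imp_less)
      then have "(w - u) * D' u < 0" using D'_pos[OF u] by (simp add: mult_neg_pos)
      moreover have "((\<lambda>u. w * D u + \<Psi> u) has_real_derivative w * D' u + - u * D' u) (at u)"
        by (intro DERIV_add DERIV_cmult dD[OF u] d\<Psi>[OF u])
      ultimately show "\<exists>y. ((\<lambda>u. w * D u + \<Psi> u) has_real_derivative y) (at u) \<and> y < 0"
        by (intro exI[of _ "w * D' u + - u * D' u"]) (simp add: algebra_simps)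
    qed
    \<comment> \<open>At the turning point \<open>t = 0\<close> and \<open>e > 0\<close>, so both
      quotients are 1 and each arcsine is \<open>pi / 2\<close>.\<close>
    moreover have "\<Psi> m = pi"
    proof -
      have "Q + m\<^sup>2 = (e c)\<^sup>2" using consQ[of c] tc by (simp add: m_def)
      then show ?thesis using ec by (simp add: \<Psi>_def ends)
    qed
    moreover have "\<Psi> M > 0"
    proof -
      have M': "M \<in> {m..M}" using mM by simp
      \<comment> \<open>Since \<open>arcsin\<close> is odd and increasing, the sign is that of
        \<open>e (R M) + e (L M)\<close>.\<close>
      have "- (e (L M) / sqrt (Q + M\<^sup>2)) < e (R M) / sqrt (Q + M\<^sup>2)"
        using S[OF M'] Qu[OF M'] by (simp add: minus_divide_left divide_strict_right_mono del: minus_divide_left[symmetric])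
      then have "arcsin (- (e (L M) / sqrt (Q + M\<^sup>2))) < arcsin (e (R M) / sqrt (Q + M\<^sup>2))"
        using bnd[OF M', unfolded abs_le_iff] by (intro arcsin_less_arcsin) linarith+
      moreover have "arcsin (- (e (L M) / sqrt (Q + M\<^sup>2))) = - arcsin (e (L M) / sqrt (Q + M\<^sup>2))"
        using bnd[OF M', unfolded abs_le_iff] by (intro arcsin_minus) linarith+
      ultimately show ?thesis by (simp add: \<Psi>_def)
    qed
    ultimately have "w * D M < pi" by (simp add: D0)
    have "\<gamma> M \<noteq> 0"
    proof (rule rotation_no_return[OF mM w(1) cont\<kappa> cont\<gamma> contD _ d\<gamma> dD start D0 DM \<open>w * D M < pi\<close>])
      show "(\<kappa> has_real_derivative - w\<^sup>2 * \<gamma> u * D' u) (at u)" if "m < u" "u < M" for u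
        using d\<kappa>[OF that] by (simp add: w(2) mult.assoc)
    qed
    then show False using finish by simp
  qed
qed

end

section \<open>Embeddedness, both ends, and the theorem\<close>

context global_soliton
begin

text \<open>A double point gives a critical point of the height by Rolle. Outside the geodesic case
  \<open>a\<close> is nonzero there; a change of sign of \<open>v\<close> makes it positive and time
  reversal makes \<open>e\<close> nonnegative, which leaves the symmetric and the asymmetric
  case.\<close>

lemma inj_X: "inj X"
proof -
  have main: "X l \<noteq> X r" if lr: "l < r" for l r
  proof (cases "\<exists>s. a s = 0 \<and> t s = 0")
    case True
    then have "t s = 0" for s using trivial_everywhere by blast
    then show ?thesis using geodesic_inj that by blast
  next
    case False
    then interpret nontrivial_scalar_system a t e "mink v v" by unfold_locales auto
    show ?thesis
    proof
      assume X: "X l = X r"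
      then have "a l = a r" by (simp add: a_def)
      then obtain c where c: "l < c" "c < r" "t c = 0"
        using Rolle_deriv[OF lr _ cont(1), of "\<lambda>s h. t s * h"] da
        by (auto simp: has_field_derivative_def fun_eq_iff)
      \<comment> \<open>Stated for arbitrary data, so that it applies to the flipped and reversed
        solitons as well.\<close>
      have u_case: False
        if "u_shaped_soliton v' \<epsilon>' X' T' N' c'" "l' < c'" "c' < r'" "X' l' = X' r'"
          "mink (N' c') v' \<ge> 0" for v' \<epsilon>' X' T' N' c' l' r'
      proof -
        interpret u: u_shaped_soliton v' \<epsilon>' X' T' N' c' by (rule that(1))
        show False
          using u.symmetric_case[of l' r'] u.asymmetric_case[of l' r'] that(2-5)
          by (auto simp: u.e_def order_le_less)
      qed
      have rev_case: False
        if u: "u_shaped_soliton v' \<epsilon>' X T' N' c" for v' \<epsilon>' T' N'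
      proof (cases "mink (N' c) v' \<ge> 0")
        case True
        then show False using u_case[OF u c(1,2) X] by simp
      next
        case False
        interpret u: u_shaped_soliton v' \<epsilon>' X T' N' c by (rule u)
        interpret r: global_soliton v' \<epsilon>' "\<lambda>s. X (- s)" "\<lambda>s. - T' (- s)" "\<lambda>s. - N' (- s)"
          by standard (rule soliton_frame_reverse[OF u.sf])
        have "u_shaped_soliton v' \<epsilon>' (\<lambda>s. X (- s)) (\<lambda>s. - T' (- s)) (\<lambda>s. - N' (- s)) (- c)"
          using u.tc u.ac by unfold_locales (simp_all add: r.t_def r.a_def u.t_def u.a_def mink_simps)
        from u_case[OF this, of "- r" "- l"] False c X show False by (simp add: mink_simps)
      qed
      have "a c \<noteq> 0" using nontrivial[of c] c by simp
      show False
      proof (cases "a c > 0")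
        case True
        then have "u_shaped_soliton v \<epsilon> X T N c" using c(3) by unfold_locales
        then show False by (rule rev_case)
      next
        case False
        interpret f: global_soliton "- v" "- \<epsilon>" X T "\<lambda>s. - N s"
          by standard (rule soliton_frame_flip[OF sf])
        have "u_shaped_soliton (- v) (- \<epsilon>) X T (\<lambda>s. - N s) c"
          using c(3) False \<open>a c \<noteq> 0\<close> by unfold_locales (simp_all add: f.t_def f.a_def t_def a_def mink_simps)
        then show False by (rule rev_case)
      qed
    qed
  qed
  show ?thesis
    by (rule linorder_injI) (rule main)
qed

lemma reverse_soliton: "global_soliton v \<epsilon> (\<lambda>s. X (- s)) (\<lambda>s. - T (- s)) (\<lambda>s. - N (- s))"
  by standard (rule soliton_frame_reverse[OF sf])

lemma t_tendsto_at_bot: "\<exists>c\<in>{-1, 0, 1}. (t \<longlongrightarrow> c) at_bot"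
proof -
  interpret r: global_soliton v \<epsilon> "\<lambda>s. X (- s)" "\<lambda>s. - T (- s)" "\<lambda>s. - N (- s)" by (rule reverse_soliton)
  have "r.t = (\<lambda>s. - t (- s))" by (auto simp: r.t_def t_def mink_simps)
  then obtain c where c: "c \<in> {-1, 0, 1}" "((\<lambda>s. - t (- s)) \<longlongrightarrow> c) at_top"
    using r.t_tendsto by auto
  then have "((\<lambda>s. - (- t (- s))) \<longlongrightarrow> - c) at_top" by (intro tendsto_minus)
  then have "(t \<longlongrightarrow> - c) at_bot" by (simp add: filterlim_at_bot_mirror)
  then show ?thesis using c(1) by auto
qed

lemma norm_X_filterlim:
  "filterlim (\<lambda>s. norm (X s)) at_top at_top" "filterlim (\<lambda>s. norm (X s)) at_top at_bot"
proof -
  show "filterlim (\<lambda>s. norm (X s)) at_top at_top" using t_tendsto norm_X_at_top by blast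
  interpret r: global_soliton v \<epsilon> "\<lambda>s. X (- s)" "\<lambda>s. - T (- s)" "\<lambda>s. - N (- s)" by (rule reverse_soliton)
  have "filterlim (\<lambda>s. norm (X (- s))) at_top at_top" using r.t_tendsto r.norm_X_at_top by blast
  then show "filterlim (\<lambda>s. norm (X s)) at_top at_bot" by (simp add: filterlim_at_bot_mirror)
qed

end

text \<open>An injective curve may still accumulate on itself. Properness excludes this: the
  parameters of a convergent sequence in the image stay in a compact interval, so \<open>X\<close>
  is a closed map.\<close>

lemma proper_injection_homeomorphism:
  fixes X :: "real \<Rightarrow> 'a::real_normed_vector"
  assumes cont: "continuous_on UNIV X" and inj: "inj X"
    and lim: "filterlim (\<lambda>s. norm (X s)) at_top at_top" "filterlim (\<lambda>s. norm (X s)) at_top at_bot"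
  shows "\<exists>g. homeomorphism UNIV (range X) X g"
proof -
  have "closed (X ` U)" if "closed U" for U
    unfolding closed_sequential_limits
  proof (intro allI impI, elim conjE)
    fix x l assume x: "\<forall>n. x n \<in> X ` U" "x \<longlonglongrightarrow> l"
    have "bounded (range x)" using x(2) by (rule convergent_imp_bounded)
    then obtain B where B: "\<And>n. norm (x n) \<le> B" by (auto simp: bounded_iff)
    have "eventually (\<lambda>s. B + 1 \<le> norm (X s)) at_top" "eventually (\<lambda>s. B + 1 \<le> norm (X s)) at_bot"
      using lim by (auto simp: filterlim_at_top)
    then obtain p q where pq: "\<And>s. s \<ge> p \<Longrightarrow> B + 1 \<le> norm (X s)" "\<And>s. s \<le> q \<Longrightarrow> B + 1 \<le> norm (X s)"
      unfolding eventually_at_top_linorder eventually_at_bot_linorder by blast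
    have "x n \<in> X ` (U \<inter> {q..p})" for n
    proof -
      obtain s where s: "s \<in> U" "x n = X s" using x(1) by blast
      then have "q \<le> s" "s \<le> p" using B[of n] pq(1)[of s] pq(2)[of s] by force+
      then show ?thesis using s by auto
    qed
    moreover have "closed (X ` (U \<inter> {q..p}))"
      using closed_Int_compact[OF that compact_Icc] continuous_on_subset[OF cont]
      by (intro compact_imp_closed compact_continuous_image) auto
    ultimately have "l \<in> X ` (U \<inter> {q..p})"
      using x(2) closed_sequentially by blast
    then show "l \<in> X ` U" by blast
  qed
  then have "closedin (top_of_set (range X)) (X ` U)" if "closedin (top_of_set UNIV) U" for U
    using that by (intro closed_subset) auto
  then show ?thesis
    using homeomorphism_injective_closed_map[OF cont refl inj] by metis
qed

theorem theorem2p3: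
  fixes v :: "real^3"
  assumes "v \<noteq> 0"
  shows
    "(\<forall>\<alpha> \<tau> \<eta>. (\<alpha>, \<tau>, \<eta>) \<in> admissible_data v \<longrightarrow>
        (\<exists>I X. maximal_soliton v I X \<and> 0 \<in> I \<and> initial_data v X = (\<alpha>, \<tau>, \<eta>) \<and>
               (trivial_on I X \<longleftrightarrow> \<alpha> = 0 \<and> \<tau> = 0))) \<and>
     (\<forall>I X. maximal_soliton v I X \<and> 0 \<in> I \<longrightarrow> initial_data v X \<in> admissible_data v) \<and>
     (\<forall>I X J Y. maximal_soliton v I X \<and> maximal_soliton v J Y \<and> 0 \<in> I \<and> 0 \<in> J \<and>
        initial_data v X = initial_data v Y \<longrightarrow>
        J = I \<and> (\<exists>A\<in>H2_isometries. \<forall>s\<in>I. Y s = A *v X s)) \<and>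
     (\<forall>I X. maximal_soliton v I X \<longrightarrow>
        csf_soliton_on I X \<and> I = UNIV \<and> embedded_curve_on I X \<and>
        (\<exists>c\<in>{-1, 0, 1}. (geodesic_curvature X \<longlongrightarrow> c) at_top) \<and>
        (\<exists>c\<in>{-1, 0, 1}. (geodesic_curvature X \<longlongrightarrow> c) at_bot))"
proof (intro conjI allI impI)
  fix \<alpha> \<tau> \<eta> assume "(\<alpha>, \<tau>, \<eta>) \<in> admissible_data v"
  then obtain x u where x: "x \<in> H2" "mframe x u (mcross x u)"
    "mink x v = \<alpha>" "mink u v = \<tau>" "mink (mcross x u) v = \<eta>"
    by (rule admissible_frame_exists[OF assms])
  then obtain X T N where sf: "soliton_frame v 1 UNIV X T N" and X0: "X 0 = x" "T 0 = u" "N 0 = mcross x u"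
    using soliton_frame_exists[OF x(1,2), of 1 v 0] by auto
  note sol = soliton_frame_imp_soliton[OF sf open_interval_UNIV]
  interpret global_soliton v 1 X T N by standard (rule sf)
  have k: "geodesic_curvature X s = t s" for s using sol(4) by (simp add: t_def)
  have "initial_data v X = (\<alpha>, \<tau>, \<eta>)"
    using x X0 sol(2,3) by (simp add: initial_data_def)
  moreover have "trivial_on UNIV X \<longleftrightarrow> \<alpha> = 0 \<and> \<tau> = 0"
  proof
    assume "trivial_on UNIV X"
    then have t: "t s = 0" for s using k by (simp add: trivial_on_def)
    then have "t = (\<lambda>s. 0)" by auto
    \<comment> \<open>If \<open>t\<close> vanishes identically, so does
      \<open>t' = a + t * e\<close>, which leaves \<open>a 0 = 0\<close>.\<close>
    then have "a 0 + t 0 * e 0 = 0" using dt[of 0] DERIV_const DERIV_unique by metis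
    then show "\<alpha> = 0 \<and> \<tau> = 0" using t[of 0] x X0 by (simp add: a_def t_def)
  next
    assume "\<alpha> = 0 \<and> \<tau> = 0"
    then have "a 0 = 0" "t 0 = 0" using x X0 by (simp_all add: a_def t_def)
    then show "trivial_on UNIV X" using trivial_everywhere(2)[of 0] k by (simp add: trivial_on_def)
  qed
  ultimately show "\<exists>I X. maximal_soliton v I X \<and> 0 \<in> I \<and> initial_data v X = (\<alpha>, \<tau>, \<eta>) \<and>
      (trivial_on I X \<longleftrightarrow> \<alpha> = 0 \<and> \<tau> = 0)"
    using sol(1) maximal_soliton_iff by blast
next
  fix I X assume "maximal_soliton v I X \<and> 0 \<in> I"
  then have "soliton_frame v 1 UNIV X (unit_tangent X) (unit_normal X)"
    using maximal_soliton_iff soliton_imp_soliton_frame by blast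
  then show "initial_data v X \<in> admissible_data v"
    unfolding initial_data_def by (intro frame_data_admissible[OF assms]) (auto simp only: soliton_frame_def)
next
  fix I X J Y
  assume *: "maximal_soliton v I X \<and> maximal_soliton v J Y \<and> 0 \<in> I \<and> 0 \<in> J \<and> initial_data v X = initial_data v Y"
  then show "J = I" by (simp add: maximal_soliton_iff)
  have "soliton_frame v 1 UNIV X (unit_tangent X) (unit_normal X)"
    "soliton_frame v 1 UNIV Y (unit_tangent Y) (unit_normal Y)"
    using * maximal_soliton_iff soliton_imp_soliton_frame by blast+
  from soliton_congruent[OF this] * show "\<exists>A\<in>H2_isometries. \<forall>s\<in>I. Y s = A *v X s"
    by (auto simp: initial_data_def)
next
  fix I X assume "maximal_soliton v I X"
  then have I: "I = UNIV" and sol: "soliton_with_vector_on v UNIV X" by (simp_all add: maximal_soliton_iff)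
  note sf = soliton_imp_soliton_frame[OF sol]
  interpret global_soliton v 1 X "unit_tangent X" "unit_normal X" by standard (rule sf)
  have k: "geodesic_curvature X = t"
    using soliton_frame_imp_soliton(4)[OF sf open_interval_UNIV] by (auto simp: t_def)
  show "I = UNIV" by (rule I)
  show "csf_soliton_on I X" using soliton_is_csf[OF sf] I by simp
  have "regular_curve_on UNIV X" using sol by (simp add: soliton_with_vector_on_def arclength_curve_on_def)
  then show "embedded_curve_on I X"
    using proper_injection_homeomorphism[OF continuous_X inj_X norm_X_filterlim]
    by (simp add: embedded_curve_on_def I)
  show "\<exists>c\<in>{-1, 0, 1}. (geodesic_curvature X \<longlongrightarrow> c) at_top" using t_tendsto k by simp
  show "\<exists>c\<in>{-1, 0, 1}. (geodesic_curvature X \<longlongrightarrow> c) at_bot" using t_tendsto_at_bot k by simp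
qed

end
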